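(* Let $(Q,g_Q)$ be a leaf space represented by $(M,\mathcal{F},g)$, so that $Q=M/\mathcal{F}$, with mean curvature vector field $H$, and write $g=g_Q+g_L$ on $M_{reg}$. Then there exists an infinite subfamily $\mathcal{R}_\mu(Q,g_Q,H)\subset\mathcal{R}(Q,g_Q)$ of representations of $(Q,g_Q)$, indexed by $\mu\in\mathbb{R}^+=(0,\infty)$, such that each member has ambient space $M$ but with the leaf-wise metric $g_L$ rescaled by the constant $\mu$ on $M_{reg}$, and such that all members of the family are basic isospectral (to one another).
   Context: Let $(M,\mathcal{F})$ be a (possibly singular) Riemannian foliation with closed, not necessarily connected, leaves on a compact manifold $M$, with adapted Riemannian metric $g$ (a geodesic orthogonal to one leaf is orthogonal to every leaf it meets). The leaf space $Q=M/\mathcal{F}$ carries the metric $g_Q$ induced by restricting $g$ to vectors orthogonal to the leaves. A triple $(M,\mathcal{F},g)$ giving rise to $(Q,g_Q)$ is called a representation of $(Q,g_Q)$; $\mathcal{R}(Q,g_Q)$ denotes the set of all representations. $M_{reg}$ is the open dense set where the leaf dimension is maximal. In distinguished coordinates $(x,y)$ on $M_{reg}$ ($x$ transverse, $y$ leaf-wise) the metric has the form $g(x,y)=g_Q(x)+g_L(x,y)$, where $g_L$ is the leaf-wise metric. A function on $M$ is basic if it is constant along the leaves. The basic Laplacian $\Delta_B$ is the restriction of the Laplacian of $(M,g)$ to smooth basic functions, and its spectrum is the basic spectrum $spec_B(M,\mathcal{F})$. Two representations are basic isospectral if they have the same basic spectrum. The mean curvature vector field $H$ is defined on $M_{reg}$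 and satisfies $H(x)=\nabla\log(1/Lvol(x))$, where $Lvol(x)$ is the volume of the leaf through $x$. Standing assumption: every representation is generalized isoparametric, i.e. its mean curvature vector field is basic.
   Formalization: If there are singular leaves, members are representations only with metric smooth and adapted on M_reg (g_Q+μg_L does not extend smoothly for μ≠1), the eigenvalue equation being imposed there; the family is claimed infinite only if some leaf has positive dimension. *)

theory Defs
  imports "HOL-Analysis.Analysis" "HOL-Library.Function_Algebras" "HOL-Library.Extended_Nat"
begin

section \<open>Smooth manifolds\<close>

text \<open>
  The ambient manifold is a whole type \<open>'m\<close> with an atlas \<open>A\<close> of charts into \<open>real ^ 'n\<close>; a chart
  is a pair of its domain and its coordinate map.  Tensor fields are families of components, one for
  each chart, related by the usual transformation law.
\<close>

type_synonym ('m, 'n) chart = "'m set \<times> ('m \<Rightarrow> real ^ 'n)"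
type_synonym ('m, 'n) vfield = "('m, 'n) chart \<Rightarrow> 'm \<Rightarrow> real ^ 'n"
type_synonym ('m, 'n) tensor2 = "('m, 'n) chart \<Rightarrow> 'm \<Rightarrow> real ^ 'n ^ 'n"

primrec C_k :: "nat \<Rightarrow> 'a::euclidean_space set \<Rightarrow> ('a \<Rightarrow> 'b::real_normed_vector) \<Rightarrow> bool" where
  "C_k 0 S f \<longleftrightarrow> continuous_on S f"
| "C_k (Suc k) S f \<longleftrightarrow> (\<forall>x\<in>S. f differentiable at x) \<and>
     (\<forall>b\<in>Basis. C_k k S (\<lambda>x. frechet_derivative f (at x) b))"

definition smooth_on :: "'a::euclidean_space set \<Rightarrow> ('a \<Rightarrow> 'b::real_normed_vector) \<Rightarrow> bool" where
  "smooth_on S f \<longleftrightarrow> (\<forall>k. C_k k S f)"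

definition chart_range :: "('m, 'n) chart \<Rightarrow> (real ^ 'n) set" where
  "chart_range c = snd c ` fst c"

definition chart_inv :: "('m, 'n) chart \<Rightarrow> real ^ 'n \<Rightarrow> 'm" where
  "chart_inv c = inv_into (fst c) (snd c)"

definition smooth_atlas :: "('m::t2_space, 'n::finite) chart set \<Rightarrow> bool" where
  "smooth_atlas A \<longleftrightarrow>
     (\<Union>c\<in>A. fst c) = UNIV \<and>
     (\<forall>c\<in>A. open (fst c) \<and> open (chart_range c) \<and>
        homeomorphism (fst c) (chart_range c) (snd c) (chart_inv c)) \<and>
     (\<forall>c\<in>A. \<forall>d\<in>A. smooth_on (snd c ` (fst c \<inter> fst d)) (snd d \<circ> chart_inv c))"

definition compact_manifold :: "('m::t2_space, 'n::finite) chart set \<Rightarrow> bool" where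
  "compact_manifold A \<longleftrightarrow> compact (UNIV :: 'm set) \<and> smooth_atlas A"

text \<open>Jacobian at \<open>x\<close> of the change of coordinates from \<open>c\<close> to \<open>d\<close>.\<close>

definition jacobian :: "('m, 'n::finite) chart \<Rightarrow> ('m, 'n) chart \<Rightarrow> 'm \<Rightarrow> real ^ 'n ^ 'n" where
  "jacobian c d x = matrix (frechet_derivative (snd d \<circ> chart_inv c) (at (snd c x)))"

definition smooth_fun :: "('m::t2_space, 'n::finite) chart set \<Rightarrow> 'm set \<Rightarrow> ('m \<Rightarrow> real) \<Rightarrow> bool" where
  "smooth_fun A U f \<longleftrightarrow> (\<forall>c\<in>A. smooth_on (snd c ` (fst c \<inter> U)) (f \<circ> chart_inv c))"

definition dfun :: "('m, 'n::finite) chart \<Rightarrow> ('m \<Rightarrow> real) \<Rightarrow> 'm \<Rightarrow> real ^ 'n \<Rightarrow> real" where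
  "dfun c f x v = frechet_derivative (f \<circ> chart_inv c) (at (snd c x)) v"

definition smooth_vector_field ::
    "('m::t2_space, 'n::finite) chart set \<Rightarrow> ('m, 'n) vfield \<Rightarrow> bool" where
  "smooth_vector_field A X \<longleftrightarrow>
     (\<forall>c\<in>A. smooth_on (chart_range c) (\<lambda>z. X c (chart_inv c z))) \<and>
     (\<forall>c\<in>A. \<forall>d\<in>A. \<forall>x\<in>fst c \<inter> fst d. X d x = jacobian c d x *v X c x)"

definition smooth_curve ::
    "('m::t2_space, 'n::finite) chart set \<Rightarrow> real set \<Rightarrow> (real \<Rightarrow> 'm) \<Rightarrow> bool" where
  "smooth_curve A I \<gamma> \<longleftrightarrow> continuous_on I \<gamma> \<and>
     (\<forall>c\<in>A. smooth_on {t \<in> I. \<gamma> t \<in> fst c} (snd c \<circ> \<gamma>))"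

definition velocity :: "('m, 'n::finite) chart \<Rightarrow> (real \<Rightarrow> 'm) \<Rightarrow> real \<Rightarrow> real ^ 'n" where
  "velocity c \<gamma> t = vector_derivative (snd c \<circ> \<gamma>) (at t)"


section \<open>Riemannian metrics\<close>

definition ip :: "('m, 'n::finite) tensor2 \<Rightarrow> ('m, 'n) chart \<Rightarrow> 'm \<Rightarrow> real ^ 'n \<Rightarrow> real ^ 'n \<Rightarrow> real" where
  "ip g c x u v = u \<bullet> (g c x *v v)"

text \<open>
  A field of inner products on all tangent spaces, depending smoothly on the point of \<open>S\<close>; for
  \<open>S = UNIV\<close> this is a Riemannian metric.  Components that have no meaning (chart not in the atlas,
  point outside the chart) are fixed to be \<open>0\<close>, so that equality of component families is equality
  of tensor fields.
\<close>

definition riemannian_metric ::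
    "('m::t2_space, 'n::finite) chart set \<Rightarrow> 'm set \<Rightarrow> ('m, 'n) tensor2 \<Rightarrow> bool" where
  "riemannian_metric A S g \<longleftrightarrow>
     (\<forall>c x. \<not> (c \<in> A \<and> x \<in> fst c) \<longrightarrow> g c x = 0) \<and>
     (\<forall>c\<in>A. \<forall>x\<in>fst c. transpose (g c x) = g c x \<and> (\<forall>v. v \<noteq> 0 \<longrightarrow> ip g c x v v > 0)) \<and>
     (\<forall>c\<in>A. \<forall>d\<in>A. \<forall>x\<in>fst c \<inter> fst d.
        g c x = transpose (jacobian c d x) ** g d x ** jacobian c d x) \<and>
     (\<forall>c\<in>A. smooth_on (snd c ` (fst c \<inter> S)) (\<lambda>z. g c (chart_inv c z)))"

definition dmetric :: "('m, 'n::finite) tensor2 \<Rightarrow> ('m, 'n) chart \<Rightarrow> 'm \<Rightarrow> real ^ 'n \<Rightarrow> real ^ 'n ^ 'n" where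
  "dmetric g c x w = frechet_derivative (\<lambda>z. g c (chart_inv c z)) (at (snd c x)) w"

text \<open>
  \<open>\<Gamma>(u, v)\<^sup>k = \<Sum>i j l. 1/2 g\<^sup>k\<^sup>l (\<partial>\<^sub>i g\<^sub>j\<^sub>l + \<partial>\<^sub>j g\<^sub>i\<^sub>l - \<partial>\<^sub>l g\<^sub>i\<^sub>j) u\<^sup>i v\<^sup>j\<close>.
\<close>

definition christoffel ::
    "('m, 'n::finite) tensor2 \<Rightarrow> ('m, 'n) chart \<Rightarrow> 'm \<Rightarrow> real ^ 'n \<Rightarrow> real ^ 'n \<Rightarrow> real ^ 'n" where
  "christoffel g c x u v = matrix_inv (g c x) *v
     (\<chi> l. ((dmetric g c x u *v v) $ l + (dmetric g c x v *v u) $ l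
            - u \<bullet> (dmetric g c x (axis l 1) *v v)) / 2)"

definition geodesic ::
    "('m::t2_space, 'n::finite) chart set \<Rightarrow> ('m, 'n) tensor2 \<Rightarrow> real set \<Rightarrow> (real \<Rightarrow> 'm) \<Rightarrow> bool" where
  "geodesic A g I \<gamma> \<longleftrightarrow> open I \<and> is_interval I \<and> smooth_curve A I \<gamma> \<and>
     (\<forall>c\<in>A. \<forall>t\<in>I. \<gamma> t \<in> fst c \<longrightarrow>
        vector_derivative (velocity c \<gamma>) (at t)
          + christoffel g c (\<gamma> t) (velocity c \<gamma> t) (velocity c \<gamma> t) = 0)"

definition grad :: "('m, 'n::finite) tensor2 \<Rightarrow> ('m, 'n) chart \<Rightarrow> ('m \<Rightarrow> real) \<Rightarrow> 'm \<Rightarrow> real ^ 'n" where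
  "grad g c f x = matrix_inv (g c x) *v (\<chi> i. dfun c f x (axis i 1))"

text \<open>
  The nonnegative Laplacian \<open>- div grad\<close>, i.e.
  \<open>- (1 / \<surd>det g) \<Sum>i. \<partial>\<^sub>i (\<surd>det g (grad f)\<^sup>i)\<close>, in the coordinates of \<open>c\<close>.
\<close>

definition laplacian :: "('m, 'n::finite) tensor2 \<Rightarrow> ('m, 'n) chart \<Rightarrow> ('m \<Rightarrow> real) \<Rightarrow> 'm \<Rightarrow> real" where
  "laplacian g c f x =
     - (1 / sqrt (det (g c x))) *
       (\<Sum>i\<in>UNIV. frechet_derivative
          (\<lambda>z. sqrt (det (g c (chart_inv c z))) * grad g c f (chart_inv c z) $ i)
          (at (snd c x)) (axis i 1))"


section \<open>Foliations with closed leaves\<close>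

definition leaf_of :: "'m set set \<Rightarrow> 'm \<Rightarrow> 'm set" where
  "leaf_of F x = (THE L. L \<in> F \<and> x \<in> L)"

text \<open>Velocities at \<open>x\<close>, in the coordinates of \<open>c\<close>, of the smooth curves inside the leaf of \<open>x\<close>.\<close>

definition leaf_tangent :: "'m set set \<Rightarrow> ('m, 'n::finite) chart \<Rightarrow> 'm \<Rightarrow> (real ^ 'n) set" where
  "leaf_tangent F c x = {v. \<exists>e>0. \<exists>z. smooth_on {-e<..<e} z \<and>
     (\<forall>t\<in>{-e<..<e}. z t \<in> chart_range c \<and> chart_inv c (z t) \<in> leaf_of F x) \<and>
     z 0 = snd c x \<and> v = vector_derivative z (at (0::real))}"

text \<open>
  Embedded submanifolds, by slice charts.  \<open>smooth_atlas (insert c A)\<close> says that \<open>c\<close> belongs to the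
  maximal atlas of \<open>A\<close>.
\<close>

definition embedded_submanifold ::
    "('m::t2_space, 'n::finite) chart set \<Rightarrow> 'm set \<Rightarrow> bool" where
  "embedded_submanifold A L \<longleftrightarrow> (\<exists>k. \<forall>x\<in>L. \<exists>c K. smooth_atlas (insert c A) \<and> x \<in> fst c \<and>
     card K = k \<and> snd c ` (fst c \<inter> L) = chart_range c \<inter> {z. \<forall>i. i \<notin> K \<longrightarrow> z $ i = 0})"

definition regular_set :: "('m, 'n::finite) chart set \<Rightarrow> 'm set set \<Rightarrow> 'm set" where
  "regular_set A F = {x. \<exists>c\<in>A. x \<in> fst c \<and>
     (\<forall>d\<in>A. \<forall>y\<in>fst d. dim (leaf_tangent F d y) \<le> dim (leaf_tangent F c x))}"

text \<open>
  The last condition, that the regular set is dense, is automatic when the manifold is connected.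
\<close>

definition smooth_foliation ::
    "('m::t2_space, 'n::finite) chart set \<Rightarrow> 'm set set \<Rightarrow> bool" where
  "smooth_foliation A F \<longleftrightarrow>
     partition_on UNIV F \<and>
     (\<forall>L\<in>F. closed L \<and> embedded_submanifold A L) \<and>
     (\<forall>c\<in>A. \<forall>x\<in>fst c. \<forall>v\<in>leaf_tangent F c x. \<exists>X. smooth_vector_field A X \<and>
        (\<forall>d\<in>A. \<forall>y\<in>fst d. X d y \<in> leaf_tangent F d y) \<and> X c x = v) \<and>
     closure (regular_set A F) = UNIV"

definition orthogonal_at ::
    "('m::t2_space, 'n::finite) chart set \<Rightarrow> 'm set set \<Rightarrow> ('m, 'n) tensor2 \<Rightarrow> (real \<Rightarrow> 'm) \<Rightarrow> real \<Rightarrow> bool" where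
  "orthogonal_at A F g \<gamma> t \<longleftrightarrow> (\<forall>c\<in>A. \<gamma> t \<in> fst c \<longrightarrow>
     (\<forall>v\<in>leaf_tangent F c (\<gamma> t). ip g c (\<gamma> t) (velocity c \<gamma> t) v = 0))"

definition adapted ::
    "('m::t2_space, 'n::finite) chart set \<Rightarrow> 'm set set \<Rightarrow> 'm set \<Rightarrow> ('m, 'n) tensor2 \<Rightarrow> bool" where
  "adapted A F S g \<longleftrightarrow> (\<forall>I \<gamma>. geodesic A g I \<gamma> \<and> \<gamma> ` I \<subseteq> S \<and> (\<exists>t\<in>I. orthogonal_at A F g \<gamma> t) \<longrightarrow>
     (\<forall>t\<in>I. orthogonal_at A F g \<gamma> t))"

definition basic_on :: "'m set set \<Rightarrow> 'm set \<Rightarrow> ('m \<Rightarrow> real) \<Rightarrow> bool" where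
  "basic_on F U f \<longleftrightarrow> (\<forall>L\<in>F. \<forall>x\<in>L \<inter> U. \<forall>y\<in>L \<inter> U. f x = f y)"

definition saturated :: "'m set set \<Rightarrow> 'm set \<Rightarrow> bool" where
  "saturated F U \<longleftrightarrow> (\<forall>L\<in>F. L \<inter> U \<noteq> {} \<longrightarrow> L \<subseteq> U)"

definition vproj ::
    "'m set set \<Rightarrow> ('m, 'n::finite) tensor2 \<Rightarrow> ('m, 'n) chart \<Rightarrow> 'm \<Rightarrow> real ^ 'n \<Rightarrow> real ^ 'n" where
  "vproj F g c x u = (THE v. v \<in> leaf_tangent F c x \<and>
     (\<forall>w\<in>leaf_tangent F c x. ip g c x (u - v) w = 0))"

definition hproj ::
    "'m set set \<Rightarrow> ('m, 'n::finite) tensor2 \<Rightarrow> ('m, 'n) chart \<Rightarrow> 'm \<Rightarrow> real ^ 'n \<Rightarrow> real ^ 'n" where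
  "hproj F g c x u = u - vproj F g c x u"

text \<open>
  The two summands of \<open>g = g\<^sub>Q + g\<^sub>L\<close>.  The metric of the leaf space is given through its pullback to
  the manifold, the restriction of \<open>g\<close> to vectors orthogonal to the leaves.
\<close>

definition transverse_metric ::
    "('m, 'n::finite) chart set \<Rightarrow> 'm set set \<Rightarrow> ('m, 'n) tensor2 \<Rightarrow> ('m, 'n) tensor2" where
  "transverse_metric A F g c x = (if c \<in> A \<and> x \<in> fst c
     then \<chi> i j. ip g c x (hproj F g c x (axis i 1)) (hproj F g c x (axis j 1)) else 0)"

definition leaf_metric ::
    "('m, 'n::finite) chart set \<Rightarrow> 'm set set \<Rightarrow> ('m, 'n) tensor2 \<Rightarrow> ('m, 'n) tensor2" where
  "leaf_metric A F g c x = (if c \<in> A \<and> x \<in> fst c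
     then \<chi> i j. ip g c x (vproj F g c x (axis i 1)) (vproj F g c x (axis j 1)) else 0)"

text \<open>
  The transverse metric passes to the leaf space: \<open>g(grad f, grad h)\<close> is basic whenever \<open>f\<close> and \<open>h\<close>
  are.  For connected leaves this follows from adaptedness; for disconnected leaves it does not
  (consider the orbits of a fixed-point free involution that is not an isometry).
\<close>

definition descends ::
    "('m::t2_space, 'n::finite) chart set \<Rightarrow> 'm set set \<Rightarrow> 'm set \<Rightarrow> ('m, 'n) tensor2 \<Rightarrow> bool" where
  "descends A F S g \<longleftrightarrow> (\<forall>U f h. open U \<and> U \<subseteq> S \<and> saturated F U \<and>
     smooth_fun A U f \<and> basic_on F U f \<and> smooth_fun A U h \<and> basic_on F U h \<longrightarrow>
     (\<forall>c\<in>A. \<forall>d\<in>A. \<forall>x\<in>fst c \<inter> U. \<forall>y\<in>fst d \<inter> U. leaf_of F x = leaf_of F y \<longrightarrow>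
        ip g c x (grad g c f x) (grad g c h x) = ip g d y (grad g d f y) (grad g d h y)))"

text \<open>
  The mean curvature vector is the trace \<open>\<Sum>i. (\<nabla>\<^bsub>E\<^sub>i\<^esub> E\<^sub>i)\<^sup>h\<^sup>o\<^sup>r\<close> of the second fundamental form of
  the leaf, where the \<open>E\<^sub>i\<close> are local smooth fields tangent to the leaves that form an orthonormal
  basis of the tangent space of the leaf at \<open>x\<close>.
\<close>

definition vertical_frame ::
    "'m set set \<Rightarrow> ('m, 'n::finite) tensor2 \<Rightarrow> ('m, 'n) chart \<Rightarrow> 'm \<Rightarrow>
     'n set \<Rightarrow> ('n \<Rightarrow> real ^ 'n \<Rightarrow> real ^ 'n) \<Rightarrow> bool" where
  "vertical_frame F g c x K E \<longleftrightarrow>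
     (\<exists>W. open W \<and> snd c x \<in> W \<and> W \<subseteq> chart_range c \<and>
        (\<forall>i\<in>K. smooth_on W (E i) \<and> (\<forall>z\<in>W. E i z \<in> leaf_tangent F c (chart_inv c z)))) \<and>
     (\<forall>i\<in>K. \<forall>j\<in>K. ip g c x (E i (snd c x)) (E j (snd c x)) = (if i = j then 1 else 0)) \<and>
     span ((\<lambda>i. E i (snd c x)) ` K) = leaf_tangent F c x"

definition covariant_derivative ::
    "('m, 'n::finite) tensor2 \<Rightarrow> ('m, 'n) chart \<Rightarrow> 'm \<Rightarrow>
     (real ^ 'n \<Rightarrow> real ^ 'n) \<Rightarrow> (real ^ 'n \<Rightarrow> real ^ 'n) \<Rightarrow> real ^ 'n" where
  "covariant_derivative g c x X Y =
     frechet_derivative Y (at (snd c x)) (X (snd c x)) + christoffel g c x (X (snd c x)) (Y (snd c x))"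

definition mean_curvature :: "'m set set \<Rightarrow> ('m, 'n::finite) tensor2 \<Rightarrow> ('m, 'n) vfield" where
  "mean_curvature F g c x = (THE h. \<exists>K E. vertical_frame F g c x K E \<and>
     h = (\<Sum>i\<in>K. hproj F g c x (covariant_derivative g c x (E i) (E i))))"

text \<open>
  Basic vector fields: horizontal and projectable to the leaf space, that is, mapping basic functions
  to basic functions.
\<close>

definition basic_vector_field ::
    "('m::t2_space, 'n::finite) chart set \<Rightarrow> 'm set set \<Rightarrow> ('m, 'n) tensor2 \<Rightarrow> 'm set \<Rightarrow> ('m, 'n) vfield \<Rightarrow> bool" where
  "basic_vector_field A F g S X \<longleftrightarrow>
     (\<forall>c\<in>A. \<forall>x\<in>fst c \<inter> S. \<forall>v\<in>leaf_tangent F c x. ip g c x (X c x) v = 0) \<and>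
     (\<forall>U f. open U \<and> U \<subseteq> S \<and> saturated F U \<and> smooth_fun A U f \<and> basic_on F U f \<longrightarrow>
        (\<forall>c\<in>A. \<forall>d\<in>A. \<forall>x\<in>fst c \<inter> U. \<forall>y\<in>fst d \<inter> U. leaf_of F x = leaf_of F y \<longrightarrow>
           dfun c f x (X c x) = dfun d f y (X d y)))"

definition generalized_isoparametric ::
    "('m::t2_space, 'n::finite) chart set \<Rightarrow> 'm set set \<Rightarrow> ('m, 'n) tensor2 \<Rightarrow> bool" where
  "generalized_isoparametric A F g \<longleftrightarrow>
     basic_vector_field A F g (regular_set A F) (mean_curvature F g)"


section \<open>Representations of a leaf space and basic spectra\<close>

text \<open>
  Generalized isoparametric Riemannian foliations whose metric is smooth and adapted on \<open>S\<close>.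
\<close>

definition riemannian_foliation ::
    "('m::t2_space, 'n::finite) chart set \<Rightarrow> 'm set set \<Rightarrow> 'm set \<Rightarrow> ('m, 'n) tensor2 \<Rightarrow> bool" where
  "riemannian_foliation A F S g \<longleftrightarrow>
     compact_manifold A \<and> smooth_foliation A F \<and> riemannian_metric A S g \<and>
     adapted A F S g \<and> descends A F S g \<and> generalized_isoparametric A F g"

text \<open>
  \<open>representations Q gQ\<close> is the set of representations of \<open>(Q, gQ)\<close> in the strict sense, with a
  Riemannian metric on the whole manifold.  If there are singular leaves and \<open>\<mu> \<noteq> 1\<close>, the metric
  \<open>g\<^sub>Q + \<mu> g\<^sub>L\<close> on the regular set has in general no smooth (not even a continuous) extension to the
  manifold: for the rotations of the round sphere it is \<open>dr\<^sup>2 + \<mu> sin\<^sup>2 r d\<theta>\<^sup>2\<close>, with conical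
  points at the poles.  \<open>representations_reg\<close> therefore asks for smoothness and adaptedness of the
  metric only on the regular set; at singular points there is still an inner product, with the
  prescribed transverse part.  The two notions agree for regular foliations.
\<close>

definition representations ::
    "'m::t2_space set set \<Rightarrow> ('m, 'n::finite) tensor2 \<Rightarrow>
     (('m, 'n) chart set \<times> 'm set set \<times> ('m, 'n) tensor2) set" where
  "representations Q gQ =
     {(A, F, g). riemannian_foliation A F UNIV g \<and> Q = F \<and> gQ = transverse_metric A F g}"

definition representations_reg ::
    "'m::t2_space set set \<Rightarrow> ('m, 'n::finite) tensor2 \<Rightarrow>
     (('m, 'n) chart set \<times> 'm set set \<times> ('m, 'n) tensor2) set" where
  "representations_reg Q gQ =
     {(A, F, g). riemannian_foliation A F (regular_set A F) g \<and> Q = F \<and> gQ = transverse_metric A F g}"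

definition basic_eigenspace ::
    "('m::t2_space, 'n::finite) chart set \<Rightarrow> 'm set set \<Rightarrow> 'm set \<Rightarrow> ('m, 'n) tensor2 \<Rightarrow> real \<Rightarrow> ('m \<Rightarrow> real) set" where
  "basic_eigenspace A F S g lam = {f. smooth_fun A UNIV f \<and> basic_on F UNIV f \<and>
     (\<forall>c\<in>A. \<forall>x\<in>fst c \<inter> S. laplacian g c f x = lam * f x)}"

text \<open>
  The spectrum is encoded by its multiplicity function: \<open>lam\<close> is an eigenvalue iff its value is
  nonzero.  The Laplacian is evaluated on the set \<open>S\<close> where the metric is smooth; the eigenfunctions
  are smooth on the whole manifold.
\<close>

definition basic_spectrum ::
    "('m::t2_space, 'n::finite) chart set \<Rightarrow> 'm set set \<Rightarrow> 'm set \<Rightarrow> ('m, 'n) tensor2 \<Rightarrow> real \<Rightarrow> enat" where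
  "basic_spectrum A F S g lam =
     (SUP B\<in>{B. finite B \<and> B \<subseteq> basic_eigenspace A F S g lam \<and>
        \<not> module.dependent (\<lambda>(a::real) f x. a * f x) B}. enat (card B))"

end

theory Submission
  imports Defs
begin

text \<open>
  For \<open>\<mu> > 0\<close> let \<open>g\<^sub>\<mu> = g\<^sub>Q + \<mu> g\<^sub>L\<close>: lengths along the leaves are rescaled by a constant, while horizontal
  vectors keep their lengths and stay horizontal.  Writing \<open>P\<close> for the \<open>g\<close>-orthogonal projection onto
  the tangent spaces of the leaves, \<open>g\<^sub>\<mu> = g (1 + (\<mu> - 1) P)\<close>, and everything follows from two facts: the
  two metrics have the same horizontal vectors and agree on them, and they differ by the constant
  factor \<open>\<mu>\<close> on vertical vectors.  Near a regular point \<open>P\<close> is smooth, since the leaves have constant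
  dimension there and vertical vector fields form a local frame.

  The transverse metric is unchanged by construction.  The gradient of a basic function is horizontal,
  hence the same for all \<open>g\<^sub>\<mu>\<close>, and the volume density of \<open>g\<^sub>\<mu>\<close> on the regular set is that of \<open>g\<close> times the
  constant \<open>\<mu>\<^sup>k\<^sup>/\<^sup>2\<close>, where \<open>k\<close> is the dimension of the regular leaves.  So the Laplacians agree on basic
  functions at regular points (\<open>laplacian_rescaled\<close>), and by density and continuity an eigenfunction for
  one metric is one for all, with the same eigenvalue (\<open>basic_eigenspace_rescaled\<close>).  A similar
  computation shows that the mean curvature vector does not change: the second fundamental form of a
  leaf scales by \<open>\<mu>\<close>, and its trace is taken over frames that scale by \<open>1 / \<surd>\<mu>\<close>
  (\<open>mean_curvature_rescaled\<close>).

  The remaining point is that \<open>g\<^sub>\<mu>\<close> is again adapted, a statement about all its geodesics.  Adaptedness of a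
  metric is equivalent to an infinitesimal condition: the Lie derivative \<open>(L\<^sub>X g)(u, u)\<close> vanishes for
  every vertical field \<open>X\<close> and horizontal vector \<open>u\<close>.  This condition follows from adaptedness by
  differentiating \<open>g(\<gamma>', X)\<close> along a geodesic with initial velocity \<open>u\<close>
  (\<open>adapted_imp_half_lie_zero\<close>); the existence of that geodesic rests on the Picard theorem and on the
  invariance of the geodesic equation under changes of charts.  Conversely, under this condition the
  pairings of \<open>\<gamma>'\<close> with a vertical frame satisfy a homogeneous linear differential equation, so that they
  vanish identically once they vanish at one time (\<open>half_lie_zero_imp_adapted\<close>).  The condition passes
  from \<open>g\<close> to \<open>g\<^sub>\<mu>\<close>, because \<open>g\<^sub>\<mu> - g\<close> is a multiple of the quadratic form \<open>u \<mapsto> g(P u, P u)\<close>, which vanishes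
  to second order at horizontal vectors (\<open>rescaled_adapted\<close>).
\<close>

section \<open>Smooth functions\<close>

lemma frechet_derivative_eq:
  "(f has_derivative f') (at x) \<Longrightarrow> frechet_derivative f (at x) = f'"
  using frechet_derivative_at by metis

lemma differentiable_cong_open:
  assumes "open S" "x \<in> S" "\<And>y. y \<in> S \<Longrightarrow> f y = g y"
  shows "f differentiable at x \<longleftrightarrow> g differentiable at x"
  unfolding differentiable_def
  using has_derivative_transform_within_open[OF _ assms(1,2), of f _ UNIV g]
    has_derivative_transform_within_open[OF _ assms(1,2), of g _ UNIV f] assms(3) by metis

lemma frechet_derivative_cong_open:
  assumes "open S" "x \<in> S" "\<And>y. y \<in> S \<Longrightarrow> f y = g y"
  shows "frechet_derivative f (at x) = frechet_derivative g (at x)"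
proof (cases "f differentiable at x")
  case True
  then show ?thesis using frechet_derivative_transform_within_open assms by blast
next
  case False
  then have "\<not> g differentiable at x" using differentiable_cong_open[OF assms] by simp
  moreover have "\<And>D. (f has_derivative D) (at x) = (g has_derivative D) (at x)"
    using False calculation unfolding differentiable_def by blast
  ultimately show ?thesis unfolding frechet_derivative_def by simp
qed

text \<open>
  Openness of the domain is what makes \<open>C_k\<close> depend only on the values of the function on the set:
  the derivatives in its definition are taken in the whole space.
\<close>

lemma C_k_cong:
  assumes "open S" "\<And>x. x \<in> S \<Longrightarrow> f x = g x"
  shows "C_k k S f \<longleftrightarrow> C_k k S g"
  using assms(2)
proof (induction k arbitrary: f g)
  case 0
  then show ?case by simp
next
  case (Suc k)
  have 1: "f differentiable at x \<longleftrightarrow> g differentiable at x" if "x \<in> S" for x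
    using differentiable_cong_open[OF assms(1) that] Suc.prems by blast
  have 2: "frechet_derivative f (at x) = frechet_derivative g (at x)" if "x \<in> S" for x
    using frechet_derivative_cong_open[OF assms(1) that] Suc.prems by blast
  have 3: "C_k k S (\<lambda>x. frechet_derivative f (at x) b) = C_k k S (\<lambda>x. frechet_derivative g (at x) b)" for b
    by (rule Suc.IH) (simp add: 2)
  show ?case using 1 3 by simp
qed

lemma C_k_SucD: "C_k (Suc k) S f \<Longrightarrow> C_k k S f"
proof (induction k arbitrary: f)
  case 0
  then show ?case
    by (auto intro!: continuous_at_imp_continuous_on differentiable_imp_continuous_within)
next
  case (Suc k)
  then show ?case by (metis C_k.simps(2))
qed

lemma C_k_subset: "C_k k S f \<Longrightarrow> T \<subseteq> S \<Longrightarrow> C_k k T f"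
proof (induction k arbitrary: f)
  case 0
  then show ?case using continuous_on_subset by auto
next
  case (Suc k)
  then show ?case by (simp add: subset_iff)
qed

lemma C_k_const: "C_k k S (\<lambda>x. c)"
  by (induction k arbitrary: c) (auto simp: frechet_derivative_const)

lemma C_k_has_derivative: "C_k (Suc k) S f \<Longrightarrow> x \<in> S \<Longrightarrow> (f has_derivative frechet_derivative f (at x)) (at x)"
  by (simp add: frechet_derivative_works[symmetric])

text \<open>
  The induction step of all closure properties below: it is enough to exhibit a derivative and to
  see that its values on basis vectors are one order less smooth.
\<close>

lemma C_k_SucI:
  assumes S: "open S" and d: "\<And>x. x \<in> S \<Longrightarrow> (f has_derivative f' x) (at x)"
    and p: "\<And>b. b \<in> Basis \<Longrightarrow> C_k k S (\<lambda>x. f' x b)"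
  shows "C_k (Suc k) S f"
  unfolding C_k.simps
proof (intro conjI ballI)
  fix x assume "x \<in> S" then show "f differentiable at x" by (rule differentiableI[OF d])
next
  fix b :: 'a assume "b \<in> Basis"
  then show "C_k k S (\<lambda>x. frechet_derivative f (at x) b)"
    using C_k_cong[OF S, of "\<lambda>x. frechet_derivative f (at x) b" "\<lambda>x. f' x b"] frechet_derivative_eq[OF d] p by simp
qed

lemma C_k_bounded_linear:
  assumes L: "bounded_linear L" and S: "open S" and f: "C_k k S f"
  shows "C_k k S (\<lambda>x. L (f x))"
  using f
proof (induction k arbitrary: f)
  case 0
  then show ?case by (auto intro: bounded_linear.continuous_on[OF L])
next
  case (Suc k)
  show ?case
    by (rule C_k_SucI[OF S bounded_linear.has_derivative[OF L C_k_has_derivative[OF Suc.prems]]])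
       (use Suc in auto)
qed

lemma C_k_add:
  assumes S: "open S" and "C_k k S f" "C_k k S g"
  shows "C_k k S (\<lambda>x. f x + g x)"
  using assms(2,3)
proof (induction k arbitrary: f g)
  case 0
  then show ?case by (auto intro: continuous_intros)
next
  case (Suc k)
  show ?case
    by (rule C_k_SucI[OF S has_derivative_add[OF C_k_has_derivative[OF Suc.prems(1)] C_k_has_derivative[OF Suc.prems(2)]]])
       (use Suc in auto)
qed

lemma C_k_bilinear:
  assumes B: "bounded_bilinear B" and S: "open S" and "C_k k S f" "C_k k S g"
  shows "C_k k S (\<lambda>x. B (f x) (g x))"
  using assms(3,4)
proof (induction k arbitrary: f g)
  case 0
  then show ?case by (auto intro: bounded_bilinear.continuous_on[OF B])
next
  case (Suc k)
  show ?case
    by (rule C_k_SucI[OF S bounded_bilinear.FDERIV[OF B C_k_has_derivative[OF Suc.prems(1)] C_k_has_derivative[OF Suc.prems(2)]]];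
        (assumption | intro C_k_add[OF S] Suc.IH))
       (use Suc.prems C_k_SucD[OF Suc.prems(1)] C_k_SucD[OF Suc.prems(2)] in auto)
qed

lemma C_k_sum:
  assumes "open S" "\<And>i. i \<in> I \<Longrightarrow> C_k k S (f i)"
  shows "C_k k S (\<lambda>x. \<Sum>i\<in>I. f i x)"
  using assms(2)
  by (induction I rule: infinite_finite_induct) (auto simp: C_k_const intro: C_k_add[OF assms(1)])

lemma linear_basis_expansion:
  fixes L :: "'a::euclidean_space \<Rightarrow> 'b::real_normed_vector"
  assumes "linear L" shows "L v = (\<Sum>e\<in>Basis. (v \<bullet> e) *\<^sub>R L e)"
  by (subst euclidean_representation[of v, symmetric]) (simp only: linear_sum[OF assms] linear_cmul[OF assms])

text \<open>
  The chain rule writes a partial derivative of the composition as a sum of products of partial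
  derivatives of \<open>f\<close> with partial derivatives of \<open>g\<close> composed with \<open>f\<close>, so that the induction runs over
  all outer functions \<open>g\<close> at once while \<open>f\<close> stays fixed.
\<close>

lemma C_k_compose:
  fixes f :: "'a::euclidean_space \<Rightarrow> 'b::euclidean_space" and g :: "'b \<Rightarrow> 'c::real_normed_vector"
  assumes S: "open S" and T: "open T" and sub: "f ` S \<subseteq> T" and f: "C_k k S f" and g: "C_k k T g"
  shows "C_k k S (\<lambda>x. g (f x))"
  using f g
proof (induction k arbitrary: g)
  case 0
  then show ?case using sub by (auto intro: continuous_on_compose2)
next
  case (Suc k)
  show ?case
  proof (rule C_k_SucI[OF S])
    fix x assume "x \<in> S"
    then have x: "x \<in> S" "f x \<in> T" using sub by auto
    note dg = C_k_has_derivative[OF Suc.prems(2) x(2)]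
    show "((\<lambda>x. g (f x)) has_derivative (\<lambda>b. \<Sum>e\<in>Basis. (frechet_derivative f (at x) b \<bullet> e) *\<^sub>R frechet_derivative g (at (f x)) e)) (at x)"
      using diff_chain_at[OF C_k_has_derivative[OF Suc.prems(1) x(1)] dg]
      unfolding o_def linear_basis_expansion[OF has_derivative_linear[OF dg], symmetric] .
  next
    fix b :: 'a assume "b \<in> Basis"
    then show "C_k k S (\<lambda>x. \<Sum>e\<in>Basis. (frechet_derivative f (at x) b \<bullet> e) *\<^sub>R frechet_derivative g (at (f x)) e)"
      using Suc.prems C_k_SucD[OF Suc.prems(1)]
      by (intro C_k_sum[OF S] C_k_bilinear[OF bounded_bilinear_scaleR S] Suc.IH
          C_k_bounded_linear[OF bounded_linear_inner_left S]) auto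
  qed
qed

lemma C_k_inverse:
  fixes f :: "'a::euclidean_space \<Rightarrow> real"
  assumes S: "open S" and nz: "\<And>x. x \<in> S \<Longrightarrow> f x \<noteq> 0" and f: "C_k k S f"
  shows "C_k k S (\<lambda>x. inverse (f x))"
  using f
proof (induction k)
  case 0
  then show ?case using nz by (auto intro!: continuous_intros)
next
  case (Suc k)
  show ?case
    by (rule C_k_SucI[OF S Deriv.has_derivative_inverse[OF nz C_k_has_derivative[OF Suc.prems]]];
        (assumption | intro C_k_bilinear[OF bounded_bilinear_mult S] C_k_bounded_linear[OF bounded_linear_minus[OF bounded_linear_ident] S]))
       (use Suc.prems Suc.IH[OF C_k_SucD[OF Suc.prems]] in auto)
qed

lemma C_k_sqrt:
  fixes f :: "'a::euclidean_space \<Rightarrow> real"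
  assumes S: "open S" and pos: "\<And>x. x \<in> S \<Longrightarrow> f x > 0" and f: "C_k k S f"
  shows "C_k k S (\<lambda>x. sqrt (f x))"
  using f
proof (induction k)
  case 0
  then show ?case by (auto intro!: continuous_intros)
next
  case (Suc k)
  show ?case
  proof (rule C_k_SucI[OF S])
    fix x assume x: "x \<in> S"
    show "((\<lambda>x. sqrt (f x)) has_derivative (\<lambda>b. frechet_derivative f (at x) b * (inverse (sqrt (f x)) / 2))) (at x)"
      using has_derivative_real_sqrt[OF pos[OF x] C_k_has_derivative[OF Suc.prems x]] by simp
  next
    fix b :: 'a assume "b \<in> Basis"
    then show "C_k k S (\<lambda>x. frechet_derivative f (at x) b * (inverse (sqrt (f x)) / 2))"
      using Suc.prems Suc.IH[OF C_k_SucD[OF Suc.prems]] pos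
      by (intro C_k_bilinear[OF bounded_bilinear_mult S]
          C_k_bounded_linear[OF bounded_linear_divide S] C_k_inverse[OF S]) force+
  qed
qed

lemma C_k_linear:
  assumes L: "bounded_linear L" shows "C_k k S L"
proof (cases k)
  case 0 then show ?thesis by (simp add: linear_continuous_on[OF L])
next
  case (Suc n)
  have d: "(L has_derivative L) (at x)" for x using L by (rule bounded_linear_imp_has_derivative)
  show ?thesis unfolding Suc using d frechet_derivative_eq[OF d]
    by (auto intro: differentiableI simp: C_k_const)
qed

lemma smooth_on_cong:
  assumes "open S" "\<And>x. x \<in> S \<Longrightarrow> f x = g x"
  shows "smooth_on S f \<longleftrightarrow> smooth_on S g"
  using C_k_cong[OF assms(1), of f g] assms(2) unfolding smooth_on_def by simp

text \<open>
  Smoothness is a local property; this allows it to be checked with the help of frames that exist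
  only near a given point.
\<close>

lemma C_k_local:
  assumes "\<And>x. x \<in> S \<Longrightarrow> \<exists>T. open T \<and> x \<in> T \<and> C_k k T f"
  shows "C_k k S f"
  using assms
proof (induction k arbitrary: f)
  case 0
  have "isCont f x" if x: "x \<in> S" for x
  proof -
    obtain T where "open T" "x \<in> T" "continuous_on T f" using 0[OF x] by auto
    then show ?thesis using continuous_on_eq_continuous_at[of T f] by simp
  qed
  then show ?case by (simp add: continuous_at_imp_continuous_on)
next
  case (Suc k)
  have 1: "f differentiable at x" if "x \<in> S" for x using Suc.prems[OF that] by auto
  have 2: "C_k k S (\<lambda>x. frechet_derivative f (at x) b)" if "b \<in> Basis" for b
    by (rule Suc.IH) (use Suc.prems that in force)
  show ?case using 1 2 by simp
qed

lemma smooth_on_local: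
  assumes "\<And>x. x \<in> S \<Longrightarrow> \<exists>T. open T \<and> x \<in> T \<and> smooth_on T f"
  shows "smooth_on S f"
  unfolding smooth_on_def
proof
  fix k show "C_k k S f"
    by (rule C_k_local) (use assms in \<open>auto simp: smooth_on_def\<close>)
qed

lemma smooth_on_subset: "smooth_on S f \<Longrightarrow> T \<subseteq> S \<Longrightarrow> smooth_on T f"
  unfolding smooth_on_def using C_k_subset by blast

lemma smooth_on_const: "smooth_on S (\<lambda>x. c)"
  unfolding smooth_on_def using C_k_const by blast

lemma smooth_on_linear: "bounded_linear L \<Longrightarrow> smooth_on S L"
  unfolding smooth_on_def using C_k_linear by blast

lemma smooth_on_ident: "smooth_on S (\<lambda>x. x)"
  by (rule smooth_on_linear[OF bounded_linear_ident])

lemma smooth_on_bounded_linear: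
  "bounded_linear L \<Longrightarrow> open S \<Longrightarrow> smooth_on S f \<Longrightarrow> smooth_on S (\<lambda>x. L (f x))"
  unfolding smooth_on_def using C_k_bounded_linear by blast

lemma smooth_on_add:
  "open S \<Longrightarrow> smooth_on S f \<Longrightarrow> smooth_on S g \<Longrightarrow> smooth_on S (\<lambda>x. f x + g x)"
  unfolding smooth_on_def using C_k_add by blast

lemma smooth_on_minus:
  "open S \<Longrightarrow> smooth_on S f \<Longrightarrow> smooth_on S (\<lambda>x. - f x)"
  by (rule smooth_on_bounded_linear[OF bounded_linear_minus[OF bounded_linear_ident]])

lemma smooth_on_diff:
  "open S \<Longrightarrow> smooth_on S f \<Longrightarrow> smooth_on S g \<Longrightarrow> smooth_on S (\<lambda>x. f x - g x)"
  using smooth_on_add[of S f "\<lambda>x. - g x"] smooth_on_minus[of S g] by simp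

lemma smooth_on_bilinear:
  "bounded_bilinear B \<Longrightarrow> open S \<Longrightarrow> smooth_on S f \<Longrightarrow> smooth_on S g \<Longrightarrow> smooth_on S (\<lambda>x. B (f x) (g x))"
  unfolding smooth_on_def using C_k_bilinear by blast

lemmas smooth_on_mult = smooth_on_bilinear[OF bounded_bilinear_mult]
lemmas smooth_on_scaleR = smooth_on_bilinear[OF bounded_bilinear_scaleR]
lemmas smooth_on_inner = smooth_on_bilinear[OF bounded_bilinear_inner]

lemma smooth_on_sum:
  "open S \<Longrightarrow> (\<And>i. i \<in> I \<Longrightarrow> smooth_on S (f i)) \<Longrightarrow> smooth_on S (\<lambda>x. \<Sum>i\<in>I. f i x)"
  unfolding smooth_on_def by (simp add: C_k_sum)

lemma smooth_on_prod:
  fixes f :: "'i \<Rightarrow> 'a::euclidean_space \<Rightarrow> real"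
  assumes "open S" "\<And>i. i \<in> I \<Longrightarrow> smooth_on S (f i)"
  shows "smooth_on S (\<lambda>x. \<Prod>i\<in>I. f i x)"
  using assms(2)
  by (induction I rule: infinite_finite_induct) (auto simp: smooth_on_const intro: smooth_on_mult[OF assms(1)])

lemma smooth_on_compose:
  fixes f :: "'a::euclidean_space \<Rightarrow> 'b::euclidean_space" and g :: "'b \<Rightarrow> 'c::real_normed_vector"
  assumes "open S" "open T" "f ` S \<subseteq> T" "smooth_on S f" "smooth_on T g"
  shows "smooth_on S (\<lambda>x. g (f x))"
  unfolding smooth_on_def
proof
  fix k show "C_k k S (\<lambda>x. g (f x))"
    using C_k_compose[OF assms(1-3), of k g] assms(4,5) unfolding smooth_on_def by simp
qed

lemma smooth_on_inverse:
  fixes f :: "'a::euclidean_space \<Rightarrow> real"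
  shows "open S \<Longrightarrow> (\<And>x. x \<in> S \<Longrightarrow> f x \<noteq> 0) \<Longrightarrow> smooth_on S f \<Longrightarrow> smooth_on S (\<lambda>x. inverse (f x))"
  unfolding smooth_on_def by (simp add: C_k_inverse)

lemma smooth_on_divide:
  fixes f :: "'a::euclidean_space \<Rightarrow> real"
  shows "open S \<Longrightarrow> (\<And>x. x \<in> S \<Longrightarrow> g x \<noteq> 0) \<Longrightarrow> smooth_on S f \<Longrightarrow> smooth_on S g \<Longrightarrow> smooth_on S (\<lambda>x. f x / g x)"
  unfolding divide_inverse by (intro smooth_on_mult smooth_on_inverse)

lemma smooth_on_sqrt:
  fixes f :: "'a::euclidean_space \<Rightarrow> real"
  shows "open S \<Longrightarrow> (\<And>x. x \<in> S \<Longrightarrow> f x > 0) \<Longrightarrow> smooth_on S f \<Longrightarrow> smooth_on S (\<lambda>x. sqrt (f x))"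
  unfolding smooth_on_def by (simp add: C_k_sqrt)

lemma smooth_on_imp_continuous_on: "smooth_on S f \<Longrightarrow> continuous_on S f"
  unfolding smooth_on_def using C_k.simps(1) by blast

lemma smooth_on_imp_differentiable: "smooth_on S f \<Longrightarrow> x \<in> S \<Longrightarrow> f differentiable at x"
  unfolding smooth_on_def using C_k.simps(2)[of 0 S f] by blast

lemma smooth_on_has_derivative:
  "smooth_on S f \<Longrightarrow> x \<in> S \<Longrightarrow> (f has_derivative frechet_derivative f (at x)) (at x)"
  using smooth_on_imp_differentiable frechet_derivative_works by blast

lemma smooth_on_partial:
  "smooth_on S f \<Longrightarrow> b \<in> Basis \<Longrightarrow> smooth_on S (\<lambda>x. frechet_derivative f (at x) b)"
  unfolding smooth_on_def by (metis C_k.simps(2))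

lemma smooth_on_dir_deriv:
  fixes f :: "'a::euclidean_space \<Rightarrow> 'b::real_normed_vector"
  assumes S: "open S" and f: "smooth_on S f" and v: "smooth_on S v"
  shows "smooth_on S (\<lambda>x. frechet_derivative f (at x) (v x))"
proof -
  have "smooth_on S (\<lambda>x. \<Sum>e\<in>Basis. (v x \<bullet> e) *\<^sub>R frechet_derivative f (at x) e)"
    by (intro smooth_on_sum S smooth_on_scaleR smooth_on_inner v smooth_on_const smooth_on_partial f)
  then show ?thesis
    using smooth_on_cong[OF S linear_basis_expansion[OF has_derivative_linear[OF smooth_on_has_derivative[OF f]]]] by simp
qed

lemma bounded_linear_axis: "bounded_linear (axis i :: 'b::real_normed_vector \<Rightarrow> 'b ^ 'n::finite)"
proof
  show "\<exists>K. \<forall>x. norm (axis i x :: 'b ^ 'n) \<le> norm x * K"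
  proof (intro exI allI)
    fix x :: 'b
    have "norm (axis i x :: 'b ^ 'n) \<le> (\<Sum>j\<in>UNIV. norm ((axis i x :: 'b ^ 'n) $ j))"
      unfolding norm_vec_def by (rule L2_set_le_sum) simp
    also have "\<dots> = norm x * 1"
      by (simp add: axis_def if_distrib cong: if_cong)
    finally show "norm (axis i x :: 'b ^ 'n) \<le> norm x * 1" .
  qed
qed (auto simp: vec_eq_iff axis_def)

lemma vec_as_sum_axis: "(\<Sum>i\<in>UNIV. axis i (x $ i)) = (x :: 'b::comm_monoid_add ^ 'n::finite)"
  by (simp add: vec_eq_iff axis_def if_distrib cong: if_cong)

lemma smooth_on_vecI:
  fixes f :: "'a::euclidean_space \<Rightarrow> 'b::real_normed_vector ^ 'n::finite"
  assumes "open S" "\<And>i. smooth_on S (\<lambda>x. f x $ i)"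
  shows "smooth_on S f"
proof -
  have "smooth_on S (\<lambda>x. \<Sum>i\<in>UNIV. axis i (f x $ i))"
    using assms by (intro smooth_on_sum smooth_on_bounded_linear[OF bounded_linear_axis]) auto
  then show ?thesis by (simp add: vec_as_sum_axis)
qed

lemma smooth_on_nth: "open S \<Longrightarrow> smooth_on S f \<Longrightarrow> smooth_on S (\<lambda>x. f x $ i)"
  by (rule smooth_on_bounded_linear[OF bounded_linear_vec_nth])

lemma smooth_on_matvec:
  fixes f :: "'a::euclidean_space \<Rightarrow> real ^ 'n::finite ^ 'm::finite"
  shows "open S \<Longrightarrow> smooth_on S f \<Longrightarrow> smooth_on S g \<Longrightarrow> smooth_on S (\<lambda>x. f x *v g x)"
  unfolding matrix_vector_mult_def
  by (intro smooth_on_vecI) (auto intro!: smooth_on_sum smooth_on_mult smooth_on_nth)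

lemma smooth_on_matmul:
  fixes f :: "'a::euclidean_space \<Rightarrow> real ^ 'n::finite ^ 'm::finite"
  shows "open S \<Longrightarrow> smooth_on S f \<Longrightarrow> smooth_on S g \<Longrightarrow> smooth_on S (\<lambda>x. f x ** g x)"
  unfolding matrix_matrix_mult_def
  by (intro smooth_on_vecI) (auto intro!: smooth_on_sum smooth_on_mult smooth_on_nth)

lemma smooth_on_transpose:
  fixes f :: "'a::euclidean_space \<Rightarrow> real ^ 'n::finite ^ 'm::finite"
  shows "open S \<Longrightarrow> smooth_on S f \<Longrightarrow> smooth_on S (\<lambda>x. transpose (f x))"
  unfolding transpose_def
  by (intro smooth_on_vecI) (auto intro!: smooth_on_nth)

lemma smooth_on_det:
  fixes f :: "'a::euclidean_space \<Rightarrow> real ^ 'n::finite ^ 'n"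
  shows "open S \<Longrightarrow> smooth_on S f \<Longrightarrow> smooth_on S (\<lambda>x. det (f x))"
  unfolding det_def
  by (intro smooth_on_sum smooth_on_mult smooth_on_const smooth_on_prod) (auto intro!: smooth_on_nth)

lemma matrix_inv_both:
  fixes A :: "real ^ 'n::finite ^ 'n"
  assumes "invertible A"
  shows "A ** matrix_inv A = mat 1" "matrix_inv A ** A = mat 1"
proof -
  have "\<exists>A'. A ** A' = mat 1 \<and> A' ** A = mat 1" using assms unfolding invertible_def .
  from someI_ex[OF this] show "A ** matrix_inv A = mat 1" "matrix_inv A ** A = mat 1"
    unfolding matrix_inv_def by auto
qed

lemma matrix_inv_nth:
  fixes A :: "real ^ 'n::finite ^ 'n"
  assumes "det A \<noteq> 0"
  shows "matrix_inv A $ k $ l = det (\<chi> i j. if j = k then axis l 1 $ i else A $ i $ j) / det A"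
proof -
  have inv: "invertible A" using assms invertible_det_nz by blast
  have "A *v (matrix_inv A *v axis l 1) = axis l 1"
    using matrix_inv_both[OF inv] by (simp add: matrix_vector_mul_assoc)
  then have "matrix_inv A *v axis l 1 = (\<chi> k. det(\<chi> i j. if j=k then axis l 1 $i else A$i$j) / det A)"
    using cramer[OF assms] by blast
  moreover have "(matrix_inv A *v axis l 1) $ k = matrix_inv A $ k $ l"
    by (simp add: matrix_vector_mult_basis column_def)
  ultimately show ?thesis by simp
qed

text \<open>
  By Cramer's rule the entries of the inverse are rational functions of the entries of the matrix.
\<close>

lemma smooth_on_matrix_inv:
  fixes f :: "'a::euclidean_space \<Rightarrow> real ^ 'n::finite ^ 'n"
  assumes S: "open S" and nz: "\<And>x. x \<in> S \<Longrightarrow> invertible (f x)" and f: "smooth_on S f"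
  shows "smooth_on S (\<lambda>x. matrix_inv (f x))"
proof (intro smooth_on_vecI S)
  fix k l
  have nz': "det (f x) \<noteq> 0" if "x \<in> S" for x using nz that invertible_det_nz by blast
  have "smooth_on S (\<lambda>x. if j = k then axis l 1 $ i else f x $ i $ j)" for i j
    by (cases "j = k") (auto intro!: smooth_on_const smooth_on_nth S f)
  then have "smooth_on S (\<lambda>x. det (\<chi> i j. if j = k then axis l 1 $ i else f x $ i $ j) / det (f x))"
    by (intro smooth_on_divide S smooth_on_det f smooth_on_vecI) (auto simp: nz')
  then show "smooth_on S (\<lambda>x. matrix_inv (f x) $ k $ l)"
    using smooth_on_cong[OF S] matrix_inv_nth[OF nz'] by (metis (no_types, lifting))
qed

text \<open>
  Schwarz's theorem.  The second difference of \<open>f\<close> over a small parallelogram with sides \<open>t a\<close> and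
  \<open>t b\<close> is symmetric in \<open>a\<close> and \<open>b\<close>; two applications of the mean value theorem express it, divided by
  \<open>t\<^sup>2\<close>, as either of the two mixed derivatives at nearby points.
\<close>

lemma symmetric_second_derivative_real:
  fixes f :: "'a::euclidean_space \<Rightarrow> real"
  assumes S: "open S" and x: "x \<in> S" and f: "smooth_on S f"
  shows "frechet_derivative (\<lambda>y. frechet_derivative f (at y) a) (at x) b =
         frechet_derivative (\<lambda>y. frechet_derivative f (at y) b) (at x) a"
proof -
  define D where "D u v y = frechet_derivative (\<lambda>y. frechet_derivative f (at y) u) (at y) v" for u v y
  have sm: "smooth_on S (D u v)" for u v
    unfolding D_def by (intro smooth_on_dir_deriv S f smooth_on_const)
  have sm1: "smooth_on S (\<lambda>y. frechet_derivative f (at y) u)" for u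
    by (intro smooth_on_dir_deriv S f smooth_on_const)
  have line: "((\<lambda>s. h (p + s *\<^sub>R u)) has_real_derivative frechet_derivative h (at (p + s *\<^sub>R u)) u) (at s)"
    if "smooth_on S h" "p + s *\<^sub>R u \<in> S" for h :: "'a \<Rightarrow> real" and p u s
  proof -
    have "((\<lambda>s. p + s *\<^sub>R u) has_derivative (\<lambda>h. h *\<^sub>R u)) (at s)" by (auto intro!: derivative_eq_intros)
    from diff_chain_at[OF this smooth_on_has_derivative[OF that]]
    moreover have "(\<lambda>r. r * frechet_derivative h (at (p + s *\<^sub>R u)) u) = (*) (frechet_derivative h (at (p + s *\<^sub>R u)) u)"
      by (simp add: fun_eq_iff)
    ultimately show ?thesis unfolding has_field_derivative_def o_def
      using linear_cmul[OF linear_frechet_derivative[OF smooth_on_imp_differentiable[OF that]]] by simp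
  qed
  have dq: "\<exists>\<theta> \<eta>. 0 < \<theta> \<and> \<theta> < t \<and> 0 < \<eta> \<and> \<eta> < t \<and>
      f (x + t *\<^sub>R u + t *\<^sub>R v) - f (x + t *\<^sub>R u) - f (x + t *\<^sub>R v) + f x = t * t * D u v (x + \<theta> *\<^sub>R u + \<eta> *\<^sub>R v)"
    if t: "0 < t" and inS: "\<And>r s. 0 \<le> r \<Longrightarrow> r \<le> t \<Longrightarrow> 0 \<le> s \<Longrightarrow> s \<le> t \<Longrightarrow> x + r *\<^sub>R u + s *\<^sub>R v \<in> S" for t u v
  proof -
    define k where "k s = f (x + t *\<^sub>R v + s *\<^sub>R u) - f (x + s *\<^sub>R u)" for s
    have in1: "x + t *\<^sub>R v + s *\<^sub>R u \<in> S" "x + s *\<^sub>R u \<in> S" if "0 \<le> s" "s \<le> t" for s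
      using inS[of s t] inS[of s 0] that t by (auto simp: algebra_simps)
    have kd: "(k has_real_derivative frechet_derivative f (at (x + t *\<^sub>R v + s *\<^sub>R u)) u - frechet_derivative f (at (x + s *\<^sub>R u)) u) (at s)"
      if "0 \<le> s" "s \<le> t" for s
      unfolding k_def by (intro DERIV_diff line f in1 that)
    obtain \<theta> where th: "0 < \<theta>" "\<theta> < t" "k t - k 0 = (t - 0) * (frechet_derivative f (at (x + t *\<^sub>R v + \<theta> *\<^sub>R u)) u - frechet_derivative f (at (x + \<theta> *\<^sub>R u)) u)"
      using MVT2[OF t kd] by auto
    define l where "l s = frechet_derivative f (at ((x + \<theta> *\<^sub>R u) + s *\<^sub>R v)) u" for s
    have ld: "(l has_real_derivative D u v ((x + \<theta> *\<^sub>R u) + s *\<^sub>R v)) (at s)" if "0 \<le> s" "s \<le> t" for s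
      unfolding l_def D_def using line[OF sm1] inS[of \<theta> s] th that by auto
    obtain \<eta> where et: "0 < \<eta>" "\<eta> < t" "l t - l 0 = (t - 0) * D u v (x + \<theta> *\<^sub>R u + \<eta> *\<^sub>R v)"
      using MVT2[OF t ld] by auto
    have "f (x + t *\<^sub>R u + t *\<^sub>R v) - f (x + t *\<^sub>R u) - f (x + t *\<^sub>R v) + f x = k t - k 0"
      unfolding k_def by (simp add: algebra_simps)
    also have "\<dots> = t * (l t - l 0)" unfolding th(3) l_def by (simp add: algebra_simps)
    also have "\<dots> = t * t * D u v (x + \<theta> *\<^sub>R u + \<eta> *\<^sub>R v)" unfolding et(3) by simp
    finally show ?thesis using th et by blast
  qed
  have close: "\<exists>\<delta>>0. \<forall>p. dist p x < \<delta> \<longrightarrow> p \<in> S \<and> \<bar>D u v p - D u v x\<bar> < e" if e0: "e > 0" for u v e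
  proof -
    have "isCont (D u v) x"
      using smooth_on_imp_continuous_on[OF sm] S x continuous_on_eq_continuous_at by blast
    then obtain d where d: "d > 0" "\<forall>p. dist p x < d \<longrightarrow> \<bar>D u v p - D u v x\<bar> < e"
      using e0 unfolding continuous_at_eps_delta dist_real_def by meson
    obtain d' where d': "d' > 0" "ball x d' \<subseteq> S" using S x open_contains_ball by blast
    show ?thesis using d d' by (intro exI[of _ "min d d'"]) (auto simp: mem_ball dist_commute subset_iff)
  qed
  have "\<bar>D a b x - D b a x\<bar> \<le> e" if e: "e > 0" for e
  proof -
    obtain d1 where d1: "d1 > 0" "\<forall>p. dist p x < d1 \<longrightarrow> p \<in> S \<and> \<bar>D a b p - D a b x\<bar> < e/2"
      using close[OF half_gt_zero[OF e]] by metis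
    obtain d2 where d2: "d2 > 0" "\<forall>p. dist p x < d2 \<longrightarrow> p \<in> S \<and> \<bar>D b a p - D b a x\<bar> < e/2"
      using close[OF half_gt_zero[OF e]] by metis
    define N where "N = norm a + norm b + 1"
    have N: "N > 0" unfolding N_def by (simp add: add_nonneg_pos)
    \<comment> \<open>Small enough for the whole parallelogram to lie where both mixed derivatives are almost constant.\<close>
    define t where "t = min d1 d2 / (2 * N)"
    have t: "t > 0" unfolding t_def using d1 d2 N by auto
    have near: "dist (x + r *\<^sub>R u + s *\<^sub>R v) x < min d1 d2"
      if "0 \<le> r" "r \<le> t" "0 \<le> s" "s \<le> t" "(u, v) = (a, b) \<or> (u, v) = (b, a)" for r s u v
    proof -
      have "dist (x + r *\<^sub>R u + s *\<^sub>R v) x = norm (r *\<^sub>R u + s *\<^sub>R v)" by (simp add: dist_norm)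
      also have "\<dots> \<le> r * norm u + s * norm v" using norm_triangle_ineq[of "r *\<^sub>R u" "s *\<^sub>R v"] that by simp
      also have "\<dots> \<le> t * norm u + t * norm v" using that by (intro add_mono mult_right_mono) auto
      also have "\<dots> \<le> t * N" using t that(5) unfolding N_def by (auto simp: algebra_simps)
      also have "\<dots> = min d1 d2 / 2" unfolding t_def using N by simp
      also have "\<dots> < min d1 d2" using d1(1) d2(1) by (simp add: min_def)
      finally show ?thesis .
    qed
    obtain \<theta> \<eta> where 1: "0 < \<theta>" "\<theta> < t" "0 < \<eta>" "\<eta> < t"
      "f (x + t *\<^sub>R a + t *\<^sub>R b) - f (x + t *\<^sub>R a) - f (x + t *\<^sub>R b) + f x = t * t * D a b (x + \<theta> *\<^sub>R a + \<eta> *\<^sub>R b)"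
      using dq[OF t, of a b] near[of _ _ a b] d1 by force
    obtain \<theta>' \<eta>' where 2: "0 < \<theta>'" "\<theta>' < t" "0 < \<eta>'" "\<eta>' < t"
      "f (x + t *\<^sub>R b + t *\<^sub>R a) - f (x + t *\<^sub>R b) - f (x + t *\<^sub>R a) + f x = t * t * D b a (x + \<theta>' *\<^sub>R b + \<eta>' *\<^sub>R a)"
      using dq[OF t, of b a] near[of _ _ b a] d1 by force
    have "t * t * D a b (x + \<theta> *\<^sub>R a + \<eta> *\<^sub>R b) = t * t * D b a (x + \<theta>' *\<^sub>R b + \<eta>' *\<^sub>R a)"
      unfolding 1(5)[symmetric] 2(5)[symmetric] by (simp add: algebra_simps)
    then have "D a b (x + \<theta> *\<^sub>R a + \<eta> *\<^sub>R b) = D b a (x + \<theta>' *\<^sub>R b + \<eta>' *\<^sub>R a)" using t by simp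
    moreover have "\<bar>D a b (x + \<theta> *\<^sub>R a + \<eta> *\<^sub>R b) - D a b x\<bar> < e/2"
      using d1(2) near[of \<theta> \<eta> a b] 1 by simp
    moreover have "\<bar>D b a (x + \<theta>' *\<^sub>R b + \<eta>' *\<^sub>R a) - D b a x\<bar> < e/2"
      using d2(2) near[of \<theta>' \<eta>' b a] 2 by simp
    ultimately show ?thesis by linarith
  qed
  then have "\<bar>D a b x - D b a x\<bar> \<le> 0" by (rule field_le_epsilon) simp
  then show ?thesis unfolding D_def by simp
qed

lemma symmetric_second_derivative:
  fixes f :: "'a::euclidean_space \<Rightarrow> 'b::euclidean_space"
  assumes S: "open S" and x: "x \<in> S" and f: "smooth_on S f"
  shows "frechet_derivative (\<lambda>y. frechet_derivative f (at y) a) (at x) b =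
         frechet_derivative (\<lambda>y. frechet_derivative f (at y) b) (at x) a"
proof (rule euclidean_eqI)
  fix e :: 'b assume "e \<in> Basis"
  have in': "frechet_derivative (\<lambda>y. h y \<bullet> e) (at y) u = frechet_derivative h (at y) u \<bullet> e"
    if "smooth_on S h" "y \<in> S" for h :: "'a \<Rightarrow> 'b" and y u
    using frechet_derivative_eq[OF has_derivative_inner_left[OF smooth_on_has_derivative[OF that], of e]] by simp
  have s1: "smooth_on S (\<lambda>y. frechet_derivative f (at y) u)" for u
    by (intro smooth_on_dir_deriv S f smooth_on_const)
  have "frechet_derivative (\<lambda>y. frechet_derivative (\<lambda>y. f y \<bullet> e) (at y) u) (at x) v
      = frechet_derivative (\<lambda>y. frechet_derivative f (at y) u) (at x) v \<bullet> e" for u v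
  proof -
    have "frechet_derivative (\<lambda>y. frechet_derivative (\<lambda>y. f y \<bullet> e) (at y) u) (at x)
      = frechet_derivative (\<lambda>y. frechet_derivative f (at y) u \<bullet> e) (at x)"
      by (rule frechet_derivative_cong_open[OF S x in'[OF f]])
    then show ?thesis using in'[OF s1 x] by simp
  qed
  note comm = this
  have "smooth_on S (\<lambda>y. f y \<bullet> e)" by (intro smooth_on_inner S f smooth_on_const)
  from symmetric_second_derivative_real[OF S x this, of a b]
  show "frechet_derivative (\<lambda>y. frechet_derivative f (at y) a) (at x) b \<bullet> e =
         frechet_derivative (\<lambda>y. frechet_derivative f (at y) b) (at x) a \<bullet> e"
    unfolding comm .
qed

text \<open>
  The vanishing case of Gronwall's inequality, in both time directions.  It serves as uniqueness
  theorem for linear differential equations.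
\<close>

lemma gronwall_zero:
  fixes f :: "real \<Rightarrow> real"
  assumes d: "\<And>t. t \<in> {a..b} \<Longrightarrow> (f has_real_derivative f' t) (at t)"
    and bd: "\<And>t. t \<in> {a..b} \<Longrightarrow> \<bar>f' t\<bar> \<le> C * f t"
    and nn: "\<And>t. t \<in> {a..b} \<Longrightarrow> f t \<ge> 0"
    and s: "s \<in> {a..b}" "f s = 0" and t: "t \<in> {a..b}"
  shows "f t = 0"
proof (cases "s \<le> t")
  case True
  \<comment> \<open>After multiplication with the exponential, monotonicity leads from the zero to later times,\<close>
  have "(\<lambda>t. f t * exp (- C * t)) t \<le> (\<lambda>t. f t * exp (- C * t)) s"
  proof (rule DERIV_nonpos_imp_nonincreasing[OF True])
    fix r assume "s \<le> r" "r \<le> t"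
    then have r: "r \<in> {a..b}" using s t by auto
    show "\<exists>y. ((\<lambda>t. f t * exp (- C * t)) has_real_derivative y) (at r) \<and> y \<le> 0"
      using bd[OF r]
      by (intro exI[of _ "(f' r - C * f r) * exp (- C * r)"] conjI)
         (auto intro!: derivative_eq_intros d[OF r] mult_nonpos_nonneg simp: algebra_simps)
  qed
  then have "f t \<le> 0" using s(2) by (simp add: mult_le_0_iff not_le[symmetric])
  then show ?thesis using nn[OF t] by simp
next
  case False
  then have ts: "t \<le> s" by simp
  \<comment> \<open>and with the opposite exponential to earlier times.\<close>
  have "(\<lambda>t. f t * exp (C * t)) t \<le> (\<lambda>t. f t * exp (C * t)) s"
  proof (rule DERIV_nonneg_imp_nondecreasing[OF ts])
    fix r assume "t \<le> r" "r \<le> s"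
    then have r: "r \<in> {a..b}" using s t by auto
    have "0 \<le> (f' r + C * f r) * exp (C * r)" using bd[OF r] by (intro mult_nonneg_nonneg) auto
    then show "\<exists>y. ((\<lambda>t. f t * exp (C * t)) has_real_derivative y) (at r) \<and> y \<ge> 0"
      by (intro exI[of _ "(f' r + C * f r) * exp (C * r)"] conjI)
         (auto intro!: derivative_eq_intros d[OF r] simp: algebra_simps)
  qed
  then have "f t \<le> 0" using s(2) by (simp add: mult_le_0_iff not_le[symmetric])
  then show ?thesis using nn[OF t] by simp
qed

section \<open>Ordinary differential equations\<close>

lemma smooth_on_locally_lipschitz:
  fixes f :: "'a::euclidean_space \<Rightarrow> 'b::real_normed_vector"
  assumes U: "open U" and f: "smooth_on U f" and sub: "cball x r \<subseteq> U"
  shows "\<exists>L>0. \<forall>u\<in>cball x r. \<forall>v\<in>cball x r. dist (f u) (f v) \<le> L * dist u v"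
proof -
  define k where "k u = (\<Sum>b\<in>Basis. norm (frechet_derivative f (at u) b))" for u
  have "continuous_on (cball x r) k"
    unfolding k_def
    by (intro continuous_on_sum continuous_on_norm smooth_on_imp_continuous_on
        smooth_on_subset[OF smooth_on_partial[OF f] sub])
  then have "bounded (k ` cball x r)" by (intro compact_imp_bounded compact_continuous_image compact_cball)
  then obtain K where K: "\<forall>y\<in>k ` cball x r. norm y \<le> K" unfolding bounded_iff by blast
  have on: "onorm (frechet_derivative f (at u)) \<le> \<bar>K\<bar> + 1" if u: "u \<in> cball x r" for u
  proof (rule onorm_le)
    fix h
    have lin: "linear (frechet_derivative f (at u))"
      using smooth_on_imp_differentiable[OF f] u sub by (intro linear_frechet_derivative) blast
    have "norm (frechet_derivative f (at u) h) \<le> (\<Sum>b\<in>Basis. norm ((h \<bullet> b) *\<^sub>R frechet_derivative f (at u) b))"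
      by (subst linear_basis_expansion[OF lin]) (rule norm_sum)
    also have "\<dots> \<le> (\<Sum>b\<in>Basis. norm h * norm (frechet_derivative f (at u) b))"
      by (intro sum_mono) (auto intro!: mult_right_mono Basis_le_norm)
    also have "\<dots> = k u * norm h" unfolding k_def by (simp add: sum_distrib_left mult.commute)
    also have "\<dots> \<le> (\<bar>K\<bar> + 1) * norm h"
      using K u by (intro mult_right_mono) force+
    finally show "norm (frechet_derivative f (at u) h) \<le> (\<bar>K\<bar> + 1) * norm h" .
  qed
  show ?thesis
  proof (intro exI[of _ "\<bar>K\<bar> + 1"] conjI ballI)
    fix u v assume uv: "u \<in> cball x r" "v \<in> cball x r"
    have "(f has_derivative frechet_derivative f (at u)) (at u within cball x r)" if "u \<in> cball x r" for u
      using smooth_on_has_derivative[OF f] that sub by (blast intro: has_derivative_at_withinI)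
    with uv show "dist (f u) (f v) \<le> (\<bar>K\<bar> + 1) * dist u v"
      unfolding dist_norm
      using on
      by (intro differentiable_bound[of "cball x r" f "\<lambda>u. frechet_derivative f (at u)"]) auto
  qed auto
qed

text \<open>
  Picard iteration for a globally Lipschitz right-hand side, as a contraction of the Banach space of
  bounded continuous curves.  Curves on \<open>{-e..e}\<close> are extended to the real line by clamping time.
\<close>

lemma picard_lipschitz:
  fixes f :: "'a::euclidean_space \<Rightarrow> 'a"
  assumes L: "L > 0" and lip: "\<And>x y. dist (f x) (f y) \<le> L * dist x y"
  shows "\<exists>e>0. \<exists>y. y 0 = y0 \<and> (\<forall>t\<in>{-e<..<e}. (y has_vector_derivative f (y t)) (at t))"
proof -
  \<comment> \<open>The integrals over \<open>{-e..t}\<close> and \<open>{-e..0}\<close> have total length at most \<open>3 e\<close>.\<close>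
  define e where "e = 1 / (6 * L)"
  have e: "e > 0" and eL: "3 * e * L = 1 / 2" unfolding e_def using L by auto
  have fc: "continuous_on S f" for S
    by (rule continuous_on_subset[OF _ subset_UNIV], rule lipschitz_on_continuous_on[of L])
       (auto intro!: lipschitz_onI lip less_imp_le[OF L])
  have hc: "continuous_on S (\<lambda>s. f (apply_bcontfun Y s))" for Y :: "real \<Rightarrow>\<^sub>C 'a" and S
    by (rule continuous_on_compose2[OF fc]) auto
  \<comment> \<open>Integrals start at \<open>-e\<close>, so that times of both signs are treated alike.\<close>
  define K where "K Y t = integral {-e..t} (\<lambda>s. f (apply_bcontfun Y s))" for Y :: "real \<Rightarrow>\<^sub>C 'a" and t
  define J where "J Y t = y0 + (K Y t - K Y 0)" for Y t
  have Jc: "continuous_on (cbox (-e) e) (J Y)" for Y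
    unfolding J_def K_def cbox_interval
    by (intro continuous_intros indefinite_integral_continuous_1 integrable_continuous_real hc)
  define T where "T Y = Bcontfun (\<lambda>t. J Y (clamp (-e) e t))" for Y
  have TY: "apply_bcontfun (T Y) t = J Y (clamp (-e) e t)" for Y t
  proof -
    have "(\<lambda>t. J Y (clamp (-e) e t)) \<in> bcontfun"
      unfolding bcontfun_def
      using clamp_continuous_on[OF Jc] clamp_bounded[OF
        compact_imp_bounded[OF compact_continuous_image[OF Jc compact_cbox]]] by blast
    then show ?thesis unfolding T_def by (simp add: Bcontfun_inverse)
  qed
  have est: "norm (K Y t - K Z t) \<le> (L * dist Y Z) * (t + e)" if t: "-e \<le> t" for Y Z t
  proof -
    have "K Y t - K Z t = integral {-e..t} (\<lambda>s. f (apply_bcontfun Y s) - f (apply_bcontfun Z s))"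
      unfolding K_def by (rule integral_diff[symmetric]; intro integrable_continuous_real hc)
    also have "norm \<dots> \<le> (L * dist Y Z) * (t - (-e))"
    proof (rule integral_bound[OF t])
      show "continuous_on {-e..t} (\<lambda>s. f (apply_bcontfun Y s) - f (apply_bcontfun Z s))"
        by (intro continuous_on_diff hc)
      fix s
      have "norm (f (apply_bcontfun Y s) - f (apply_bcontfun Z s)) \<le> L * dist (apply_bcontfun Y s) (apply_bcontfun Z s)"
        using lip by (simp add: dist_norm)
      also have "\<dots> \<le> L * dist Y Z" using L by (intro mult_left_mono dist_bounded) auto
      finally show "norm (f (apply_bcontfun Y s) - f (apply_bcontfun Z s)) \<le> L * dist Y Z" .
    qed
    finally show ?thesis by simp
  qed
  have contr: "dist (T Y) (T Z) \<le> (1/2) * dist Y Z" for Y Z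
  proof (rule dist_bound)
    fix t
    define c where "c = clamp (-e) e t"
    have c: "-e \<le> c" "c \<le> e" unfolding c_def using clamp_in_interval[of "-e" e t] e by auto
    have "dist (apply_bcontfun (T Y) t) (apply_bcontfun (T Z) t) = norm ((K Y c - K Z c) - (K Y 0 - K Z 0))"
      unfolding TY J_def dist_norm c_def[symmetric] by (simp add: algebra_simps)
    also have "\<dots> \<le> (L * dist Y Z) * (c + e) + (L * dist Y Z) * (0 + e)"
      using c e by (intro order_trans[OF norm_triangle_ineq4 add_mono[OF est est]]) auto
    also have "\<dots> \<le> (L * dist Y Z) * (2 * e) + (L * dist Y Z) * (0 + e)"
      using c L by (intro add_right_mono mult_left_mono) auto
    also have "\<dots> = (3 * e * L) * dist Y Z" by (simp add: algebra_simps)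
    finally show "dist (apply_bcontfun (T Y) t) (apply_bcontfun (T Z) t) \<le> (1/2) * dist Y Z" unfolding eL .
  qed
  obtain Y where Y: "T Y = Y"
    using banach_fix_type[of "1/2" T] contr by auto
  have YJ: "apply_bcontfun Y t = J Y t" if "t \<in> {-e..e}" for t
    using TY[of Y t] Y that e by simp
  show ?thesis
  proof (intro exI[of _ e] conjI e exI[of _ "J Y"] ballI)
    show "J Y 0 = y0" unfolding J_def by simp
    fix t assume t: "t \<in> {-e<..<e}"
    have "(K Y has_vector_derivative f (apply_bcontfun Y t)) (at t within {-e..e})"
      unfolding K_def by (rule integral_has_vector_derivative[OF hc]) (use t in auto)
    then have "(K Y has_vector_derivative f (apply_bcontfun Y t)) (at t)"
      using at_within_interior[of t "{-e..e}"] t by (simp add: interior_atLeastAtMost_real)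
    then have "(J Y has_vector_derivative f (apply_bcontfun Y t)) (at t)"
      unfolding J_def[abs_def] by (auto intro!: derivative_eq_intros)
    then show "(J Y has_vector_derivative f (J Y t)) (at t)" using YJ t by simp
  qed
qed

lemma real_vector_derivative_C_k:
  fixes y :: "real \<Rightarrow> 'a::real_normed_vector"
  assumes "open I" "\<And>t. t \<in> I \<Longrightarrow> (y has_vector_derivative h t) (at t)" "C_k k I h"
  shows "C_k (Suc k) I y"
proof -
  have "frechet_derivative y (at t) 1 = h t" if "t \<in> I" for t
    using frechet_derivative_eq[OF assms(2)[OF that, unfolded has_vector_derivative_def]] by simp
  then have "C_k k I (\<lambda>t. frechet_derivative y (at t) 1)"
    using C_k_cong[OF assms(1), of "\<lambda>t. frechet_derivative y (at t) 1" h k] assms(3) by simp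
  then show ?thesis using assms(2) by (auto intro: differentiableI_vector)
qed

text \<open>
  Bootstrapping: if the solution is of class \<open>C_k\<close>, then so is its derivative, being the composition
  with a smooth right-hand side.
\<close>

lemma ode_solution_smooth:
  fixes f :: "'a::euclidean_space \<Rightarrow> 'a"
  assumes U: "open U" and f: "smooth_on U f" and I: "open (I :: real set)"
    and y: "\<And>t. t \<in> I \<Longrightarrow> y t \<in> U" "\<And>t. t \<in> I \<Longrightarrow> (y has_vector_derivative f (y t)) (at t)"
  shows "smooth_on I y"
  unfolding smooth_on_def
proof
  fix k show "C_k k I y"
  proof (induction k)
    case 0
    show ?case using y(2)
      by (auto intro!: continuous_at_imp_continuous_on has_vector_derivative_continuous)
  next
    case (Suc k)
    have "C_k k I (\<lambda>t. f (y t))"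
      using f y(1) by (intro C_k_compose[OF I U _ Suc.IH]) (auto simp: smooth_on_def)
    then show ?case by (intro real_vector_derivative_C_k[OF I y(2)])
  qed
qed

text \<open>
  Outside a small ball the right-hand side is replaced by its value at the closest point of the
  ball, which makes it globally Lipschitz; for short times the solution stays in the ball.
\<close>

theorem smooth_ode_exists:
  fixes f :: "'a::euclidean_space \<Rightarrow> 'a"
  assumes U: "open U" and f: "smooth_on U f" and y0: "y0 \<in> U"
  shows "\<exists>e>0. \<exists>y. y 0 = y0 \<and> smooth_on {-e<..<e} y \<and>
    (\<forall>t\<in>{-e<..<e}. y t \<in> U \<and> (y has_vector_derivative f (y t)) (at t))"
proof -
  obtain r where r: "r > 0" "cball y0 r \<subseteq> U" using U y0 open_contains_cball by blast
  obtain L where L: "L > 0" "\<forall>u\<in>cball y0 r. \<forall>v\<in>cball y0 r. dist (f u) (f v) \<le> L * dist u v"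
    using smooth_on_locally_lipschitz[OF U f r(2)] by blast
  define p where "p = closest_point (cball y0 r)"
  have cb: "convex (cball y0 r)" "closed (cball y0 r)" "cball y0 r \<noteq> {}" using r by auto
  have pin: "p x \<in> cball y0 r" for x unfolding p_def using closest_point_in_set[OF cb(2,3)] by blast
  have "dist (f (p x)) (f (p y)) \<le> L * dist x y" for x y
  proof -
    have "dist (f (p x)) (f (p y)) \<le> L * dist (p x) (p y)" using L(2) pin by blast
    also have "\<dots> \<le> L * dist x y"
      unfolding p_def using closest_point_lipschitz[OF cb] L(1) by (intro mult_left_mono) auto
    finally show ?thesis .
  qed
  from picard_lipschitz[OF L(1), of "\<lambda>x. f (p x)" y0, OF this]
  obtain e y where e: "e > 0" and y: "y 0 = y0" "\<And>t. t \<in> {-e<..<e} \<Longrightarrow> (y has_vector_derivative f (p (y t))) (at t)"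
    by blast
  have "isCont y 0" using y(2)[of 0] e has_vector_derivative_continuous by auto
  then obtain d where d: "d > 0" "\<And>t. dist t 0 < d \<Longrightarrow> dist (y t) (y 0) < r"
    using r(1) unfolding continuous_at_eps_delta by blast
  define e' where "e' = min e d"
  have e': "e' > 0" unfolding e'_def using e d by simp
  have inb: "y t \<in> cball y0 r" if "t \<in> {-e'<..<e'}" for t
    using d(2)[of t] that y(1) unfolding e'_def by (auto simp: dist_commute dist_real_def abs_less_iff min_def split: if_splits)
  have der: "(y has_vector_derivative f (y t)) (at t)" if "t \<in> {-e'<..<e'}" for t
    using y(2)[of t] that closest_point_self[OF inb[OF that]] unfolding e'_def p_def by (auto simp: min_def split: if_splits)
  show ?thesis
  proof (intro exI[of _ e'] conjI e' exI[of _ y] y(1) ballI)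
    show "smooth_on {-e'<..<e'} y"
      by (rule ode_solution_smooth[OF U f _ _ der]) (use inb r in auto)
  qed (use inb r der in auto)
qed

section \<open>Orthogonal projections and rescaled inner products\<close>

lemma inner_matvec: "x \<bullet> (A *v y) = (transpose A *v x) \<bullet> y" for A :: "real ^ 'n::finite ^ 'm::finite"
  by (simp add: dot_lmul_matrix[symmetric])

lemma matrix_entry: "A $ i $ j = axis i 1 \<bullet> (A *v axis j 1)" for A :: "real ^ 'n::finite ^ 'm::finite"
  by (simp add: inner_axis' matrix_vector_mult_basis column_def)

lemma matrix_eqI_inner:
  fixes A A' :: "real ^ 'n::finite ^ 'm::finite"
  assumes "\<And>u w. u \<bullet> (A *v w) = u \<bullet> (A' *v w)" shows "A = A'"
  by (simp add: vec_eq_iff) (simp add: matrix_entry assms)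

text \<open>
  Symmetric positive definite matrices represent the inner products on a tangent space.
\<close>

definition spd :: "real ^ 'n::finite ^ 'n \<Rightarrow> bool" where
  "spd B \<longleftrightarrow> transpose B = B \<and> (\<forall>v. v \<noteq> 0 \<longrightarrow> v \<bullet> (B *v v) > 0)"

lemma spd_sym: "spd B \<Longrightarrow> u \<bullet> (B *v w) = w \<bullet> (B *v u)"
  unfolding spd_def using inner_matvec[of u B w] by (simp add: inner_commute)

lemma spd_pos: "spd B \<Longrightarrow> v \<noteq> 0 \<Longrightarrow> v \<bullet> (B *v v) > 0"
  unfolding spd_def by blast

lemma invertible_kernel:
  fixes A :: "real ^ 'n::finite ^ 'n"
  assumes "\<And>x. A *v x = 0 \<Longrightarrow> x = 0" shows "invertible A"
proof -
  have "\<exists>A'. A' ** A = mat 1" using assms matrix_left_invertible_ker by blast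
  then show ?thesis using invertible_left_inverse by blast
qed

lemma spd_invertible: "spd B \<Longrightarrow> invertible B"
  by (rule invertible_kernel) (metis inner_zero_right less_irrefl spd_pos)

lemma spd_nondegenerate: "spd B \<Longrightarrow> (\<And>w. w \<bullet> (B *v v) = 0) \<Longrightarrow> v = 0"
  by (metis less_irrefl spd_pos)

text \<open>
  The Gram matrix of the columns of \<open>X\<close> with indices in \<open>K\<close>, completed by an identity block on the
  other indices.  The completion keeps frames of a \<open>k\<close>-dimensional subspace within square matrices of
  the full size, where determinants and inverses are available.
\<close>

definition gram :: "'n set \<Rightarrow> real ^ 'n::finite ^ 'n \<Rightarrow> real ^ 'n ^ 'n \<Rightarrow> real ^ 'n ^ 'n" where
  "gram K X B = transpose X ** B ** X + (\<chi> i j. if i = j \<and> i \<notin> K then 1 else 0)"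

definition frame :: "'n set \<Rightarrow> real ^ 'n::finite ^ 'n \<Rightarrow> (real ^ 'n) set \<Rightarrow> bool" where
  "frame K X V \<longleftrightarrow> (\<forall>i. i \<notin> K \<longrightarrow> column i X = 0) \<and> range (\<lambda>w. X *v w) = V \<and>
     (\<forall>w. (\<forall>i. i \<notin> K \<longrightarrow> w $ i = 0) \<and> X *v w = 0 \<longrightarrow> w = 0)"

lemma gram_apply: "gram K X B *v w = transpose X *v (B *v (X *v w)) + (\<chi> i. if i \<in> K then 0 else w $ i)"
proof -
  have "(\<chi> i j. if i = j \<and> i \<notin> K then 1 else 0) *v w = (\<chi> i. if i \<in> K then 0 else w $ i)"
  proof -
    have "(if i = j \<and> i \<notin> K then 1 else 0) * w $ j = (if i = j then (if i \<in> K then 0 else w $ j) else 0)" for i j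
      by auto
    then show ?thesis by (simp add: vec_eq_iff matrix_vector_mult_def)
  qed
  then show ?thesis
    unfolding gram_def by (simp add: matrix_vector_mult_add_rdistrib matrix_vector_mul_assoc[symmetric])
qed

lemma gram_invertible:
  assumes B: "spd B" and ind: "\<And>w. (\<forall>i. i \<notin> K \<longrightarrow> w $ i = 0) \<Longrightarrow> X *v w = 0 \<Longrightarrow> w = 0"
  shows "invertible (gram K X B)"
proof (rule invertible_kernel)
  fix w assume 0: "gram K X B *v w = 0"
  have "0 = w \<bullet> (gram K X B *v w)" using 0 by simp
  also have "\<dots> = (X *v w) \<bullet> (B *v (X *v w)) + (\<Sum>i\<in>UNIV. if i \<in> K then 0 else w $ i * w $ i)"
    unfolding gram_apply inner_add_right inner_matvec[of w "transpose X"]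
    by (auto simp: inner_vec_def intro!: sum.cong)
  finally have e: "(X *v w) \<bullet> (B *v (X *v w)) + (\<Sum>i\<in>UNIV. if i \<in> K then 0 else w $ i * w $ i) = 0" by simp
  have n1: "(X *v w) \<bullet> (B *v (X *v w)) \<ge> 0" using spd_pos[OF B, of "X *v w"] by (cases "X *v w = 0") auto
  have n2: "(\<Sum>i\<in>UNIV. if i \<in> K then 0 else w $ i * w $ i) \<ge> 0" by (intro sum_nonneg) auto
  have z: "(X *v w) \<bullet> (B *v (X *v w)) = 0" "(\<Sum>i\<in>UNIV. if i \<in> K then 0 else w $ i * w $ i) = 0"
    using e add_nonneg_eq_0_iff[OF n1 n2] by simp_all
  from z(1) have "X *v w = 0" using spd_pos[OF B, of "X *v w"] by auto
  moreover have "\<forall>i. i \<notin> K \<longrightarrow> w $ i = 0"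
  proof -
    have "\<forall>i\<in>UNIV. (if i \<in> K then 0 else w $ i * w $ i) = 0"
      using z(2) by (subst (asm) sum_nonneg_eq_0_iff) auto
    then show ?thesis by (metis UNIV_I mult_eq_0_iff)
  qed
  ultimately show "w = 0" using ind by blast
qed

lemma column_in_range: "column i X \<in> range (\<lambda>w. X *v w)" for X :: "real ^ 'n::finite ^ 'm::finite"
  by (metis matrix_vector_mult_basis rangeI)

lemma matvec_in_subspace:
  fixes X :: "real ^ 'n::finite ^ 'm::finite"
  assumes "subspace V" "\<And>i. column i X \<in> V" shows "X *v w \<in> V"
  unfolding matrix_mult_sum scalar_mult_eq_scaleR
  by (intro subspace_sum[OF assms(1)] subspace_scale[OF assms(1)] assms(2))

lemma gram_independent:
  assumes inv: "invertible (gram K X B)" and w: "\<forall>i. i \<notin> K \<longrightarrow> w $ i = 0" "X *v w = 0"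
  shows "w = 0"
proof -
  have "gram K X B *v w = 0" unfolding gram_apply w(2) using w(1) by (simp add: vec_eq_iff)
  then show ?thesis using matrix_inv_both(2)[OF inv]
    by (metis matrix_vector_mul_assoc matrix_vector_mul_lid matrix_vector_mult_0_right)
qed

lemma gram_dim_image:
  fixes X :: "real ^ 'n::finite ^ 'n"
  assumes inv: "invertible (gram K X B)"
  shows "dim (((*v) X) ` {w. \<forall>i. i \<notin> K \<longrightarrow> w $ i = 0}) = card K"
proof -
  define S where "S = {w :: real ^ 'n. \<forall>i. i \<notin> K \<longrightarrow> w $ i = 0}"
  have S: "subspace S" unfolding S_def subspace_def by auto
  have inj: "inj_on ((*v) X) S"
  proof (rule inj_onI)
    fix u v assume uv: "u \<in> S" "v \<in> S" "X *v u = X *v v"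
    then have "X *v (u - v) = 0" by (simp add: matrix_vector_mult_diff_distrib)
    moreover have "\<forall>i. i \<notin> K \<longrightarrow> (u - v) $ i = 0" using uv unfolding S_def by auto
    ultimately show "u = v" using gram_independent[OF inv, of "u - v"] by simp
  qed
  have "dim (((*v) X) ` S) = dim S"
    by (rule dim_image_eq[OF matrix_vector_mul_linear]) (use inj S in \<open>simp add: span_eq_iff[THEN iffD2]\<close>)
  also have "dim S = card K" unfolding S_def using dim_substandard_cart[of K, where 'a=real] by (simp add: dim_vec_eq)
  finally show ?thesis unfolding S_def .
qed

lemma gram_card_le_dim:
  fixes X :: "real ^ 'n::finite ^ 'n"
  assumes inv: "invertible (gram K X B)" and V: "subspace V" "\<And>i. column i X \<in> V"
  shows "card K \<le> dim V"
  unfolding gram_dim_image[OF inv, symmetric]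
  by (intro dim_subset image_subsetI matvec_in_subspace[OF V])

text \<open>
  A converse to \<open>gram_invertible\<close>: vectors of \<open>V\<close> with invertible Gram matrix are independent, and if there
  are \<open>dim V\<close> of them they span \<open>V\<close>.  This is how a frame at one point persists at nearby points.
\<close>

lemma frame_of_gram:
  fixes X :: "real ^ 'n::finite ^ 'n"
  assumes z: "\<And>i. i \<notin> K \<Longrightarrow> column i X = 0" and inv: "invertible (gram K X B)"
    and V: "subspace V" "\<And>i. column i X \<in> V" and d: "dim V \<le> card K"
  shows "frame K X V"
proof -
  let ?S = "{w :: real ^ 'n. \<forall>i. i \<notin> K \<longrightarrow> w $ i = 0}"
  have S: "subspace ?S" unfolding subspace_def by auto
  have sub: "((*v) X) ` ?S \<subseteq> V" by (intro image_subsetI matvec_in_subspace[OF V])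
  have eq: "((*v) X) ` ?S = V"
    by (rule subspace_dim_equal[OF linear_subspace_image[OF matrix_vector_mul_linear S] V(1) sub])
       (use gram_dim_image[OF inv] d in simp)
  have "range (\<lambda>w. X *v w) \<subseteq> V" by (intro image_subsetI matvec_in_subspace[OF V])
  moreover have "V \<subseteq> range (\<lambda>w. X *v w)" unfolding eq[symmetric] by (rule image_mono) simp
  ultimately show ?thesis unfolding frame_def using z gram_independent[OF inv] by simp
qed

text \<open>
  The classical formula \<open>X (X\<^sup>T B X)\<^sup>-\<^sup>1 X\<^sup>T B\<close> for the \<open>B\<close>-orthogonal projection onto the column space; it
  shows that the projection depends smoothly on \<open>X\<close> and \<open>B\<close>.
\<close>

definition frame_proj :: "'n set \<Rightarrow> real ^ 'n::finite ^ 'n \<Rightarrow> real ^ 'n ^ 'n \<Rightarrow> real ^ 'n ^ 'n" where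
  "frame_proj K X B = X ** matrix_inv (gram K X B) ** transpose X ** B"

lemma frame_proj_apply: "frame_proj K X B *v u = X *v (matrix_inv (gram K X B) *v (transpose X *v (B *v u)))"
  unfolding frame_proj_def by (simp add: matrix_vector_mul_assoc[symmetric])

text \<open>
  With \<open>\<phi> = X\<^sup>T B u\<close> and \<open>y\<close> the solution of \<open>gram y = \<phi>\<close>, the identity block of the Gram matrix forces
  \<open>y\<close> to vanish outside \<open>K\<close>, because \<open>\<phi>\<close> does; hence \<open>y\<close> solves the normal equations
  \<open>X\<^sup>T B X y = X\<^sup>T B u\<close>.
\<close>

lemma frame_proj_projects:
  assumes B: "spd B" and fr: "frame K X V"
  shows "frame_proj K X B *v u \<in> V" "w \<in> V \<Longrightarrow> (u - frame_proj K X B *v u) \<bullet> (B *v w) = 0"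
proof -
  show "frame_proj K X B *v u \<in> V" using fr unfolding frame_proj_apply frame_def by blast
  assume "w \<in> V"
  then obtain a where w: "w = X *v a" using fr unfolding frame_def by blast
  define \<phi> where "\<phi> = transpose X *v (B *v u)"
  define y where "y = matrix_inv (gram K X B) *v \<phi>"
  have "invertible (gram K X B)" using fr by (intro gram_invertible[OF B]) (auto simp: frame_def)
  then have "gram K X B *v y = \<phi>"
    unfolding y_def by (simp add: matrix_vector_mul_assoc matrix_inv_both(1))
  then have e: "transpose X *v (B *v (X *v y)) + (\<chi> i. if i \<in> K then 0 else y $ i) = \<phi>" unfolding gram_apply .
  have t0: "(transpose X *v v) $ i = 0" if "i \<notin> K" for v i
  proof -
    have "(transpose X *v v) $ i = column i X \<bullet> v"
      by (simp add: matrix_vector_mult_def transpose_def column_def inner_vec_def)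
    then show ?thesis using fr that unfolding frame_def by simp
  qed
  have "y $ i = 0" if i: "i \<notin> K" for i
  proof -
    have "(transpose X *v (B *v (X *v y))) $ i + y $ i = \<phi> $ i"
      using arg_cong[OF e, of "\<lambda>v. v $ i"] i by simp
    then show ?thesis using t0[OF i] unfolding \<phi>_def by simp
  qed
  then have "(\<chi> i. if i \<in> K then 0 else y $ i) = 0" by (simp add: vec_eq_iff)
  then have "transpose X *v (B *v (X *v y)) = \<phi>" using e by simp
  then have "transpose X *v (B *v (u - X *v y)) = 0"
    unfolding \<phi>_def by (simp add: matrix_vector_mult_diff_distrib)
  then have "a \<bullet> (transpose X *v (B *v (u - X *v y))) = 0" by simp
  then have "(X *v a) \<bullet> (B *v (u - X *v y)) = 0" unfolding inner_matvec[of a] by simp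
  then show "(u - frame_proj K X B *v u) \<bullet> (B *v w) = 0"
    unfolding frame_proj_apply w \<phi>_def[symmetric] y_def[symmetric] using spd_sym[OF B] by metis
qed

text \<open>
  Bases are indexed by the type of coordinates, so that they can be used as columns of matrices.
\<close>

lemma subspace_adapted_basis:
  fixes V :: "(real ^ 'n::finite) set"
  assumes V: "subspace V"
  obtains K f where "inj f" "independent (range f)" "span (range (f :: 'n \<Rightarrow> real ^ 'n)) = UNIV"
    "span (f ` K) = V" "card K = dim V"
proof -
  obtain b where b: "b \<subseteq> V" "independent b" "V \<subseteq> span b" "card b = dim V" using basis_exists by blast
  define c where "c = extend_basis b"
  have c: "b \<subseteq> c" "independent c" "span c = UNIV"
    unfolding c_def using extend_basis_superset[OF b(2)] independent_extend_basis[OF b(2)] span_extend_basis[OF b(2)] by auto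
  have fin: "finite c" using c(2) independent_imp_finite by blast
  have "card c = dim (UNIV :: (real ^ 'n) set)" using dim_eq_card[of c UNIV] c by simp
  then have "card c = CARD('n)" by simp
  then obtain f where f: "bij_betw f (UNIV :: 'n set) c"
    using finite_same_card_bij[of "UNIV :: 'n set" c] fin by auto
  define K where "K = f -` b"
  have fK: "f ` K = b" unfolding K_def using f c(1) by (simp add: bij_betw_def image_vimage_eq Int_absorb2)
  have inj: "inj f" and rg: "range f = c" using f unfolding bij_betw_def by auto
  have "card K = card b" using card_image[OF inj_on_subset[OF inj subset_UNIV], of K] fK by simp
  moreover have "span b = V" using b V by (simp add: span_minimal subset_antisym)
  ultimately show ?thesis using that[of f K] inj rg fK c b(4) by simp
qed

lemma frame_of_basis:
  fixes f :: "'n::finite \<Rightarrow> real ^ 'n"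
  assumes inj: "inj_on f K" and ind: "independent (f ` K)" and sp: "span (f ` K) = V"
  shows "frame K (\<chi> i j. if j \<in> K then f j $ i else 0) V"
proof -
  let ?X = "\<chi> i j. if j \<in> K then f j $ i else 0 :: real ^ 'n ^ 'n"
  have col: "column j ?X = (if j \<in> K then f j else 0)" for j by (simp add: column_def vec_eq_iff)
  have ap: "?X *v w = (\<Sum>j\<in>K. w $ j *\<^sub>R f j)" for w
    unfolding matrix_mult_sum col scalar_mult_eq_scaleR
    by (rule sum.mono_neutral_cong_right) auto
  have "range (\<lambda>w. ?X *v w) = V"
  proof
    show "range (\<lambda>w. ?X *v w) \<subseteq> V"
      unfolding ap sp[symmetric] by (intro image_subsetI span_sum span_scale span_base imageI)
    have "f j \<in> range (\<lambda>w. ?X *v w)" if "j \<in> K" for j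
      using column_in_range[of j ?X] that unfolding col by simp
    then have "f ` K \<subseteq> range (\<lambda>w. ?X *v w)" by (rule image_subsetI)
    moreover have "subspace (range (\<lambda>w. ?X *v w))"
      using linear_subspace_image[OF matrix_vector_mul_linear subspace_UNIV] .
    ultimately show "V \<subseteq> range (\<lambda>w. ?X *v w)" unfolding sp[symmetric] by (rule span_minimal)
  qed
  moreover have "w = 0" if "\<forall>i. i \<notin> K \<longrightarrow> w $ i = 0" "?X *v w = 0" for w
  proof -
    have "(\<Sum>v\<in>f ` K. w $ (the_inv_into K f v) *\<^sub>R v) = 0"
      using that(2) unfolding ap by (simp add: sum.reindex[OF inj] the_inv_into_f_f[OF inj])
    then have "w $ (the_inv_into K f v) = 0" if "v \<in> f ` K" for v
      using independentD[OF ind _ subset_refl, of "\<lambda>v. w $ (the_inv_into K f v)"] that by simp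
    then have "w $ j = 0" if "j \<in> K" for j using that the_inv_into_f_f[OF inj that] by fastforce
    then show ?thesis using that(1) unfolding vec_eq_iff by auto
  qed
  ultimately show ?thesis unfolding frame_def col by auto
qed

lemma frame_exists:
  fixes V :: "(real ^ 'n::finite) set"
  assumes "subspace V" obtains K X where "frame K X V"
proof -
  obtain K and f :: "'n \<Rightarrow> real ^ 'n" where f: "inj f" "independent (range f)" "span (range f) = UNIV"
    "span (f ` K) = V" "card K = dim V"
    by (rule subspace_adapted_basis[OF assms])
  have "inj_on f K" using f(1) by (rule inj_on_subset) simp
  moreover have "independent (f ` K)" by (rule independent_mono[OF f(2)]) blast
  ultimately show ?thesis using f(4) by (intro that[OF frame_of_basis])
qed

text \<open>
  The matrix of the \<open>B\<close>-orthogonal projection onto \<open>V\<close>, characterised without choice of a frame.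
\<close>

definition oproj :: "real ^ 'n::finite ^ 'n \<Rightarrow> (real ^ 'n) set \<Rightarrow> real ^ 'n ^ 'n" where
  "oproj B V = matrix (\<lambda>u. THE v. v \<in> V \<and> (\<forall>w\<in>V. (u - v) \<bullet> (B *v w) = 0))"

lemma orth_unique:
  assumes B: "spd B" and V: "subspace V" and "v \<in> V" "v' \<in> V"
    "\<forall>w\<in>V. (u - v) \<bullet> (B *v w) = 0" "\<forall>w\<in>V. (u - v') \<bullet> (B *v w) = 0"
  shows "v = v'"
proof (rule ccontr)
  assume "v \<noteq> v'"
  then have "(v - v') \<bullet> (B *v (v - v')) > 0" using spd_pos[OF B] by simp
  moreover have "v - v' \<in> V" using V assms subspace_diff by blast
  then have "(u - v') \<bullet> (B *v (v - v')) - (u - v) \<bullet> (B *v (v - v')) = 0" using assms by simp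
  ultimately show False by (simp add: inner_diff_left)
qed

lemma the_orth_proj:
  assumes B: "spd B" and V: "subspace V" and v: "v \<in> V" "\<forall>w\<in>V. (u - v) \<bullet> (B *v w) = 0"
  shows "(THE v. v \<in> V \<and> (\<forall>w\<in>V. (u - v) \<bullet> (B *v w) = 0)) = v"
  using orth_unique[OF B V] v by (intro the_equality) blast+

lemma oproj_frame:
  assumes B: "spd B" and V: "subspace V" and fr: "frame K X V"
  shows "oproj B V = frame_proj K X B"
proof -
  have "(THE v. v \<in> V \<and> (\<forall>w\<in>V. (u - v) \<bullet> (B *v w) = 0)) = frame_proj K X B *v u" for u
    using frame_proj_projects[OF B fr] by (intro the_orth_proj[OF B V]) auto
  then show ?thesis unfolding oproj_def by simp
qed

context
  fixes B :: "real ^ 'n::finite ^ 'n" and V :: "(real ^ 'n) set"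
  assumes B: "spd B" and V: "subspace V"
begin

lemma oproj_in: "oproj B V *v u \<in> V"
  and oproj_orth: "w \<in> V \<Longrightarrow> (u - oproj B V *v u) \<bullet> (B *v w) = 0"
proof -
  obtain K X where fr: "frame K X V" using frame_exists[OF V] by blast
  show "oproj B V *v u \<in> V" unfolding oproj_frame[OF B V fr] by (rule frame_proj_projects(1)[OF B fr])
  show "(u - oproj B V *v u) \<bullet> (B *v w) = 0" if "w \<in> V"
    unfolding oproj_frame[OF B V fr] by (rule frame_proj_projects(2)[OF B fr that])
qed

lemma oproj_unique: "v \<in> V \<Longrightarrow> (\<And>w. w \<in> V \<Longrightarrow> (u - v) \<bullet> (B *v w) = 0) \<Longrightarrow> oproj B V *v u = v"
  using orth_unique[OF B V oproj_in] oproj_orth by blast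

lemma oproj_the: "(THE v. v \<in> V \<and> (\<forall>w\<in>V. (u - v) \<bullet> (B *v w) = 0)) = oproj B V *v u"
  using the_orth_proj[OF B V oproj_in] oproj_orth by blast

lemma oproj_id: "v \<in> V \<Longrightarrow> oproj B V *v v = v"
  by (rule oproj_unique) auto

lemma oproj_zero: "(\<And>w. w \<in> V \<Longrightarrow> u \<bullet> (B *v w) = 0) \<Longrightarrow> oproj B V *v u = 0"
  using subspace_0[OF V] by (intro oproj_unique) auto

lemma oproj_selfadj: "u \<bullet> (B *v (oproj B V *v w)) = (oproj B V *v u) \<bullet> (B *v (oproj B V *v w))"
  using oproj_orth[OF oproj_in, of u w] by (simp add: inner_diff_left)

text \<open>
  Multiply the inner product \<open>B\<close> by \<open>\<mu>\<close> on \<open>V\<close> and keep it on the orthogonal complement, leaving the two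
  spaces orthogonal to each other.
\<close>

definition rescale :: "real \<Rightarrow> real ^ 'n ^ 'n" where
  "rescale \<mu> = B + (\<mu> - 1) *\<^sub>R (B ** oproj B V)"

lemma rescale_apply: "rescale \<mu> *v u = B *v u + (\<mu> - 1) *\<^sub>R (B *v (oproj B V *v u))"
  unfolding rescale_def
  by (simp add: matrix_vector_mult_add_rdistrib scaleR_matrix_vector_assoc[symmetric] matrix_vector_mul_assoc)

lemma rescale_vert: "v \<in> V \<Longrightarrow> rescale \<mu> *v v = \<mu> *\<^sub>R (B *v v)"
  unfolding rescale_apply by (simp add: oproj_id algebra_simps)

lemma rescale_hor: "(\<And>w. w \<in> V \<Longrightarrow> u \<bullet> (B *v w) = 0) \<Longrightarrow> rescale \<mu> *v u = B *v u"
  unfolding rescale_apply by (simp add: oproj_zero)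

lemma rescale_form: "u \<bullet> (rescale \<mu> *v w) =
    (u - oproj B V *v u) \<bullet> (B *v (w - oproj B V *v w)) + \<mu> * ((oproj B V *v u) \<bullet> (B *v (oproj B V *v w)))"
  unfolding rescale_apply
  using oproj_selfadj[of u w] oproj_selfadj[of w u] spd_sym[OF B, of "oproj B V *v u"]
  by (simp add: inner_add_right inner_diff_left inner_diff_right matrix_vector_mult_diff_distrib algebra_simps)

lemma rescale_spd: assumes mu: "\<mu> > 0" shows "spd (rescale \<mu>)"
  unfolding spd_def
proof (intro conjI allI impI)
  show "transpose (rescale \<mu>) = rescale \<mu>"
  proof (rule matrix_eqI_inner)
    fix u w
    have "u \<bullet> (transpose (rescale \<mu>) *v w) = w \<bullet> (rescale \<mu> *v u)"
      by (simp add: inner_matvec inner_commute)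
    also have "\<dots> = u \<bullet> (rescale \<mu> *v w)"
      unfolding rescale_form using spd_sym[OF B] by metis
    finally show "u \<bullet> (transpose (rescale \<mu>) *v w) = u \<bullet> (rescale \<mu> *v w)" .
  qed
next
  fix v :: "real ^ 'n" assume v: "v \<noteq> 0"
  let ?p = "oproj B V *v v"
  have nn: "x \<bullet> (B *v x) \<ge> 0" for x using spd_pos[OF B, of x] by (cases "x = 0") auto
  show "v \<bullet> (rescale \<mu> *v v) > 0"
  proof (cases "?p = 0")
    case True
    then show ?thesis unfolding rescale_form using spd_pos[OF B v] by simp
  next
    case False
    then show ?thesis unfolding rescale_form using mu spd_pos[OF B False] nn[of "v - ?p"]
      by (simp add: add_nonneg_pos)
  qed
qed

lemma rescale_orth_iff:
  "\<mu> > 0 \<Longrightarrow> w \<in> V \<Longrightarrow> u \<bullet> (rescale \<mu> *v w) = 0 \<longleftrightarrow> u \<bullet> (B *v w) = 0"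
  by (simp add: rescale_vert)

lemma transverse_matrix:
  "(\<chi> i j. (axis i 1 - oproj B V *v axis i 1) \<bullet> (B *v (axis j 1 - oproj B V *v axis j 1))) = B - B ** oproj B V"
proof -
  have "(u - oproj B V *v u) \<bullet> (B *v (w - oproj B V *v w)) = u \<bullet> ((B - B ** oproj B V) *v w)" for u w
    using oproj_selfadj[of u w] oproj_orth[OF oproj_in, of w u] spd_sym[OF B, of "oproj B V *v u"]
    by (simp add: inner_diff_left inner_diff_right matrix_vector_mult_diff_distrib
        matrix_vector_mult_diff_rdistrib matrix_vector_mul_assoc[symmetric])
  then show ?thesis unfolding vec_eq_iff vec_lambda_beta matrix_entry[of "B - B ** oproj B V"] by simp
qed

lemma leaf_matrix:
  "(\<chi> i j. (oproj B V *v axis i 1) \<bullet> (B *v (oproj B V *v axis j 1))) = B ** oproj B V"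
  unfolding vec_eq_iff matrix_entry vec_lambda_beta
  using oproj_selfadj by (simp add: matrix_vector_mul_assoc[symmetric] inner_axis)

text \<open>
  In a basis adapted to the splitting into \<open>V\<close> and its orthogonal complement, rescaling multiplies by a
  diagonal matrix with entries \<open>\<mu>\<close> on \<open>V\<close> and \<open>1\<close> on the complement.
\<close>

lemma det_rescale: "det (rescale \<mu>) = \<mu> ^ dim V * det B"
proof -
  obtain K and f :: "'n \<Rightarrow> real ^ 'n" where "inj f" "independent (range f)"
    and f: "span (range f) = UNIV" "span (f ` K) = V" "card K = dim V"
    by (rule subspace_adapted_basis[OF V])
  let ?P = "oproj B V"
  define M where "M = mat 1 + (\<mu> - 1) *\<^sub>R ?P"
  \<comment> \<open>Replace the basis vectors outside \<open>V\<close> by their components orthogonal to \<open>V\<close>.\<close>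
  define e where "e j = (if j \<in> K then f j else f j - ?P *v f j)" for j
  define E where "E = (\<chi> i j. e j $ i)"
  define D where "D = (\<chi> i j. if i = j then (if j \<in> K then \<mu> else 1) else 0 :: real ^ 'n ^ 'n)"
  have colE: "column j E = e j" for j unfolding E_def column_def by (simp add: vec_eq_iff)
  have M: "M *v u = u + (\<mu> - 1) *\<^sub>R (?P *v u)" for u
    unfolding M_def by (simp add: matrix_vector_mult_add_rdistrib scaleR_matrix_vector_assoc[symmetric])
  have "rescale \<mu> = B ** M"
    unfolding matrix_eq rescale_apply
    by (simp add: matrix_vector_mul_assoc[symmetric] M matrix_vector_right_distrib matrix_vector_mult_scaleR)
  have fV: "f j \<in> V" if "j \<in> K" for j using that f(2) span_base[of "f j" "f ` K"] by simp
  have Pv: "?P *v (f j - ?P *v f j) = 0" for j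
    by (simp only: matrix_vector_mult_diff_distrib oproj_id[OF oproj_in] diff_self)
  have Me: "M *v e j = (if j \<in> K then \<mu> else 1) *\<^sub>R e j" for j
    unfolding M e_def by (simp add: oproj_id[OF fV] Pv oproj_id[OF oproj_in] algebra_simps)
  have "M ** E = E ** D"
  proof -
    have "(M ** E) *v axis j 1 = (E ** D) *v axis j 1" for j
    proof -
      have Dj: "D *v axis j 1 = (if j \<in> K then \<mu> else 1) *\<^sub>R axis j 1"
        unfolding D_def matrix_vector_mult_basis column_def by (auto simp: vec_eq_iff axis_def)
      have "(M ** E) *v axis j 1 = M *v e j"
        by (subst matrix_vector_mul_assoc[symmetric]) (simp only: matrix_vector_mult_basis colE)
      also have "\<dots> = E *v ((if j \<in> K then \<mu> else 1) *\<^sub>R axis j 1)"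
        unfolding Me by (simp add: matrix_vector_mult_scaleR matrix_vector_mult_basis colE)
      also have "\<dots> = (E ** D) *v axis j 1"
        by (subst matrix_vector_mul_assoc[symmetric]) (simp only: Dj)
      finally show ?thesis .
    qed
    then show ?thesis unfolding matrix_vector_mult_basis by (simp add: vec_eq_iff column_def)
  qed
  moreover have "det D = \<mu> ^ dim V"
  proof -
    have "det D = (\<Prod>i\<in>UNIV. D $ i $ i)" by (rule det_diagonal) (simp add: D_def)
    also have "\<dots> = (\<Prod>i\<in>UNIV. if i \<in> K then \<mu> else 1)" unfolding D_def by simp
    also have "\<dots> = (\<Prod>i\<in>K. \<mu>)" by (simp add: prod.If_cases)
    finally show ?thesis using f(3) by simp
  qed
  moreover have "det E \<noteq> 0"
  proof -
    have ek: "f j \<in> span (columns E)" if "j \<in> K" for j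
    proof -
      have "f j = column j E" unfolding colE e_def using that by simp
      then show ?thesis by (auto simp: columns_def intro!: span_base)
    qed
    then have "span (f ` K) \<subseteq> span (columns E)" by (intro span_minimal) auto
    then have VE: "V \<subseteq> span (columns E)" using f(2) by simp
    have en: "f j \<in> span (columns E)" if "j \<notin> K" for j
    proof -
      have "f j = column j E + ?P *v f j" unfolding colE e_def using that by simp
      moreover have "column j E \<in> span (columns E)" by (auto simp: columns_def intro!: span_base)
      moreover have "?P *v f j \<in> span (columns E)" using subsetD[OF VE oproj_in] .
      ultimately show ?thesis using span_add[of "column j E" "columns E" "?P *v f j"] by simp
    qed
    have "f j \<in> span (columns E)" for j using ek[of j] en[of j] by (cases "j \<in> K") simp_all
    then have "range f \<subseteq> span (columns E)" by (intro image_subsetI)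
    then have "span (range f) \<subseteq> span (columns E)" by (rule span_minimal) simp
    then have "span (columns E) = UNIV" unfolding f(1) by (rule top.extremum_uniqueI)
    then have "invertible E"
      using matrix_right_invertible_span_columns[of E] invertible_right_inverse[of E] by (simp add: span_vec_eq)
    then show ?thesis using invertible_det_nz[of E] by simp
  qed
  ultimately have "det M = \<mu> ^ dim V" using det_mul[of M E] det_mul[of E D] by simp
  then show ?thesis using \<open>rescale \<mu> = B ** M\<close> by (simp add: det_mul)
qed

end

lemma oproj_rescale:
  assumes B: "spd B" and V: "subspace V" and mu: "\<mu> > 0"
  shows "oproj (rescale B V \<mu>) V = oproj B V"
proof -
  have "oproj (rescale B V \<mu>) V *v u = oproj B V *v u" for u
    using oproj_in[OF B V] oproj_orth[OF B V]
    by (intro oproj_unique[OF rescale_spd[OF B V mu] V]) (auto simp: rescale_orth_iff[OF B V mu])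
  then show ?thesis by (simp add: matrix_eq)
qed

text \<open>
  Projections and rescalings are natural under isometries that match the subspaces; this is what
  makes the rescaled metric a tensor field.
\<close>

lemma oproj_transform:
  fixes J :: "real ^ 'n::finite ^ 'n"
  assumes B': "spd B'" and V: "subspace V" and V': "subspace V'" and B: "spd B"
    and J: "B = transpose J ** B' ** J" and JV: "V' = (*v) J ` V"
  shows "J ** oproj B V = oproj B' V' ** J"
proof -
  have in': "x \<bullet> (B *v y) = (J *v x) \<bullet> (B' *v (J *v y))" for x y
    unfolding J matrix_vector_mul_assoc[symmetric] by (simp only: inner_matvec[of x "transpose J"] transpose_transpose)
  have "oproj B' V' *v (J *v u) = J *v (oproj B V *v u)" for u
  proof (rule oproj_unique[OF B' V'])
    show "J *v (oproj B V *v u) \<in> V'" unfolding JV using oproj_in[OF B V] by blast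
    fix w assume "w \<in> V'"
    then obtain w0 where "w0 \<in> V" "w = J *v w0" unfolding JV by blast
    then show "(J *v u - J *v (oproj B V *v u)) \<bullet> (B' *v w) = 0"
      using oproj_orth[OF B V, of w0 u] in'[of "u - oproj B V *v u" w0]
      by (simp add: matrix_vector_mult_diff_distrib)
  qed
  then show ?thesis by (simp add: matrix_eq matrix_vector_mul_assoc[symmetric])
qed

lemma rescale_transform:
  fixes J :: "real ^ 'n::finite ^ 'n"
  assumes B': "spd B'" and V: "subspace V" and V': "subspace V'" and B: "spd B"
    and J: "B = transpose J ** B' ** J" and JV: "V' = (*v) J ` V"
  shows "rescale B V \<mu> = transpose J ** rescale B' V' \<mu> ** J"
proof (rule matrix_eqI_inner)
  fix u w
  have in': "x \<bullet> (B *v y) = (J *v x) \<bullet> (B' *v (J *v y))" for x y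
    unfolding J matrix_vector_mul_assoc[symmetric] by (simp only: inner_matvec[of x "transpose J"] transpose_transpose)
  have pr: "J *v (oproj B V *v y) = oproj B' V' *v (J *v y)" for y
    using oproj_transform[OF assms] by (simp add: matrix_vector_mul_assoc)
  have "u \<bullet> (rescale B V \<mu> *v w) = (J *v u) \<bullet> (rescale B' V' \<mu> *v (J *v w))"
    unfolding rescale_apply[OF B V] rescale_apply[OF B' V'] by (simp add: inner_add_right in' pr)
  also have "\<dots> = u \<bullet> ((transpose J ** rescale B' V' \<mu> ** J) *v w)"
    unfolding matrix_vector_mul_assoc[symmetric] by (simp only: inner_matvec[of u "transpose J"] transpose_transpose)
  finally show "u \<bullet> (rescale B V \<mu> *v w) = u \<bullet> ((transpose J ** rescale B' V' \<mu> ** J) *v w)" .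
qed

section \<open>Charts, leaves and local frames\<close>

lemma open_real_around_0:
  assumes "open (S :: real set)" "0 \<in> S" obtains e where "e > 0" "{-e<..<e} \<subseteq> S"
proof -
  obtain e where e: "e > 0" "ball 0 e \<subseteq> S" using assms unfolding open_contains_ball by blast
  have "{-e<..<e} \<subseteq> ball 0 e" by (auto simp: dist_real_def)
  then show ?thesis using e that[of e] by (meson order_trans)
qed

lemma matrix_linear_apply: "linear f \<Longrightarrow> matrix f *v x = f x" for f :: "real ^ 'n::finite \<Rightarrow> real ^ 'm::finite"
  by (simp add: matrix_works linear_matrix_vector_mul_eq)

text \<open>
  Coordinates, jacobians and tangent vectors of leaves on a manifold.  All facts hold for any atlas, in
  particular for the given one enlarged by a slice chart.
\<close>

locale atlas =
  fixes A :: "('m::t2_space, 'n::finite) chart set"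
  assumes atl: "smooth_atlas A"
begin

lemma chart_open: "c \<in> A \<Longrightarrow> open (fst c)" and chart_range_open: "c \<in> A \<Longrightarrow> open (chart_range c)"
  and chart_homeo: "c \<in> A \<Longrightarrow> homeomorphism (fst c) (chart_range c) (snd c) (chart_inv c)"
  using atl unfolding smooth_atlas_def by auto

lemma chart_inv_left [simp]: "c \<in> A \<Longrightarrow> x \<in> fst c \<Longrightarrow> chart_inv c (snd c x) = x"
  using chart_homeo unfolding homeomorphism_def by auto

lemma chart_inv_right [simp]: "c \<in> A \<Longrightarrow> z \<in> chart_range c \<Longrightarrow> snd c (chart_inv c z) = z"
  using chart_homeo unfolding homeomorphism_def by auto

lemma chart_inv_in [simp]: "c \<in> A \<Longrightarrow> z \<in> chart_range c \<Longrightarrow> chart_inv c z \<in> fst c"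
  using chart_homeo[of c] unfolding homeomorphism_def by blast

lemma chart_in_range [simp]: "x \<in> fst c \<Longrightarrow> snd c x \<in> chart_range c"
  unfolding chart_range_def by auto

lemma chart_cover: obtains c where "c \<in> A" "x \<in> fst c"
proof -
  have "x \<in> (\<Union>c\<in>A. fst c)" using atl unfolding smooth_atlas_def by simp
  then show ?thesis using that by auto
qed

lemma chart_image: "c \<in> A \<Longrightarrow> snd c ` (fst c \<inter> U) = {z \<in> chart_range c. chart_inv c z \<in> U}"
proof (intro equalityI subsetI)
  fix z assume "c \<in> A" "z \<in> {z \<in> chart_range c. chart_inv c z \<in> U}"
  then have "chart_inv c z \<in> fst c \<inter> U" "z = snd c (chart_inv c z)" by auto
  then show "z \<in> snd c ` (fst c \<inter> U)" by (metis imageI)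
qed auto

lemma chart_inv_continuous: "c \<in> A \<Longrightarrow> continuous_on (chart_range c) (chart_inv c)"
  using chart_homeo unfolding homeomorphism_def by auto

lemma chart_continuous: "c \<in> A \<Longrightarrow> continuous_on (fst c) (snd c)"
  using chart_homeo unfolding homeomorphism_def by auto

lemma chart_image_open: "c \<in> A \<Longrightarrow> open U \<Longrightarrow> open (snd c ` (fst c \<inter> U))"
proof -
  assume c: "c \<in> A" and U: "open U"
  have "open (chart_range c \<inter> chart_inv c -` U)"
    by (rule continuous_open_preimage[OF chart_inv_continuous[OF c] chart_range_open[OF c] U])
  then show ?thesis unfolding chart_image[OF c] by (simp add: vimage_def Int_def)
qed

lemma chart_image_UNIV: "snd c ` (fst c \<inter> UNIV) = chart_range c" for c :: "('m, 'n) chart"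
  unfolding chart_range_def by simp

abbreviation overlap :: "('m, 'n) chart \<Rightarrow> ('m, 'n) chart \<Rightarrow> (real ^ 'n) set" where
  "overlap c d \<equiv> snd c ` (fst c \<inter> fst d)"

lemma overlap_open: "c \<in> A \<Longrightarrow> d \<in> A \<Longrightarrow> open (overlap c d)"
  by (rule chart_image_open[OF _ chart_open])

lemma in_overlap: "x \<in> fst c \<Longrightarrow> x \<in> fst d \<Longrightarrow> snd c x \<in> overlap c d" for c d :: "('m, 'n) chart"
  by auto

lemma transition_smooth: "c \<in> A \<Longrightarrow> d \<in> A \<Longrightarrow> smooth_on (overlap c d) (\<lambda>z. snd d (chart_inv c z))"
  using atl unfolding smooth_atlas_def o_def by auto

lemma transition_derivative:
  assumes "c \<in> A" "d \<in> A" "x \<in> fst c" "x \<in> fst d"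
  shows "((\<lambda>z. snd d (chart_inv c z)) has_derivative (\<lambda>v. jacobian c d x *v v)) (at (snd c x))"
proof -
  have "((\<lambda>z. snd d (chart_inv c z)) has_derivative frechet_derivative (\<lambda>z. snd d (chart_inv c z)) (at (snd c x))) (at (snd c x))"
    by (rule smooth_on_has_derivative[OF transition_smooth[OF assms(1,2)] in_overlap[OF assms(3,4)]])
  moreover have "jacobian c d x *v v = frechet_derivative (\<lambda>z. snd d (chart_inv c z)) (at (snd c x)) v" for v
    unfolding jacobian_def o_def
    using matrix_linear_apply[OF has_derivative_linear[OF calculation]] by simp
  ultimately show ?thesis by simp
qed

lemma jacobian_apply:
  assumes "c \<in> A" "d \<in> A" "x \<in> fst c" "x \<in> fst d"
  shows "jacobian c d x *v v = frechet_derivative (\<lambda>z. snd d (chart_inv c z)) (at (snd c x)) v"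
  using frechet_derivative_eq[OF transition_derivative[OF assms]] by simp

lemma jacobian_inverse:
  assumes "c \<in> A" "d \<in> A" "x \<in> fst c" "x \<in> fst d"
  shows "jacobian d c x ** jacobian c d x = mat 1"
proof -
  have 1: "((\<lambda>z. snd c (chart_inv d (snd d (chart_inv c z)))) has_derivative (\<lambda>v. jacobian d c x *v (jacobian c d x *v v))) (at (snd c x))"
  proof -
    have "((\<lambda>z. snd c (chart_inv d z)) has_derivative (\<lambda>v. jacobian d c x *v v)) (at (snd d (chart_inv c (snd c x))))"
      using transition_derivative[OF assms(2,1,4,3)] assms by simp
    from diff_chain_at[OF transition_derivative[OF assms] this] show ?thesis by (simp add: o_def)
  qed
  have 2: "((\<lambda>z. z) has_derivative (\<lambda>v. jacobian d c x *v (jacobian c d x *v v))) (at (snd c x))"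
    by (rule has_derivative_transform_within_open[OF 1 overlap_open[OF assms(1,2)] in_overlap[OF assms(3,4)]])
       (use assms in auto)
  have "(\<lambda>v. jacobian d c x *v (jacobian c d x *v v)) = (\<lambda>v. v)"
    by (rule has_derivative_unique[OF 2 has_derivative_ident])
  then have "(jacobian d c x ** jacobian c d x) *v v = mat 1 *v v" for v
    by (simp add: matrix_vector_mul_assoc[symmetric] fun_eq_iff)
  then show ?thesis by (simp add: matrix_eq)
qed

lemma jacobian_inverse_apply:
  assumes "c \<in> A" "d \<in> A" "x \<in> fst c" "x \<in> fst d"
  shows "jacobian d c x *v (jacobian c d x *v v) = v"
  using jacobian_inverse[OF assms] by (simp add: matrix_vector_mul_assoc)

lemma curve_change:
  assumes cd: "c \<in> A" "d \<in> A" and z: "(z has_vector_derivative v) (at t)" "z t \<in> overlap c d"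
  shows "((\<lambda>s. snd d (chart_inv c (z s))) has_vector_derivative jacobian c d (chart_inv c (z t)) *v v) (at t)"
proof -
  have x: "chart_inv c (z t) \<in> fst c" "chart_inv c (z t) \<in> fst d" "snd c (chart_inv c (z t)) = z t"
    using z(2) cd by auto
  have "((\<lambda>z. snd d (chart_inv c z)) has_derivative (\<lambda>v. jacobian c d (chart_inv c (z t)) *v v)) (at (z t))"
    using transition_derivative[OF cd x(1,2)] x(3) by simp
  from vector_derivative_diff_chain_within[OF z(1) has_derivative_at_withinI[OF this]]
  show ?thesis by (simp add: o_def)
qed

lemma leaf_tangentE:
  assumes "v \<in> leaf_tangent F c x"
  obtains e z where "e > 0" "smooth_on {-e<..<e} z" "continuous_on {-e<..<e} z"
    "\<And>t. t \<in> {-e<..<e} \<Longrightarrow> z t \<in> chart_range c" "\<And>t. t \<in> {-e<..<e} \<Longrightarrow> chart_inv c (z t) \<in> leaf_of F x"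
    "z 0 = snd c x" "(z has_vector_derivative v) (at (0::real))"
proof -
  obtain e z where e: "e > 0" and z: "smooth_on {-e<..<e} z"
     "\<And>t. t \<in> {-e<..<e} \<Longrightarrow> z t \<in> chart_range c" "\<And>t. t \<in> {-e<..<e} \<Longrightarrow> chart_inv c (z t) \<in> leaf_of F x"
     "z 0 = snd c x" "v = vector_derivative z (at (0::real))"
    using assms unfolding leaf_tangent_def by auto
  have zd: "(z has_vector_derivative v) (at 0)"
    unfolding z(5) using smooth_on_imp_differentiable[OF z(1), of 0] e
    by (simp add: vector_derivative_works[symmetric])
  show ?thesis by (rule that[OF e z(1) smooth_on_imp_continuous_on[OF z(1)] z(2-4) zd])
qed

lemma leaf_tangent_change:
  assumes cd: "c \<in> A" "d \<in> A" and x: "x \<in> fst c" "x \<in> fst d" and v: "v \<in> leaf_tangent F c x"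
  shows "jacobian c d x *v v \<in> leaf_tangent F d x"
proof -
  obtain e z where e: "e > 0" and z: "smooth_on {-e<..<e} z"
     "\<And>t. t \<in> {-e<..<e} \<Longrightarrow> z t \<in> chart_range c" "\<And>t. t \<in> {-e<..<e} \<Longrightarrow> chart_inv c (z t) \<in> leaf_of F x"
     "z 0 = snd c x" and zd: "(z has_vector_derivative v) (at 0)" and zc: "continuous_on {-e<..<e} z"
    by (rule leaf_tangentE[OF v]) (rule that)
  have "open ({-e<..<e} \<inter> z -` overlap c d)"
    by (rule continuous_open_preimage[OF zc _ overlap_open[OF cd]]) simp
  moreover have "0 \<in> {-e<..<e} \<inter> z -` overlap c d" using e z(4) x by auto
  ultimately obtain e' where e': "e' > 0" "{-e'<..<e'} \<subseteq> {-e<..<e} \<inter> z -` overlap c d"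
    by (rule open_real_around_0)
  define w where "w t = snd d (chart_inv c (z t))" for t
  have "smooth_on {-e'<..<e'} (\<lambda>t. snd d (chart_inv c (z t)))"
    by (rule smooth_on_compose[OF _ overlap_open[OF cd] _ smooth_on_subset[OF z(1)] transition_smooth[OF cd]])
       (use e' in auto)
  then have w: "smooth_on {-e'<..<e'} w" unfolding w_def .
  have zo: "z 0 \<in> overlap c d" using z(4) x by auto
  have "(w has_vector_derivative jacobian c d x *v v) (at 0)"
    unfolding w_def using curve_change[OF cd zd zo] z(4) cd x by simp
  then have wd: "jacobian c d x *v v = vector_derivative w (at 0)"
    by (simp add: vector_derivative_at)
  have wt: "w t \<in> chart_range d \<and> chart_inv d (w t) \<in> leaf_of F x" if "t \<in> {-e'<..<e'}" for t
  proof -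
    have "z t \<in> overlap c d" "t \<in> {-e<..<e}" using e'(2) that by auto
    then have "chart_inv c (z t) \<in> fst d" using cd by auto
    then show ?thesis unfolding w_def using z(3)[OF \<open>t \<in> {-e<..<e}\<close>] cd by simp
  qed
  have w0: "w 0 = snd d x" unfolding w_def using z(4) cd x by simp
  show ?thesis unfolding leaf_tangent_def mem_Collect_eq
    by (rule exI[of _ e'], intro conjI e'(1), rule exI[of _ w]) (use w wt w0 wd in auto)
qed

text \<open>
  Applied to an atlas that contains a slice chart of the leaf, this reduces statements about tangent
  spaces of leaves to coordinate subspaces.
\<close>

lemma leaf_tangent_image:
  assumes cd: "c \<in> A" "d \<in> A" and x: "x \<in> fst c" "x \<in> fst d"
  shows "leaf_tangent F d x = (*v) (jacobian c d x) ` leaf_tangent F c x"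
proof (intro equalityI subsetI)
  fix v assume "v \<in> leaf_tangent F d x"
  then have "jacobian d c x *v v \<in> leaf_tangent F c x" using leaf_tangent_change[of d c x v F] cd x by simp
  moreover have "v = jacobian c d x *v (jacobian d c x *v v)"
    using jacobian_inverse_apply[of d c x v] cd x by simp
  ultimately show "v \<in> (*v) (jacobian c d x) ` leaf_tangent F c x" by (metis imageI)
next
  fix v assume "v \<in> (*v) (jacobian c d x) ` leaf_tangent F c x"
  then show "v \<in> leaf_tangent F d x" using leaf_tangent_change[OF cd x] by blast
qed

text \<open>
  In a slice chart the leaf is a piece of a coordinate subspace: curves in it have velocities in the
  subspace, and every vector of the subspace is the velocity of a straight line.
\<close>

lemma slice_leaf_tangent:
  assumes s: "s \<in> A" and x: "x \<in> fst s" "x \<in> leaf_of F x"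
    and slice: "snd s ` (fst s \<inter> leaf_of F x) = chart_range s \<inter> {z. \<forall>i. i \<notin> K \<longrightarrow> z $ i = 0}"
  shows "leaf_tangent F s x = {v. \<forall>i. i \<notin> K \<longrightarrow> v $ i = 0}"
proof (intro equalityI subsetI)
  fix v assume "v \<in> leaf_tangent F s x"
  then obtain e z where e: "e > 0" and z: "smooth_on {-e<..<e} z"
     "\<And>t. t \<in> {-e<..<e} \<Longrightarrow> z t \<in> chart_range s" "\<And>t. t \<in> {-e<..<e} \<Longrightarrow> chart_inv s (z t) \<in> leaf_of F x"
     "z 0 = snd s x" and zd: "(z has_vector_derivative v) (at 0)" and zc: "continuous_on {-e<..<e} z"
    by (rule leaf_tangentE) (rule that)
  have zi: "z t $ i = 0" if "t \<in> {-e<..<e}" "i \<notin> K" for t i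
  proof -
    have "z t \<in> snd s ` (fst s \<inter> leaf_of F x)" unfolding chart_image[OF s] using z(2,3) that by auto
    then show ?thesis unfolding slice using that by auto
  qed
  have "v $ i = 0" if "i \<notin> K" for i
  proof -
    have 1: "((\<lambda>t. z t $ i) has_vector_derivative v $ i) (at 0)"
      by (rule bounded_linear.has_vector_derivative[OF bounded_linear_vec_nth zd])
    have 2: "((\<lambda>t. z t $ i) has_vector_derivative 0) (at 0)"
      by (rule has_vector_derivative_transform_within_open[of "\<lambda>t. 0" _ _ "{-e<..<e}"]) (use e zi that in auto)
    show ?thesis by (rule vector_derivative_unique_at[OF 1 2])
  qed
  then show "v \<in> {v. \<forall>i. i \<notin> K \<longrightarrow> v $ i = 0}" by simp
next
  fix v :: "real ^ 'n" assume v: "v \<in> {v. \<forall>i. i \<notin> K \<longrightarrow> v $ i = 0}"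
  define z where "z t = snd s x + t *\<^sub>R v" for t
  have zd: "(z has_vector_derivative v) (at t)" for t unfolding z_def by (auto intro!: derivative_eq_intros)
  have "open (z -` chart_range s)"
    by (rule open_vimage[OF chart_range_open[OF s]]) (auto simp: z_def intro!: continuous_intros)
  moreover have "0 \<in> z -` chart_range s" using x unfolding z_def by simp
  ultimately obtain e where e: "e > 0" "{-e<..<e} \<subseteq> z -` chart_range s"
    by (rule open_real_around_0)
  have "snd s x \<in> snd s ` (fst s \<inter> leaf_of F x)" using x by blast
  then have x0: "snd s x $ i = 0" if "i \<notin> K" for i using that unfolding slice by auto
  have zt: "z t \<in> chart_range s \<and> chart_inv s (z t) \<in> leaf_of F x" if "t \<in> {-e<..<e}" for t
  proof -
    have "z t \<in> chart_range s" using e(2) that by auto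
    moreover have "z t $ i = 0" if "i \<notin> K" for i unfolding z_def using x0 v that by simp
    ultimately have "z t \<in> snd s ` (fst s \<inter> leaf_of F x)" unfolding slice by simp
    then show ?thesis unfolding chart_image[OF s] by simp
  qed
  have "smooth_on {-e<..<e} z"
    unfolding z_def by (intro smooth_on_add smooth_on_scaleR smooth_on_const smooth_on_ident) auto
  moreover have "z 0 = snd s x" unfolding z_def by simp
  moreover have "v = vector_derivative z (at 0)" by (rule vector_derivative_at[OF zd, symmetric])
  ultimately show "v \<in> leaf_tangent F s x" unfolding leaf_tangent_def mem_Collect_eq
    by (intro exI[of _ e] conjI e(1), intro exI[of _ z]) (use zt in auto)
qed

end

locale foliation = atlas A for A :: "('m::t2_space, 'n::finite) chart set" +
  fixes F :: "'m set set"
  assumes fol: "smooth_foliation A F"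
begin

abbreviation LT :: "('m, 'n) chart \<Rightarrow> 'm \<Rightarrow> (real ^ 'n) set" where "LT \<equiv> leaf_tangent F"

abbreviation reg :: "'m set" where "reg \<equiv> regular_set A F"

lemma part: "partition_on UNIV F" using fol unfolding smooth_foliation_def by simp

lemma leaf_of_props: "leaf_of F x \<in> F" "x \<in> leaf_of F x"
proof -
  have "x \<in> \<Union>F" using partition_onD1[OF part] by simp
  then obtain L where L: "L \<in> F" "x \<in> L" by (rule UnionE)
  have "L' = L" if L': "L' \<in> F \<and> x \<in> L'" for L'
  proof (rule ccontr)
    assume "L' \<noteq> L"
    then have "L' \<inter> L = {}" using disjointD[OF partition_onD2[OF part], of L' L] L' L by simp
    moreover have "x \<in> L' \<inter> L" using L' L by simp
    ultimately show False by simp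
  qed
  then have "\<exists>!L. L \<in> F \<and> x \<in> L" using L by (intro ex1I[of _ L] conjI)
  from theI'[OF this] show "leaf_of F x \<in> F" "x \<in> leaf_of F x" unfolding leaf_of_def by simp_all
qed

lemma LT_subspace: assumes c: "c \<in> A" "x \<in> fst c" shows "subspace (LT c x)"
proof -
  have "embedded_submanifold A (leaf_of F x)"
    using fol leaf_of_props(1)[of x] unfolding smooth_foliation_def by simp
  then obtain k where k: "\<forall>y\<in>leaf_of F x. \<exists>s K. smooth_atlas (insert s A) \<and> y \<in> fst s \<and> card K = k \<and>
    snd s ` (fst s \<inter> leaf_of F x) = chart_range s \<inter> {z. \<forall>i. i \<notin> K \<longrightarrow> z $ i = 0}"
    unfolding embedded_submanifold_def by (rule exE) (rule that)
  obtain s K where s: "smooth_atlas (insert s A)" "x \<in> fst s"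
    "snd s ` (fst s \<inter> leaf_of F x) = chart_range s \<inter> {z. \<forall>i. i \<notin> K \<longrightarrow> z $ i = 0}"
    using bspec[OF k leaf_of_props(2)[of x]] by (elim exE conjE)
  interpret S: atlas "insert s A" using s(1) by unfold_locales
  have "leaf_tangent F s x = {v. \<forall>i. i \<notin> K \<longrightarrow> v $ i = 0}"
    by (rule S.slice_leaf_tangent) (use s leaf_of_props in auto)
  moreover have "LT c x = (*v) (jacobian s c x) ` leaf_tangent F s x"
    by (rule S.leaf_tangent_image) (use s c in auto)
  moreover have "subspace {v :: real ^ 'n. \<forall>i. i \<notin> K \<longrightarrow> v $ i = 0}" unfolding subspace_def by auto
  ultimately show ?thesis using linear_subspace_image[OF matrix_vector_mul_linear] by simp
qed

lemma LT_dim: assumes cd: "c \<in> A" "d \<in> A" and x: "x \<in> fst c" "x \<in> fst d" shows "dim (LT d x) = dim (LT c x)"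
proof -
  have le: "dim (LT d x) \<le> dim (LT c x)" if "c \<in> A" "d \<in> A" "x \<in> fst c" "x \<in> fst d" for c d
    unfolding leaf_tangent_image[OF that] by (rule dim_image_le[OF matrix_vector_mul_linear])
  show ?thesis using le[OF cd x] le[OF cd(2,1) x(2,1)] by simp
qed

lemma regular_max: assumes "x \<in> reg" "c \<in> A" "x \<in> fst c" "d \<in> A" "y \<in> fst d" shows "dim (LT d y) \<le> dim (LT c x)"
proof -
  obtain c' where "c' \<in> A" "x \<in> fst c'" "\<forall>d\<in>A. \<forall>y\<in>fst d. dim (LT d y) \<le> dim (LT c' x)"
    using assms(1) unfolding regular_set_def by auto
  then show ?thesis using LT_dim[of c' c x] assms by simp
qed

lemma regular_dim: "x \<in> reg \<Longrightarrow> y \<in> reg \<Longrightarrow> c \<in> A \<Longrightarrow> x \<in> fst c \<Longrightarrow> d \<in> A \<Longrightarrow> y \<in> fst d \<Longrightarrow> dim (LT d y) = dim (LT c x)"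
  by (rule antisym; rule regular_max)

definition frame_matrix :: "'n set \<Rightarrow> ('n \<Rightarrow> ('m, 'n) vfield) \<Rightarrow> ('m, 'n) chart \<Rightarrow> real ^ 'n \<Rightarrow> real ^ 'n ^ 'n" where
  "frame_matrix K X c z = (\<chi> i j. if j \<in> K then X j c (chart_inv c z) $ i else 0)"

lemma frame_matrix_column: "column j (frame_matrix K X c z) = (if j \<in> K then X j c (chart_inv c z) else 0)"
  unfolding frame_matrix_def column_def by (simp add: vec_eq_iff)

definition tangent_field :: "('m, 'n) vfield \<Rightarrow> bool" where
  "tangent_field X \<longleftrightarrow> smooth_vector_field A X \<and> (\<forall>d\<in>A. \<forall>y\<in>fst d. X d y \<in> LT d y)"

lemma tangent_field_smooth: "tangent_field X \<Longrightarrow> c \<in> A \<Longrightarrow> smooth_on (chart_range c) (\<lambda>z. X c (chart_inv c z))"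
  unfolding tangent_field_def smooth_vector_field_def by simp

text \<open>
  Extend a basis of the tangent space of a regular leaf by global vertical fields.  Their Gram
  determinant (for the Euclidean inner product of the chart) remains nonzero nearby, so that the
  dimension of the leaves cannot drop; being maximal, it cannot rise, and the fields remain a frame.
\<close>

lemma local_frame:
  assumes x: "x \<in> reg" "c \<in> A" "x \<in> fst c"
  obtains K X N where "open N" "snd c x \<in> N" "N \<subseteq> snd c ` (fst c \<inter> reg)" "\<And>i. tangent_field (X i)"
    "\<And>z. z \<in> N \<Longrightarrow> frame K (frame_matrix K X c z) (LT c (chart_inv c z))"
    "smooth_on N (frame_matrix K X c)"
proof -
  note V = LT_subspace[OF x(2,3)]
  obtain K and f :: "'n \<Rightarrow> real ^ 'n" where f: "inj f" "independent (range f)" "span (range f) = UNIV"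
    "span (f ` K) = LT c x" "card K = dim (LT c x)"
    by (rule subspace_adapted_basis[OF V])
  have "\<exists>X. tangent_field X \<and> (i \<in> K \<longrightarrow> X c x = f i)" for i
  proof -
    have "(if i \<in> K then f i else 0) \<in> LT c x"
      using f(4) span_base[of "f i" "f ` K"] subspace_0[OF V] by auto
    then obtain X where "smooth_vector_field A X" "\<forall>d\<in>A. \<forall>y\<in>fst d. X d y \<in> LT d y" "X c x = (if i \<in> K then f i else 0)"
      using fol x(2,3) unfolding smooth_foliation_def by blast
    then show ?thesis unfolding tangent_field_def by auto
  qed
  then obtain X where X: "\<And>i. tangent_field (X i)" "\<And>i. i \<in> K \<Longrightarrow> X i c x = f i" by metis
  have Xin: "X i c (chart_inv c z) \<in> LT c (chart_inv c z)" if "z \<in> chart_range c" for i z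
    using X(1)[of i] x(2) that unfolding tangent_field_def by simp
  have col: "column i (frame_matrix K X c z) \<in> LT c (chart_inv c z)" if "z \<in> chart_range c" for i z
    unfolding frame_matrix_column using Xin[OF that] subspace_0[OF LT_subspace] x(2) that by simp
  have sm: "smooth_on (chart_range c) (frame_matrix K X c)"
  proof (intro smooth_on_vecI chart_range_open x)
    fix i j
    have "smooth_on (chart_range c) (\<lambda>z. if j \<in> K then X j c (chart_inv c z) $ i else 0)"
      by (cases "j \<in> K") (auto intro!: smooth_on_const smooth_on_nth chart_range_open x tangent_field_smooth X)
    then show "smooth_on (chart_range c) (\<lambda>z. frame_matrix K X c z $ i $ j)" unfolding frame_matrix_def by simp
  qed
  have spd1: "spd (mat 1 :: real ^ 'n ^ 'n)" unfolding spd_def by simp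
  define D where "D z = det (gram K (frame_matrix K X c z) (mat 1))" for z
  have Dc: "continuous_on (chart_range c) D"
    unfolding D_def gram_def
    by (intro smooth_on_imp_continuous_on smooth_on_det smooth_on_add smooth_on_matmul smooth_on_transpose
        smooth_on_const sm chart_range_open x)
  define N where "N = chart_range c \<inter> D -` (- {0})"
  have N: "open N" unfolding N_def by (rule continuous_open_preimage[OF Dc chart_range_open[OF x(2)]]) (simp add: open_Compl)
  have fx: "frame_matrix K X c (snd c x) = (\<chi> i j. if j \<in> K then f j $ i else 0)"
    unfolding frame_matrix_def using X(2) x by (simp add: vec_eq_iff)
  have "frame K (frame_matrix K X c (snd c x)) (LT c x)"
    unfolding fx by (rule frame_of_basis[OF inj_on_subset[OF f(1) subset_UNIV] independent_mono[OF f(2)] f(4)]) auto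
  then have "invertible (gram K (frame_matrix K X c (snd c x)) (mat 1))"
    by (intro gram_invertible[OF spd1]) (auto simp: frame_def)
  then have xN: "snd c x \<in> N" unfolding N_def D_def using x by (simp add: invertible_det_nz)
  have inv: "invertible (gram K (frame_matrix K X c z) (mat 1))" if "z \<in> N" for z
    using that unfolding N_def D_def by (simp add: invertible_det_nz)
  have Nr: "z \<in> chart_range c" if "z \<in> N" for z using that unfolding N_def by simp
  have fr: "frame K (frame_matrix K X c z) (LT c (chart_inv c z))" if "z \<in> N" for z
  proof (rule frame_of_gram[OF _ inv[OF that] LT_subspace col[OF Nr[OF that]]])
    show "dim (LT c (chart_inv c z)) \<le> card K"
      unfolding f(5) using regular_max[OF x] x Nr[OF that] by simp
  qed (use x Nr[OF that] in \<open>auto simp: frame_matrix_column\<close>)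
  have "chart_inv c z \<in> reg" if "z \<in> N" for z
  proof -
    have "card K \<le> dim (LT c (chart_inv c z))"
      by (rule gram_card_le_dim[OF inv[OF that] LT_subspace col[OF Nr[OF that]]]) (use x Nr[OF that] in auto)
    then have "dim (LT d y) \<le> dim (LT c (chart_inv c z))" if "d \<in> A" "y \<in> fst d" for d y
      using regular_max[OF x that] f(5) by simp
    then show ?thesis unfolding regular_set_def using x(2) chart_inv_in[OF x(2) Nr[OF that]] by auto
  qed
  then have Nreg: "N \<subseteq> snd c ` (fst c \<inter> reg)"
    unfolding chart_image[OF x(2)] using Nr by auto
  show ?thesis
    by (rule that[OF N xN Nreg X(1) fr smooth_on_subset[OF sm]]) (use Nr in auto)
qed

text \<open>
  The neighbourhoods on which a frame persists consist of regular points.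
\<close>

lemma regular_open: "open reg"
proof (subst open_subopen, intro ballI)
  fix x assume x: "x \<in> reg"
  obtain c where c: "c \<in> A" "x \<in> fst c" by (rule chart_cover)
  obtain K X N where N: "open N" "snd c x \<in> N" "N \<subseteq> snd c ` (fst c \<inter> reg)"
    and "\<And>i. tangent_field (X i)" "\<And>z. z \<in> N \<Longrightarrow> frame K (frame_matrix K X c z) (LT c (chart_inv c z))"
    "smooth_on N (frame_matrix K X c)"
    by (rule local_frame[OF x c]) (rule that)
  have "open (fst c \<inter> snd c -` N)"
    by (rule continuous_open_preimage[OF chart_continuous[OF c(1)] chart_open[OF c(1)] N(1)])
  moreover have "x \<in> fst c \<inter> snd c -` N" using c N by simp
  moreover have "fst c \<inter> snd c -` N \<subseteq> reg"
  proof
    fix y assume y: "y \<in> fst c \<inter> snd c -` N"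
    then have "snd c y \<in> snd c ` (fst c \<inter> reg)" using N(3) by auto
    then show "y \<in> reg" using y c unfolding chart_image[OF c(1)] by simp
  qed
  ultimately show "\<exists>T. open T \<and> x \<in> T \<and> T \<subseteq> reg" by blast
qed

text \<open>
  A vector tangent to a leaf is the velocity of a curve in the leaf, along which a basic function is
  constant.
\<close>

lemma basic_dfun_zero:
  assumes U: "open U" and f: "smooth_fun A U f" "basic_on F U f" and c: "c \<in> A" "x \<in> fst c" "x \<in> U"
    and v: "v \<in> LT c x"
  shows "dfun c f x v = 0"
proof -
  obtain e z where e: "e > 0" and z: "smooth_on {-e<..<e} z"
     "\<And>t. t \<in> {-e<..<e} \<Longrightarrow> z t \<in> chart_range c" "\<And>t. t \<in> {-e<..<e} \<Longrightarrow> chart_inv c (z t) \<in> leaf_of F x"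
     "z 0 = snd c x" and zd: "(z has_vector_derivative v) (at 0)" and zc: "continuous_on {-e<..<e} z"
    by (rule leaf_tangentE[OF v]) (rule that)
  have "open ({-e<..<e} \<inter> z -` (snd c ` (fst c \<inter> U)))"
    by (rule continuous_open_preimage[OF zc _ chart_image_open[OF c(1) U]]) simp
  moreover have "0 \<in> {-e<..<e} \<inter> z -` (snd c ` (fst c \<inter> U))" using e z(4) c by auto
  ultimately obtain e' where e': "e' > 0" "{-e'<..<e'} \<subseteq> {-e<..<e} \<inter> z -` (snd c ` (fst c \<inter> U))"
    by (rule open_real_around_0)
  have const: "f (chart_inv c (z t)) = f x" if "t \<in> {-e'<..<e'}" for t
  proof -
    have "t \<in> {-e<..<e}" "z t \<in> snd c ` (fst c \<inter> U)" using e' that by auto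
    then have "chart_inv c (z t) \<in> leaf_of F x \<inter> U" using z(3)[of t] unfolding chart_image[OF c(1)] by simp
    moreover have "x \<in> leaf_of F x \<inter> U" using leaf_of_props(2)[of x] c(3) by simp
    ultimately show ?thesis using f(2) leaf_of_props(1)[of x] unfolding basic_on_def by blast
  qed
  have "smooth_on (snd c ` (fst c \<inter> U)) (f \<circ> chart_inv c)" using f(1) c(1) unfolding smooth_fun_def by simp
  then have "(f \<circ> chart_inv c has_derivative dfun c f x) (at (z 0))"
    unfolding dfun_def z(4) using c by (intro smooth_on_has_derivative) auto
  from vector_derivative_diff_chain_within[OF zd has_derivative_at_withinI[OF this]]
  have 1: "((\<lambda>t. f (chart_inv c (z t))) has_vector_derivative dfun c f x v) (at 0)" by (simp add: o_def)
  have 2: "((\<lambda>t. f (chart_inv c (z t))) has_vector_derivative 0) (at 0)"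
    by (rule has_vector_derivative_transform_within_open[of "\<lambda>t. f x" _ _ "{-e'<..<e'}"]) (use e' const in auto)
  show ?thesis by (rule vector_derivative_unique_at[OF 1 2])
qed

end

section \<open>The geodesic equation in coordinates\<close>

lemma bounded_bilinear_matvec: "bounded_bilinear ((*v) :: real ^ 'n::finite ^ 'm::finite \<Rightarrow> real ^ 'n \<Rightarrow> real ^ 'm)"
  unfolding bilinear_conv_bounded_bilinear[symmetric] bilinear_def
proof (intro conjI allI)
  fix y :: "real ^ 'n" show "linear (\<lambda>A :: real ^ 'n ^ 'm. A *v y)"
    by (rule linearI) (simp_all add: matrix_vector_mult_add_rdistrib scaleR_matrix_vector_assoc)
qed (rule matrix_vector_mul_linear)

text \<open>
  Christoffel symbols of a metric that is given as a matrix-valued function \<open>m\<close> of the coordinates, so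
  that geodesics can be treated as curves in a Euclidean space.
\<close>

definition christoffel_coord :: "(real ^ 'n::finite \<Rightarrow> real ^ 'n ^ 'n) \<Rightarrow> real ^ 'n \<Rightarrow> real ^ 'n \<Rightarrow> real ^ 'n \<Rightarrow> real ^ 'n" where
  "christoffel_coord m p u v = matrix_inv (m p) *v
     (\<chi> l. ((frechet_derivative m (at p) u *v v) $ l + (frechet_derivative m (at p) v *v u) $ l
            - u \<bullet> (frechet_derivative m (at p) (axis l 1) *v v)) / 2)"

lemma vec_expand: "(\<Sum>i\<in>UNIV. w $ i *\<^sub>R axis i 1) = (w :: real ^ 'n::finite)"
  using basis_expansion[of w] by (simp add: scalar_mult_eq_scaleR)

text \<open>
  The Christoffel symbols with lowered index, on a repeated vector \<open>u\<close>, paired with \<open>w\<close>.  In this form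
  no inverse matrix occurs, and geodesics are handled below through their pairings only.
\<close>

lemma christoffel_coord_lower:
  assumes d: "(m has_derivative Dm) (at p)" and inv: "invertible (m p)"
  shows "w \<bullet> (m p *v christoffel_coord m p u u) = w \<bullet> (Dm u *v u) - (u \<bullet> (Dm w *v u)) / 2"
proof -
  have lin: "linear Dm" by (rule has_derivative_linear[OF d])
  have D: "frechet_derivative m (at p) = Dm" by (rule frechet_derivative_eq[OF d])
  define y where "y = (\<chi> l. ((Dm u *v u) $ l + (Dm u *v u) $ l - u \<bullet> (Dm (axis l 1) *v u)) / 2)"
  have "m p *v christoffel_coord m p u u = y"
    unfolding christoffel_coord_def D y_def[symmetric] by (simp add: matrix_vector_mul_assoc matrix_inv_both(1)[OF inv])
  then have "w \<bullet> (m p *v christoffel_coord m p u u) = (\<Sum>l\<in>UNIV. w $ l * y $ l)" by (simp add: inner_vec_def)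
  also have "\<dots> = (\<Sum>l\<in>UNIV. w $ l * (Dm u *v u) $ l - (w $ l * (u \<bullet> (Dm (axis l 1) *v u))) / 2)"
    unfolding y_def by (intro sum.cong) (auto simp: field_simps)
  also have "\<dots> = w \<bullet> (Dm u *v u) - (\<Sum>l\<in>UNIV. w $ l * (u \<bullet> (Dm (axis l 1) *v u))) / 2"
    by (simp add: sum_subtractf sum_divide_distrib inner_vec_def)
  also have "(\<Sum>l\<in>UNIV. w $ l * (u \<bullet> (Dm (axis l 1) *v u))) = u \<bullet> (Dm (\<Sum>l\<in>UNIV. w $ l *\<^sub>R axis l 1) *v u)"
    unfolding linear_sum[OF lin] linear_cmul[OF lin]
    by (simp add: bounded_bilinear.sum_left[OF bounded_bilinear_matvec] inner_sum_right scaleR_matrix_vector_assoc[symmetric])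
  finally show ?thesis unfolding vec_expand .
qed

lemma symmetric_derivative:
  fixes m :: "real ^ 'n::finite \<Rightarrow> real ^ 'n ^ 'n"
  assumes d: "(m has_derivative Dm) (at p)" and N: "open N" "p \<in> N" and sym: "\<And>q. q \<in> N \<Longrightarrow> transpose (m q) = m q"
  shows "u \<bullet> (Dm w *v v) = v \<bullet> (Dm w *v u)"
proof -
  have 1: "((\<lambda>q. a \<bullet> (m q *v b)) has_derivative (\<lambda>w. a \<bullet> (Dm w *v b))) (at p)" for a b
    by (intro has_derivative_inner_right bounded_linear.has_derivative[OF bounded_bilinear.bounded_linear_left[OF bounded_bilinear_matvec] d])
  have "((\<lambda>q. u \<bullet> (m q *v v)) has_derivative (\<lambda>w. v \<bullet> (Dm w *v u))) (at p)"
  proof (rule has_derivative_transform_within_open[OF 1 N])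
    fix q assume "q \<in> N"
    then show "v \<bullet> (m q *v u) = u \<bullet> (m q *v v)" using inner_matvec[of v "m q" u] sym[of q] by (simp add: inner_commute)
  qed
  from has_derivative_unique[OF 1[of u v] this] show ?thesis by (rule fun_cong)
qed

text \<open>
  The Euler-Lagrange form of the geodesic equation.  When the acceleration is replaced by Christoffel
  symbols, the derivative of the metric along the velocity cancels, and half of its derivative along \<open>X\<close>
  remains: the result is half the Lie derivative of the metric along \<open>X\<close>, evaluated on the velocity.
\<close>

lemma first_variation:
  fixes z z' :: "real \<Rightarrow> real ^ 'n::finite"
  assumes z: "(z has_vector_derivative u) (at t)" and z': "(z' has_vector_derivative a) (at t)" "z' t = u"
    and m: "(m has_derivative Dm) (at (z t))" and N: "open N" "z t \<in> N" "\<And>q. q \<in> N \<Longrightarrow> transpose (m q) = m q"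
    and inv: "invertible (m (z t))" and geo: "a + christoffel_coord m (z t) u u = 0"
    and X: "(X has_derivative DX) (at (z t))"
  shows "((\<lambda>s. z' s \<bullet> (m (z s) *v X (z s))) has_real_derivative
     ((u \<bullet> (Dm (X (z t)) *v u)) / 2 + u \<bullet> (m (z t) *v DX u))) (at t)"
proof -
  have mz: "((\<lambda>s. m (z s)) has_vector_derivative Dm u) (at t)"
    using vector_derivative_diff_chain_within[OF z has_derivative_at_withinI[OF m]] by (simp add: o_def)
  have Xz: "((\<lambda>s. X (z s)) has_vector_derivative DX u) (at t)"
    using vector_derivative_diff_chain_within[OF z has_derivative_at_withinI[OF X]] by (simp add: o_def)
  have "((\<lambda>s. m (z s) *v X (z s)) has_vector_derivative (m (z t) *v DX u + Dm u *v X (z t))) (at t)"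
    by (rule bounded_bilinear.has_vector_derivative[OF bounded_bilinear_matvec mz Xz])
  from bounded_bilinear.has_vector_derivative[OF bounded_bilinear_inner z'(1) this]
  have 1: "((\<lambda>s. z' s \<bullet> (m (z s) *v X (z s))) has_vector_derivative
     (z' t \<bullet> (m (z t) *v DX u + Dm u *v X (z t)) + a \<bullet> (m (z t) *v X (z t)))) (at t)" .
  have sy: "transpose (m (z t)) = m (z t)" by (rule N(3)[OF N(2)])
  have "a = - christoffel_coord m (z t) u u" using geo by (simp add: eq_neg_iff_add_eq_0)
  then have "a \<bullet> (m (z t) *v X (z t)) = - (X (z t) \<bullet> (m (z t) *v christoffel_coord m (z t) u u))"
    using inner_matvec[of "christoffel_coord m (z t) u u" "m (z t)" "X (z t)"] sy by (simp add: inner_commute)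
  also have "\<dots> = - (X (z t) \<bullet> (Dm u *v u)) + (u \<bullet> (Dm (X (z t)) *v u)) / 2"
    unfolding christoffel_coord_lower[OF m inv] by simp
  also have "X (z t) \<bullet> (Dm u *v u) = u \<bullet> (Dm u *v X (z t))"
    by (rule symmetric_derivative[OF m N])
  finally have "z' t \<bullet> (m (z t) *v DX u + Dm u *v X (z t)) + a \<bullet> (m (z t) *v X (z t)) =
     (u \<bullet> (Dm (X (z t)) *v u)) / 2 + u \<bullet> (m (z t) *v DX u)"
    unfolding z'(2) by (simp add: inner_add_right)
  with 1 show ?thesis by (simp add: has_real_derivative_iff_has_vector_derivative)
qed

text \<open>
  Invariance of the geodesic equation under an isometric change of coordinates \<open>\<phi>\<close>.  The pairing of the
  velocity with a constant field \<open>w\<close> is differentiated twice: by the geodesic equation in the old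
  coordinates, and as the pairing of the new velocity with \<open>D\<phi> w\<close>.  The derivative of \<open>m\<close> in the old
  coordinates is expressed through that in the new ones; the second derivatives of \<open>\<phi>\<close> that occur
  cancel by Schwarz's theorem, and the geodesic equation paired with \<open>D\<phi> w\<close> remains.
\<close>

lemma geodesic_coordinate_change:
  fixes z z' :: "real \<Rightarrow> real ^ 'n::finite" and \<phi> :: "real ^ 'n \<Rightarrow> real ^ 'n"
  assumes O: "open O'" and phi: "smooth_on O' \<phi>"
    and mc: "\<And>q. q \<in> O' \<Longrightarrow> spd (mc q)" "mc differentiable at (z t)"
    and md: "spd (md (\<phi> (z t)))" "md differentiable at (\<phi> (z t))" "\<And>q. q \<in> O' \<Longrightarrow> transpose (md (\<phi> q)) = md (\<phi> q)"
      "open N" "\<phi> (z t) \<in> N" "\<And>q. q \<in> N \<Longrightarrow> transpose (md q) = md q"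
    and iso: "\<And>q u w. q \<in> O' \<Longrightarrow> u \<bullet> (mc q *v w) = frechet_derivative \<phi> (at q) u \<bullet> (md (\<phi> q) *v frechet_derivative \<phi> (at q) w)"
    and surj: "surj (frechet_derivative \<phi> (at (z t)))"
    and J: "open J" "t \<in> J" "\<And>s. s \<in> J \<Longrightarrow> z s \<in> O'" "\<And>s. s \<in> J \<Longrightarrow> (z has_vector_derivative z' s) (at s)"
    and z': "(z' has_vector_derivative a) (at t)"
    and geo: "a + christoffel_coord mc (z t) (z' t) (z' t) = 0"
  shows "\<exists>b. ((\<lambda>s. frechet_derivative \<phi> (at (z s)) (z' s)) has_vector_derivative b) (at t) \<and>
    b + christoffel_coord md (\<phi> (z t)) (frechet_derivative \<phi> (at (z t)) (z' t)) (frechet_derivative \<phi> (at (z t)) (z' t)) = 0"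
proof -
  define p where "p = z t"
  define u where "u = z' t"
  have pO: "p \<in> O'" unfolding p_def by (rule J(3)[OF J(2)])
  define h where "h w q = frechet_derivative \<phi> (at q) w" for w q
  have hs: "smooth_on O' (h w)" for w unfolding h_def by (intro smooth_on_dir_deriv O phi smooth_on_const)
  define D2 where "D2 v w = frechet_derivative (h w) (at p) v" for v w
  have hd: "(h w has_derivative (\<lambda>v. D2 v w)) (at p)" for w
    unfolding D2_def by (rule smooth_on_has_derivative[OF hs pO])
  have D2sym: "D2 v w = D2 w v" for v w
    unfolding D2_def h_def by (rule symmetric_second_derivative[OF O pO phi])
  have phid: "(\<phi> has_derivative (\<lambda>v. h v q)) (at q)" if "q \<in> O'" for q
    unfolding h_def by (rule smooth_on_has_derivative[OF phi that])
  have hlin: "linear (\<lambda>v. h v q)" if "q \<in> O'" for q by (rule has_derivative_linear[OF phid[OF that]])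
  obtain Dc where Dc: "(mc has_derivative Dc) (at p)" using mc(2) unfolding differentiable_def p_def by auto
  obtain Dd where Dd: "(md has_derivative Dd) (at (\<phi> p))" using md(2) unfolding differentiable_def p_def by auto
  define y' where "y' s = h (z' s) (z s)" for s
  have zt: "(z has_vector_derivative u) (at t)" unfolding u_def by (rule J(4)[OF J(2)])
  have hz: "((\<lambda>s. h w (z s)) has_vector_derivative D2 u w) (at t)" for w
    using vector_derivative_diff_chain_within[OF zt has_derivative_at_withinI[OF hd[of w, unfolded p_def]]] by (simp add: o_def)
  define b where "b = (\<Sum>i\<in>UNIV. z' t $ i *\<^sub>R D2 u (axis i 1) + a $ i *\<^sub>R h (axis i 1) (z t))"
  have y'b: "(y' has_vector_derivative b) (at t)"
  proof -
    have "((\<lambda>s. \<Sum>i\<in>UNIV. z' s $ i *\<^sub>R h (axis i 1) (z s)) has_vector_derivative b) (at t)"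
      unfolding b_def
      by (intro has_vector_derivative_sum bounded_bilinear.has_vector_derivative[OF bounded_bilinear_scaleR]
          bounded_linear.has_vector_derivative[OF bounded_linear_vec_nth] z' hz)
    then show ?thesis
    proof (rule has_vector_derivative_transform_within_open[OF _ J(1,2)])
      fix s assume s: "s \<in> J"
      have "h (\<Sum>i\<in>UNIV. z' s $ i *\<^sub>R axis i 1) (z s) = (\<Sum>i\<in>UNIV. z' s $ i *\<^sub>R h (axis i 1) (z s))"
        by (simp only: linear_sum[OF hlin[OF J(3)[OF s]]] linear_cmul[OF hlin[OF J(3)[OF s]]])
      then show "(\<Sum>i\<in>UNIV. z' s $ i *\<^sub>R h (axis i 1) (z s)) = y' s" unfolding y'_def vec_expand by simp
    qed
  qed
  define U where "U = h u p"
  have U: "U = y' t" unfolding U_def y'_def u_def p_def ..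
  have sd: "x \<bullet> (md (\<phi> p) *v y) = y \<bullet> (md (\<phi> p) *v x)" for x y
    by (rule spd_sym) (use md(1) in \<open>simp add: p_def\<close>)
  have key: "h w p \<bullet> (md (\<phi> p) *v (b + christoffel_coord md (\<phi> p) U U)) = 0" for w
  proof -
    have geo': "a + christoffel_coord mc (z t) u u = 0" using geo unfolding u_def .
    have invc: "invertible (mc (z t))" by (rule spd_invertible[OF mc(1)[OF J(3)[OF J(2)]]])
    have symc: "transpose (mc q) = mc q" if "q \<in> O'" for q using mc(1)[OF that] unfolding spd_def by simp
    from first_variation[OF zt z' u_def[symmetric] Dc[unfolded p_def] O pO[unfolded p_def] symc invc geo' has_derivative_const[of w]]
    have L: "((\<lambda>s. z' s \<bullet> (mc (z s) *v w)) has_real_derivative (u \<bullet> (Dc w *v u)) / 2) (at t)" by simp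
    have phz: "((\<lambda>s. \<phi> (z s)) has_vector_derivative U) (at t)"
      using vector_derivative_diff_chain_within[OF zt has_derivative_at_withinI[OF phid[OF J(3)[OF J(2)]]]]
      unfolding U_def p_def by (simp add: o_def)
    have mdz: "((\<lambda>s. md (\<phi> (z s))) has_vector_derivative Dd U) (at t)"
      using vector_derivative_diff_chain_within[OF phz has_derivative_at_withinI[OF Dd[unfolded p_def]]] by (simp add: o_def)
    have "((\<lambda>s. y' s \<bullet> (md (\<phi> (z s)) *v h w (z s))) has_vector_derivative
      (y' t \<bullet> (md (\<phi> (z t)) *v D2 u w + Dd U *v h w (z t)) + b \<bullet> (md (\<phi> (z t)) *v h w (z t)))) (at t)"
      by (rule bounded_bilinear.has_vector_derivative[OF bounded_bilinear_inner y'b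
          bounded_bilinear.has_vector_derivative[OF bounded_bilinear_matvec mdz hz]])
    then have R: "((\<lambda>s. z' s \<bullet> (mc (z s) *v w)) has_vector_derivative
      (y' t \<bullet> (md (\<phi> (z t)) *v D2 u w + Dd U *v h w (z t)) + b \<bullet> (md (\<phi> (z t)) *v h w (z t)))) (at t)"
    proof (rule has_vector_derivative_transform_within_open[OF _ J(1,2)])
      fix s assume "s \<in> J"
      then show "y' s \<bullet> (md (\<phi> (z s)) *v h w (z s)) = z' s \<bullet> (mc (z s) *v w)"
        unfolding y'_def h_def using iso[OF J(3)] by simp
    qed
    have LR: "(u \<bullet> (Dc w *v u)) / 2 = U \<bullet> (md (\<phi> p) *v D2 u w + Dd U *v h w p) + b \<bullet> (md (\<phi> p) *v h w p)"
      using vector_derivative_unique_at[OF L[unfolded has_real_derivative_iff_has_vector_derivative] R]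
      unfolding U[symmetric] p_def[symmetric] by simp
    have 1: "((\<lambda>q. u \<bullet> (mc q *v u)) has_derivative (\<lambda>w. u \<bullet> (Dc w *v u))) (at p)"
      by (intro has_derivative_inner_right bounded_linear.has_derivative[OF bounded_bilinear.bounded_linear_left[OF bounded_bilinear_matvec] Dc])
    have mdd: "((\<lambda>q. md (\<phi> q)) has_derivative (\<lambda>v. Dd (h v p))) (at p)"
      using diff_chain_at[OF phid[OF pO] Dd] by (simp add: o_def)
    have "((\<lambda>q. h u q \<bullet> (md (\<phi> q) *v h u q)) has_derivative
       (\<lambda>w. h u p \<bullet> (md (\<phi> p) *v D2 w u + Dd (h w p) *v h u p) + D2 w u \<bullet> (md (\<phi> p) *v h u p))) (at p)"
      by (rule bounded_bilinear.FDERIV[OF bounded_bilinear_inner hd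
          bounded_bilinear.FDERIV[OF bounded_bilinear_matvec mdd hd]])
    then have 2: "((\<lambda>q. u \<bullet> (mc q *v u)) has_derivative
       (\<lambda>w. h u p \<bullet> (md (\<phi> p) *v D2 w u + Dd (h w p) *v h u p) + D2 w u \<bullet> (md (\<phi> p) *v h u p))) (at p)"
    proof (rule has_derivative_transform_within_open[OF _ O pO])
      fix q assume "q \<in> O'"
      then show "h u q \<bullet> (md (\<phi> q) *v h u q) = u \<bullet> (mc q *v u)" unfolding h_def using iso by simp
    qed
    have E: "u \<bullet> (Dc w *v u) = U \<bullet> (md (\<phi> p) *v D2 w u + Dd (h w p) *v U) + D2 w u \<bullet> (md (\<phi> p) *v U)"
      using fun_cong[OF has_derivative_unique[OF 1 2], of w] unfolding U_def .
    have sdd: "U \<bullet> (Dd U *v h w p) = h w p \<bullet> (Dd U *v U)"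
      by (rule symmetric_derivative[OF Dd md(4) _ md(6)]) (use md(5) in \<open>simp add: p_def\<close>)
    have "h w p \<bullet> (md (\<phi> p) *v b) + h w p \<bullet> (Dd U *v U) - (U \<bullet> (Dd (h w p) *v U)) / 2 = 0"
      using LR E sdd D2sym[of u w] sd[of b "h w p"] sd[of "D2 w u" U] by (simp add: inner_add_right field_simps)
    moreover have "h w p \<bullet> (md (\<phi> p) *v christoffel_coord md (\<phi> p) U U) = h w p \<bullet> (Dd U *v U) - (U \<bullet> (Dd (h w p) *v U)) / 2"
      by (rule christoffel_coord_lower[OF Dd spd_invertible]) (use md(1) in \<open>simp add: p_def\<close>)
    ultimately show ?thesis by (simp add: matrix_vector_right_distrib inner_add_right)
  qed
  have "b + christoffel_coord md (\<phi> p) U U = 0"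
  proof (rule spd_nondegenerate)
    show "spd (md (\<phi> p))" using md(1) by (simp add: p_def)
    fix v
    obtain w where "v = frechet_derivative \<phi> (at (z t)) w" by (rule surjE[OF surj])
    then show "v \<bullet> (md (\<phi> p) *v (b + christoffel_coord md (\<phi> p) U U)) = 0" using key[of w] unfolding h_def p_def by simp
  qed
  then show ?thesis using y'b unfolding U y'_def[abs_def] h_def p_def by blast
qed

lemma smooth_on_spray:
  fixes m :: "real ^ 'n::finite \<Rightarrow> real ^ 'n ^ 'n"
  assumes S: "open S" and m: "smooth_on S m" and inv: "\<And>q. q \<in> S \<Longrightarrow> invertible (m q)"
  shows "smooth_on (S \<times> UNIV) (\<lambda>y. (snd y, - christoffel_coord m (fst y) (snd y) (snd y)))"
proof -
  let ?U = "S \<times> (UNIV :: (real ^ 'n) set)"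
  have U: "open ?U" by (rule open_Times[OF S open_UNIV])
  have f1: "smooth_on ?U fst" and f2: "smooth_on ?U snd"
    by (rule smooth_on_linear, rule bounded_linear_fst, rule smooth_on_linear, rule bounded_linear_snd)
  have comp: "smooth_on ?U (\<lambda>y. k (fst y))" if "smooth_on S k" for k :: "real ^ 'n \<Rightarrow> real ^ 'n ^ 'n"
    by (rule smooth_on_compose[OF U S _ f1 that]) auto
  have Dax: "smooth_on ?U (\<lambda>y. frechet_derivative m (at (fst y)) w)" for w
    by (rule comp) (intro smooth_on_dir_deriv S m smooth_on_const)
  have Dv: "smooth_on ?U (\<lambda>y. frechet_derivative m (at (fst y)) (snd y))"
  proof -
    have e: "frechet_derivative m (at (fst y)) (snd y) = (\<Sum>i\<in>UNIV. snd y $ i *\<^sub>R frechet_derivative m (at (fst y)) (axis i 1))"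
      if "y \<in> ?U" for y
    proof -
      have lin: "linear (frechet_derivative m (at (fst y)))"
        using smooth_on_imp_differentiable[OF m, of "fst y"] that by (intro linear_frechet_derivative) auto
      have "frechet_derivative m (at (fst y)) (\<Sum>i\<in>UNIV. snd y $ i *\<^sub>R axis i 1) = (\<Sum>i\<in>UNIV. snd y $ i *\<^sub>R frechet_derivative m (at (fst y)) (axis i 1))"
        by (simp only: linear_sum[OF lin] linear_cmul[OF lin])
      then show ?thesis unfolding vec_expand .
    qed
    have "smooth_on ?U (\<lambda>y. \<Sum>i\<in>UNIV. snd y $ i *\<^sub>R frechet_derivative m (at (fst y)) (axis i 1))"
      by (intro smooth_on_sum U smooth_on_scaleR smooth_on_nth f2 Dax)
    then show ?thesis using smooth_on_cong[OF U e] by simp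
  qed
  have minv: "smooth_on ?U (\<lambda>y. matrix_inv (m (fst y)))"
    by (intro smooth_on_matrix_inv U comp m) (use inv in auto)
  have vec: "smooth_on ?U (\<lambda>y. \<chi> l. ((frechet_derivative m (at (fst y)) (snd y) *v snd y) $ l
      + (frechet_derivative m (at (fst y)) (snd y) *v snd y) $ l
      - snd y \<bullet> (frechet_derivative m (at (fst y)) (axis l 1) *v snd y)) / 2)"
    by (intro smooth_on_vecI U, unfold vec_lambda_beta,
        intro smooth_on_bounded_linear[OF bounded_linear_divide] smooth_on_diff smooth_on_add smooth_on_nth
          smooth_on_inner smooth_on_matvec U Dv Dax f2)
  have c: "smooth_on ?U (\<lambda>y. - christoffel_coord m (fst y) (snd y) (snd y))"
    unfolding christoffel_coord_def by (intro smooth_on_minus smooth_on_matvec U minv vec)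
  have "smooth_on ?U (\<lambda>y. (snd y, 0) + (0, - christoffel_coord m (fst y) (snd y) (snd y)))"
  proof (rule smooth_on_add[OF U])
    have b1: "bounded_linear (\<lambda>x :: real ^ 'n. (x, 0 :: real ^ 'n))"
      by (intro bounded_linear_Pair bounded_linear_ident bounded_linear_zero)
    have b2: "bounded_linear (\<lambda>x :: real ^ 'n. (0 :: real ^ 'n, x))"
      by (intro bounded_linear_Pair bounded_linear_ident bounded_linear_zero)
    show "smooth_on ?U (\<lambda>y. (snd y, 0 :: real ^ 'n))" by (rule smooth_on_bounded_linear[OF b1 U f2])
    show "smooth_on ?U (\<lambda>y. (0 :: real ^ 'n, - christoffel_coord m (fst y) (snd y) (snd y)))" by (rule smooth_on_bounded_linear[OF b2 U c])
  qed
  then show ?thesis by simp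
qed

text \<open>
  The geodesic equation as a first-order system for position and velocity.
\<close>

lemma local_geodesic_exists:
  fixes m :: "real ^ 'n::finite \<Rightarrow> real ^ 'n ^ 'n"
  assumes S: "open S" and m: "smooth_on S m" and inv: "\<And>q. q \<in> S \<Longrightarrow> invertible (m q)" and p: "p \<in> S"
  obtains e z z' where "e > 0" "z 0 = p" "z' 0 = u" "smooth_on {-e<..<e} z" "\<And>t. t \<in> {-e<..<e} \<Longrightarrow> z t \<in> S"
    "\<And>t. t \<in> {-e<..<e} \<Longrightarrow> (z has_vector_derivative z' t) (at t)"
    "\<And>t. t \<in> {-e<..<e} \<Longrightarrow> (z' has_vector_derivative - christoffel_coord m (z t) (z' t) (z' t)) (at t)"
proof -
  have U: "open (S \<times> (UNIV :: (real ^ 'n) set))" by (rule open_Times[OF S open_UNIV])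
  obtain e y where e: "e > 0" and y: "y 0 = (p, u)" "smooth_on {-e<..<e} y"
    "\<forall>t\<in>{-e<..<e}. y t \<in> S \<times> UNIV \<and> (y has_vector_derivative (snd (y t), - christoffel_coord m (fst (y t)) (snd (y t)) (snd (y t)))) (at t)"
    using smooth_ode_exists[OF U smooth_on_spray[OF S m inv], of "(p, u)"] p by auto
  show ?thesis
  proof (rule that[of e "\<lambda>t. fst (y t)" "\<lambda>t. snd (y t)"])
    show "smooth_on {-e<..<e} (\<lambda>t. fst (y t))" by (rule smooth_on_bounded_linear[OF bounded_linear_fst _ y(2)]) simp
    fix t assume t: "t \<in> {-e<..<e}"
    then have d: "(y has_vector_derivative (snd (y t), - christoffel_coord m (fst (y t)) (snd (y t)) (snd (y t)))) (at t)" using y(3) by blast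
    show "((\<lambda>t. fst (y t)) has_vector_derivative snd (y t)) (at t)"
      using bounded_linear.has_vector_derivative[OF bounded_linear_fst d] by simp
    show "((\<lambda>t. snd (y t)) has_vector_derivative - christoffel_coord m (fst (y t)) (snd (y t)) (snd (y t))) (at t)"
      using bounded_linear.has_vector_derivative[OF bounded_linear_snd d] by simp
    show "fst (y t) \<in> S" using bspec[OF y(3) t] by (simp add: mem_Times_iff)
  qed (use e y in auto)
qed

section \<open>Geodesics orthogonal to leaves\<close>

lemma smooth_on_velocity:
  fixes z :: "real \<Rightarrow> 'a::real_normed_vector"
  assumes J: "open J" and z: "smooth_on J z"
  shows "smooth_on J (\<lambda>s. vector_derivative z (at s))"
    and "s \<in> J \<Longrightarrow> (z has_vector_derivative vector_derivative z (at s)) (at s)"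
proof -
  have e: "frechet_derivative z (at s) 1 = vector_derivative z (at s)" if "s \<in> J" for s
    using frechet_derivative_eq_vector_derivative[OF smooth_on_imp_differentiable[OF z that]] by (simp add: fun_eq_iff)
  have "smooth_on J (\<lambda>s. frechet_derivative z (at s) 1)" by (rule smooth_on_partial[OF z]) simp
  then show "smooth_on J (\<lambda>s. vector_derivative z (at s))" using smooth_on_cong[OF J e] by simp
  show "s \<in> J \<Longrightarrow> (z has_vector_derivative vector_derivative z (at s)) (at s)"
    using smooth_on_imp_differentiable[OF z] by (simp add: vector_derivative_works[symmetric])
qed

context atlas begin

lemma curve_chart_open:
  assumes "open I" "continuous_on I (\<gamma> :: real \<Rightarrow> 'm)" "open U"
  shows "open {s \<in> I. \<gamma> s \<in> U}"
  using continuous_open_preimage[OF assms(2,1,3)] by (simp add: vimage_def Int_def)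

lemma velocity_change:
  assumes I: "open I" and cur: "smooth_curve A I \<gamma>" and t: "t \<in> I"
    and cd: "c \<in> A" "d \<in> A" "\<gamma> t \<in> fst c" "\<gamma> t \<in> fst d"
  shows "velocity d \<gamma> t = jacobian c d (\<gamma> t) *v velocity c \<gamma> t"
proof -
  have cont: "continuous_on I \<gamma>" and sm: "smooth_on {s \<in> I. \<gamma> s \<in> fst c} (snd c \<circ> \<gamma>)"
    using cur cd unfolding smooth_curve_def by auto
  have o: "open {s \<in> I. \<gamma> s \<in> fst c}" by (rule curve_chart_open[OF I cont chart_open[OF cd(1)]])
  have tJ: "t \<in> {s \<in> I. \<gamma> s \<in> fst c}" using t cd by simp
  have 1: "(snd c \<circ> \<gamma> has_vector_derivative velocity c \<gamma> t) (at t)"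
    unfolding velocity_def by (rule smooth_on_velocity(2)[OF o sm tJ])
  have io: "(snd c \<circ> \<gamma>) t \<in> overlap c d" using cd by auto
  have "((\<lambda>s. snd d (chart_inv c ((snd c \<circ> \<gamma>) s))) has_vector_derivative jacobian c d (\<gamma> t) *v velocity c \<gamma> t) (at t)"
    using curve_change[OF cd(1,2) 1 io] cd by simp
  then have "(snd d \<circ> \<gamma> has_vector_derivative jacobian c d (\<gamma> t) *v velocity c \<gamma> t) (at t)"
    by (rule has_vector_derivative_transform_within_open[OF _ o tJ]) (use cd in auto)
  then show ?thesis unfolding velocity_def by (rule vector_derivative_at)
qed

end

text \<open>
  A metric on the tangent spaces of a foliated manifold that is smooth on an open set \<open>S\<close>.  The
  original metric has \<open>S = UNIV\<close>, its rescalings have the regular set as \<open>S\<close>.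
\<close>

locale foliated_metric = foliation A F for A :: "('m::t2_space, 'n::finite) chart set" and F :: "'m set set" +
  fixes S :: "'m set" and g :: "('m, 'n) tensor2"
  assumes S_open: "open S" and met: "riemannian_metric A S g"
begin

definition metric_coord :: "('m, 'n) chart \<Rightarrow> real ^ 'n \<Rightarrow> real ^ 'n ^ 'n" where "metric_coord c z = g c (chart_inv c z)"

abbreviation mdom :: "('m, 'n) chart \<Rightarrow> (real ^ 'n) set" where "mdom c \<equiv> snd c ` (fst c \<inter> S)"

lemma mdom_open: "c \<in> A \<Longrightarrow> open (mdom c)" by (rule chart_image_open[OF _ S_open])

lemma spd_g: "c \<in> A \<Longrightarrow> x \<in> fst c \<Longrightarrow> spd (g c x)"
  using met unfolding riemannian_metric_def spd_def ip_def by blast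

lemma metric_coord_at [simp]: "c \<in> A \<Longrightarrow> x \<in> fst c \<Longrightarrow> metric_coord c (snd c x) = g c x" unfolding metric_coord_def by simp

lemma spd_metric_coord: "c \<in> A \<Longrightarrow> z \<in> chart_range c \<Longrightarrow> spd (metric_coord c z)"
  unfolding metric_coord_def by (rule spd_g[OF _ chart_inv_in])

lemma metric_coord_smooth: "c \<in> A \<Longrightarrow> smooth_on (mdom c) (metric_coord c)"
  using met unfolding riemannian_metric_def metric_coord_def[abs_def] by simp

lemma mdom_range: "c \<in> A \<Longrightarrow> z \<in> mdom c \<Longrightarrow> z \<in> chart_range c \<and> chart_inv c z \<in> S"
  by (simp add: chart_image)

lemma spd_mdom: "c \<in> A \<Longrightarrow> z \<in> mdom c \<Longrightarrow> spd (metric_coord c z)"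
  using spd_metric_coord mdom_range by simp

lemma christoffel_eq_coord: "c \<in> A \<Longrightarrow> x \<in> fst c \<Longrightarrow> christoffel g c x u v = christoffel_coord (metric_coord c) (snd c x) u v"
  unfolding christoffel_def christoffel_coord_def dmetric_def metric_coord_def[abs_def] by (simp only: chart_inv_left)

lemma g_change:
  assumes "c \<in> A" "d \<in> A" "x \<in> fst c" "x \<in> fst d"
  shows "g c x = transpose (jacobian c d x) ** g d x ** jacobian c d x"
  using met assms unfolding riemannian_metric_def by blast

lemma form_change:
  assumes "c \<in> A" "d \<in> A" "x \<in> fst c" "x \<in> fst d"
  shows "u \<bullet> (g c x *v w) = (jacobian c d x *v u) \<bullet> (g d x *v (jacobian c d x *v w))"
  unfolding g_change[OF assms] matrix_vector_mul_assoc[symmetric]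
  by (simp only: inner_matvec[of u "transpose (jacobian c d x)"] transpose_transpose)

text \<open>
  Velocities, tangent spaces of leaves and inner products change compatibly between charts, so that one
  chart decides.
\<close>

lemma orthogonal_chart:
  assumes I: "open I" and cur: "smooth_curve A I \<gamma>" and t: "t \<in> I" and c: "c \<in> A" "\<gamma> t \<in> fst c"
  shows "orthogonal_at A F g \<gamma> t \<longleftrightarrow> (\<forall>v\<in>LT c (\<gamma> t). velocity c \<gamma> t \<bullet> (g c (\<gamma> t) *v v) = 0)"
proof
  assume "orthogonal_at A F g \<gamma> t"
  then show "\<forall>v\<in>LT c (\<gamma> t). velocity c \<gamma> t \<bullet> (g c (\<gamma> t) *v v) = 0"
    using c unfolding orthogonal_at_def ip_def by simp
next
  assume o: "\<forall>v\<in>LT c (\<gamma> t). velocity c \<gamma> t \<bullet> (g c (\<gamma> t) *v v) = 0"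
  show "orthogonal_at A F g \<gamma> t" unfolding orthogonal_at_def ip_def
  proof (intro ballI impI)
    fix d v assume d: "d \<in> A" "\<gamma> t \<in> fst d" and v: "v \<in> LT d (\<gamma> t)"
    obtain w where w: "w \<in> LT c (\<gamma> t)" "v = jacobian c d (\<gamma> t) *v w"
      using v unfolding leaf_tangent_image[OF c(1) d(1) c(2) d(2)] by (rule imageE)
    show "velocity d \<gamma> t \<bullet> (g d (\<gamma> t) *v v) = 0"
      unfolding velocity_change[OF I cur t c(1) d(1) c(2) d(2)] w(2) form_change[OF c(1) d(1) c(2) d(2), symmetric]
      using o w(1) by simp
  qed
qed

lemma geodesic_in_chart:
  assumes geo: "geodesic A g I \<gamma>" and c: "c \<in> A" and J: "J = {s \<in> I. \<gamma> s \<in> fst c}"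
  shows "open J" "continuous_on J \<gamma>" "smooth_on J (\<lambda>s. snd c (\<gamma> s))"
    "smooth_on J (velocity c \<gamma>)"
    "\<And>s. s \<in> J \<Longrightarrow> ((\<lambda>s. snd c (\<gamma> s)) has_vector_derivative velocity c \<gamma> s) (at s)"
    "\<And>s. s \<in> J \<Longrightarrow> \<exists>a. (velocity c \<gamma> has_vector_derivative a) (at s) \<and> a + christoffel_coord (metric_coord c) (snd c (\<gamma> s)) (velocity c \<gamma> s) (velocity c \<gamma> s) = 0"
proof -
  have I: "open I" and cont: "continuous_on I \<gamma>" and sm: "smooth_on J (\<lambda>s. snd c (\<gamma> s))"
    and eq: "\<And>t. t \<in> I \<Longrightarrow> \<gamma> t \<in> fst c \<Longrightarrow> vector_derivative (velocity c \<gamma>) (at t)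
          + christoffel g c (\<gamma> t) (velocity c \<gamma> t) (velocity c \<gamma> t) = 0"
    using geo c unfolding geodesic_def smooth_curve_def J o_def by auto
  show oJ: "open J" unfolding J by (rule curve_chart_open[OF I cont chart_open[OF c]])
  show "continuous_on J \<gamma>" by (rule continuous_on_subset[OF cont]) (simp add: J)
  show "smooth_on J (\<lambda>s. snd c (\<gamma> s))" by (rule sm)
  have v: "velocity c \<gamma> = (\<lambda>s. vector_derivative (\<lambda>s. snd c (\<gamma> s)) (at s))" unfolding velocity_def[abs_def] o_def ..
  show sv: "smooth_on J (velocity c \<gamma>)" unfolding v by (rule smooth_on_velocity(1)[OF oJ sm])
  fix s assume s: "s \<in> J"
  show "((\<lambda>s. snd c (\<gamma> s)) has_vector_derivative velocity c \<gamma> s) (at s)"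
    unfolding v by (rule smooth_on_velocity(2)[OF oJ sm s])
  have "(velocity c \<gamma> has_vector_derivative vector_derivative (velocity c \<gamma>) (at s)) (at s)"
    by (rule smooth_on_velocity(2)[OF oJ sv s])
  moreover have "vector_derivative (velocity c \<gamma>) (at s) + christoffel_coord (metric_coord c) (snd c (\<gamma> s)) (velocity c \<gamma> s) (velocity c \<gamma> s) = 0"
    using eq[of s] s c christoffel_eq_coord[OF c, of "\<gamma> s"] unfolding J by simp
  ultimately show "\<exists>a. (velocity c \<gamma> has_vector_derivative a) (at s) \<and> a + christoffel_coord (metric_coord c) (snd c (\<gamma> s)) (velocity c \<gamma> s) (velocity c \<gamma> s) = 0"
    by (intro exI conjI)
qed

text \<open>
  A curve that solves the geodesic equation in one chart solves it in every other chart as well, by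
  invariance under coordinate changes.
\<close>

lemma geodesic_exists:
  assumes c: "c \<in> A" "x \<in> fst c" "x \<in> S"
  obtains e \<gamma> where "e > 0" "geodesic A g {-e<..<e} \<gamma>" "\<gamma> 0 = x" "velocity c \<gamma> 0 = u"
    "\<And>t. t \<in> {-e<..<e} \<Longrightarrow> \<gamma> t \<in> fst c \<inter> S"
proof -
  have xd: "snd c x \<in> mdom c" using c by simp
  obtain e z z' where e: "e > 0" and z: "z 0 = snd c x" "z' 0 = u" "smooth_on {-e<..<e} z"
    "\<And>t. t \<in> {-e<..<e} \<Longrightarrow> z t \<in> mdom c"
    "\<And>t. t \<in> {-e<..<e} \<Longrightarrow> (z has_vector_derivative z' t) (at t)"
    "\<And>t. t \<in> {-e<..<e} \<Longrightarrow> (z' has_vector_derivative - christoffel_coord (metric_coord c) (z t) (z' t) (z' t)) (at t)"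
    by (rule local_geodesic_exists[OF mdom_open[OF c(1)] metric_coord_smooth[OF c(1)] spd_invertible[OF spd_mdom[OF c(1)]] xd, of u]) (assumption, rule that)
  let ?I = "{-e<..<e}"
  define \<gamma> where "\<gamma> t = chart_inv c (z t)" for t
  have zr: "z t \<in> chart_range c" "chart_inv c (z t) \<in> S" if "t \<in> ?I" for t
    using mdom_range[OF c(1) z(4)[OF that]] by auto
  have gin: "\<gamma> t \<in> fst c" "snd c (\<gamma> t) = z t" "\<gamma> t \<in> S" if "t \<in> ?I" for t
    unfolding \<gamma>_def using zr[OF that] c(1) by simp_all
  have zc: "continuous_on ?I z" by (rule smooth_on_imp_continuous_on[OF z(3)])
  have gc: "continuous_on ?I \<gamma>"
    unfolding \<gamma>_def by (rule continuous_on_compose2[OF chart_inv_continuous[OF c(1)] zc]) (use zr in blast)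
  have cur: "smooth_curve A ?I \<gamma>"
    unfolding smooth_curve_def
  proof (intro conjI ballI gc)
    fix d assume d: "d \<in> A"
    have o: "open {t \<in> ?I. \<gamma> t \<in> fst d}" by (rule curve_chart_open[OF _ gc chart_open[OF d]]) simp
    have sub: "z ` {t \<in> ?I. \<gamma> t \<in> fst d} \<subseteq> overlap c d"
    proof (rule image_subsetI)
      fix t assume "t \<in> {t \<in> ?I. \<gamma> t \<in> fst d}"
      then have t: "t \<in> ?I" "\<gamma> t \<in> fst d" by auto
      then show "z t \<in> overlap c d" unfolding chart_image[OF c(1)] using zr[OF t(1)] unfolding \<gamma>_def by simp
    qed
    have "smooth_on {t \<in> ?I. \<gamma> t \<in> fst d} (\<lambda>t. snd d (chart_inv c (z t)))"
      by (rule smooth_on_compose[OF o overlap_open[OF c(1) d] sub smooth_on_subset[OF z(3)] transition_smooth[OF c(1) d]]) auto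
    then show "smooth_on {t \<in> ?I. \<gamma> t \<in> fst d} (snd d \<circ> \<gamma>)" unfolding \<gamma>_def o_def .
  qed
  have velc: "velocity c \<gamma> t = z' t" if t: "t \<in> ?I" for t
  proof -
    have "(snd c \<circ> \<gamma> has_vector_derivative z' t) (at t)"
      by (rule has_vector_derivative_transform_within_open[OF z(5)[OF t] _ t]) (use gin in auto)
    then show ?thesis unfolding velocity_def by (rule vector_derivative_at)
  qed
  have geq: "vector_derivative (velocity d \<gamma>) (at t) + christoffel g d (\<gamma> t) (velocity d \<gamma> t) (velocity d \<gamma> t) = 0"
    if d: "d \<in> A" and t: "t \<in> ?I" and gd: "\<gamma> t \<in> fst d" for d t
  proof -
    define \<phi> where "\<phi> = (\<lambda>z. snd d (chart_inv c z))"
    define O' where "O' = snd c ` (fst c \<inter> (fst d \<inter> S))"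
    define J where "J = {s \<in> ?I. \<gamma> s \<in> fst d}"
    have oJ: "open J" unfolding J_def by (rule curve_chart_open[OF _ gc chart_open[OF d]]) simp
    have oO: "open O'" unfolding O'_def by (intro chart_image_open c open_Int chart_open d S_open)
    have O'D: "q \<in> chart_range c" "chart_inv c q \<in> fst c" "chart_inv c q \<in> fst d" "chart_inv c q \<in> S" "q \<in> overlap c d" "q \<in> mdom c"
      if "q \<in> O'" for q using that c(1) unfolding O'_def chart_image[OF c(1)] by auto
    have fd: "frechet_derivative \<phi> (at q) = (*v) (jacobian c d (chart_inv c q))" if "q \<in> O'" for q
      using jacobian_apply[OF c(1) d O'D(2,3)[OF that]] O'D(1)[OF that] c(1) unfolding \<phi>_def by (simp add: fun_eq_iff)
    have tJ: "t \<in> J" unfolding J_def using t gd by simp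
    have zO: "z s \<in> O'" if "s \<in> J" for s
      using that gin[of s] zr[of s] unfolding O'_def J_def chart_image[OF c(1)] \<gamma>_def by simp
    have pz: "\<phi> (z s) = snd d (\<gamma> s)" for s unfolding \<phi>_def \<gamma>_def ..
    have phis: "smooth_on O' \<phi>" unfolding \<phi>_def
      by (rule smooth_on_subset[OF transition_smooth[OF c(1) d]]) (use O'D in blast)
    have gdS: "snd d (\<gamma> t) \<in> mdom d" using gd gin(3)[OF t] by simp
    have "\<exists>b. ((\<lambda>s. frechet_derivative \<phi> (at (z s)) (z' s)) has_vector_derivative b) (at t) \<and>
      b + christoffel_coord (metric_coord d) (\<phi> (z t)) (frechet_derivative \<phi> (at (z t)) (z' t)) (frechet_derivative \<phi> (at (z t)) (z' t)) = 0"
    proof (rule geodesic_coordinate_change[where O' = O' and J = J and N = "mdom d" and mc = "metric_coord c" and a = "- christoffel_coord (metric_coord c) (z t) (z' t) (z' t)"])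
      show "spd (metric_coord c q)" if "q \<in> O'" for q by (rule spd_metric_coord[OF c(1) O'D(1)[OF that]])
      show "metric_coord c differentiable at (z t)"
        by (rule smooth_on_imp_differentiable[OF metric_coord_smooth[OF c(1)] z(4)[OF t]])
      show "spd (metric_coord d (\<phi> (z t)))" unfolding pz by (rule spd_mdom[OF d gdS])
      show "metric_coord d differentiable at (\<phi> (z t))"
        unfolding pz by (rule smooth_on_imp_differentiable[OF metric_coord_smooth[OF d] gdS])
      show "transpose (metric_coord d (\<phi> q)) = metric_coord d (\<phi> q)" if "q \<in> O'" for q
        using spd_g[OF d O'D(3)[OF that]] d O'D(3)[OF that] unfolding \<phi>_def spd_def by simp
      show "transpose (metric_coord d q) = metric_coord d q" if "q \<in> mdom d" for q
        using spd_mdom[OF d that] unfolding spd_def by simp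
      show "u \<bullet> (metric_coord c q *v w) = frechet_derivative \<phi> (at q) u \<bullet> (metric_coord d (\<phi> q) *v frechet_derivative \<phi> (at q) w)"
        if "q \<in> O'" for q u w
        unfolding fd[OF that] using form_change[OF c(1) d O'D(2,3)[OF that], of u w] d O'D(3)[OF that]
        unfolding \<phi>_def metric_coord_def by simp
      show "surj (frechet_derivative \<phi> (at (z t)))"
        unfolding fd[OF zO[OF tJ]]
        by (rule surjI[of _ "(*v) (jacobian d c (chart_inv c (z t)))"])
           (rule jacobian_inverse_apply[OF d c(1) O'D(3)[OF zO[OF tJ]] O'D(2)[OF zO[OF tJ]]])
      show "\<phi> (z t) \<in> mdom d" unfolding pz by (rule gdS)
    qed (use oO phis oJ tJ zO z(5,6) mdom_open[OF d] t in \<open>auto simp: J_def\<close>)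
    then obtain b where b: "((\<lambda>s. frechet_derivative \<phi> (at (z s)) (z' s)) has_vector_derivative b) (at t)"
      "b + christoffel_coord (metric_coord d) (\<phi> (z t)) (frechet_derivative \<phi> (at (z t)) (z' t)) (frechet_derivative \<phi> (at (z t)) (z' t)) = 0"
      by (elim exE conjE)
    have veld: "frechet_derivative \<phi> (at (z s)) (z' s) = velocity d \<gamma> s" if "s \<in> J" for s
    proof -
      have s: "s \<in> ?I" "\<gamma> s \<in> fst d" using that unfolding J_def by auto
      have "velocity d \<gamma> s = jacobian c d (\<gamma> s) *v velocity c \<gamma> s"
        by (rule velocity_change[OF _ cur s(1) c(1) d gin(1)[OF s(1)] s(2)]) simp
      then show ?thesis unfolding fd[OF zO[OF that]] velc[OF s(1)] \<gamma>_def by simp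
    qed
    have "(velocity d \<gamma> has_vector_derivative b) (at t)"
      by (rule has_vector_derivative_transform_within_open[OF b(1) oJ tJ veld])
    then have "vector_derivative (velocity d \<gamma>) (at t) = b" by (rule vector_derivative_at)
    moreover have "b + christoffel g d (\<gamma> t) (velocity d \<gamma> t) (velocity d \<gamma> t) = 0"
      using b(2) unfolding veld[OF tJ] pz christoffel_eq_coord[OF d gd] .
    ultimately show ?thesis by simp
  qed
  have geo: "geodesic A g ?I \<gamma>"
    unfolding geodesic_def
  proof (intro conjI ballI impI cur)
    show "is_interval ?I" by (simp add: is_interval_oo)
  qed (use geq in auto)
  have 0: "0 \<in> ?I" using e by simp
  have g0: "\<gamma> 0 = x" unfolding \<gamma>_def z(1) using c by simp
  have v0: "velocity c \<gamma> 0 = u" using velc[OF 0] z(2) by simp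
  show ?thesis by (rule that[OF e geo g0 v0]) (use gin in auto)
qed

text \<open>
  Half of \<open>(L\<^sub>X g)(u, u)\<close>, the Lie derivative of the metric along \<open>X\<close>, in coordinates.
\<close>

definition half_lie :: "('m, 'n) vfield \<Rightarrow> ('m, 'n) chart \<Rightarrow> real ^ 'n \<Rightarrow> real ^ 'n \<Rightarrow> real" where
  "half_lie X c z u =
     (u \<bullet> (frechet_derivative (metric_coord c) (at z) (X c (chart_inv c z)) *v u)) / 2
     + u \<bullet> (metric_coord c z *v frechet_derivative (\<lambda>z. X c (chart_inv c z)) (at z) u)"

definition horizontal :: "('m, 'n) chart \<Rightarrow> 'm \<Rightarrow> real ^ 'n \<Rightarrow> bool" where
  "horizontal c x u \<longleftrightarrow> (\<forall>v\<in>LT c x. u \<bullet> (g c x *v v) = 0)"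

lemma pairing_derivative:
  assumes geo: "geodesic A g I \<gamma>" and sub: "\<gamma> ` I \<subseteq> S" and c: "c \<in> A" and s: "s \<in> I" "\<gamma> s \<in> fst c" and X: "tangent_field X"
  shows "((\<lambda>s. velocity c \<gamma> s \<bullet> (metric_coord c (snd c (\<gamma> s)) *v X c (chart_inv c (snd c (\<gamma> s))))) has_real_derivative
    half_lie X c (snd c (\<gamma> s)) (velocity c \<gamma> s)) (at s)"
proof -
  define J where "J = {s \<in> I. \<gamma> s \<in> fst c}"
  have sJ: "s \<in> J" unfolding J_def using s by simp
  note G = geodesic_in_chart[OF geo c J_def]
  obtain a where a: "(velocity c \<gamma> has_vector_derivative a) (at s)"
    "a + christoffel_coord (metric_coord c) (snd c (\<gamma> s)) (velocity c \<gamma> s) (velocity c \<gamma> s) = 0"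
    using G(6)[OF sJ] by (elim exE conjE)
  have sd: "snd c (\<gamma> s) \<in> mdom c" using s sub by auto
  have sr: "snd c (\<gamma> s) \<in> chart_range c" using s by simp
  have tr: "transpose (metric_coord c q) = metric_coord c q" if "q \<in> mdom c" for q using spd_mdom[OF c that] unfolding spd_def by simp
  show ?thesis
    unfolding half_lie_def
    by (rule first_variation[OF G(5)[OF sJ] a(1) refl smooth_on_has_derivative[OF metric_coord_smooth[OF c] sd] mdom_open[OF c] sd tr
          spd_invertible[OF spd_mdom[OF c sd]] a(2)
          smooth_on_has_derivative[OF tangent_field_smooth[OF X c] sr]])
qed

text \<open>
  Adaptedness in infinitesimal form.  Along the geodesic that starts with an orthogonal velocity \<open>u\<close> the
  pairing with a vertical field vanishes identically, and so does its derivative at time \<open>0\<close>.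
\<close>

lemma adapted_imp_half_lie_zero:
  assumes ad: "adapted A F S g" and c: "c \<in> A" "x \<in> fst c" "x \<in> S" and X: "tangent_field X" and u: "horizontal c x u"
  shows "half_lie X c (snd c x) u = 0"
proof -
  obtain e \<gamma> where e: "e > 0" and geo: "geodesic A g {-e<..<e} \<gamma>" and g0: "\<gamma> 0 = x" "velocity c \<gamma> 0 = u"
    and gin: "\<And>t. t \<in> {-e<..<e} \<Longrightarrow> \<gamma> t \<in> fst c \<inter> S"
    by (rule geodesic_exists[OF c, of u]) (rule that)
  have 0: "0 \<in> {-e<..<e}" using e by simp
  have cur: "smooth_curve A {-e<..<e} \<gamma>" using geo unfolding geodesic_def by simp
  have sub: "\<gamma> ` {-e<..<e} \<subseteq> S" using gin by blast
  have och: "orthogonal_at A F g \<gamma> t \<longleftrightarrow> (\<forall>v\<in>LT c (\<gamma> t). velocity c \<gamma> t \<bullet> (g c (\<gamma> t) *v v) = 0)" if "t \<in> {-e<..<e}" for t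
    by (rule orthogonal_chart[OF _ cur that c(1)]) (use gin[OF that] in auto)
  have "orthogonal_at A F g \<gamma> 0" unfolding och[OF 0] g0 using u unfolding horizontal_def .
  then have all: "orthogonal_at A F g \<gamma> t" if "t \<in> {-e<..<e}" for t
    using ad geo sub 0 that unfolding adapted_def by blast
  have zero: "0 = velocity c \<gamma> t \<bullet> (metric_coord c (snd c (\<gamma> t)) *v X c (chart_inv c (snd c (\<gamma> t))))" if "t \<in> {-e<..<e}" for t
  proof -
    have gt: "\<gamma> t \<in> fst c" using gin[OF that] by simp
    have "X c (\<gamma> t) \<in> LT c (\<gamma> t)" using X c(1) gt unfolding tangent_field_def by simp
    then show ?thesis using all[OF that] gt c(1) unfolding och[OF that] by simp
  qed
  have 1: "((\<lambda>s. velocity c \<gamma> s \<bullet> (metric_coord c (snd c (\<gamma> s)) *v X c (chart_inv c (snd c (\<gamma> s))))) has_real_derivative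
    half_lie X c (snd c (\<gamma> 0)) (velocity c \<gamma> 0)) (at 0)"
    by (rule pairing_derivative[OF geo sub c(1) 0 _ X]) (use c g0 in simp)
  have 2: "((\<lambda>s. velocity c \<gamma> s \<bullet> (metric_coord c (snd c (\<gamma> s)) *v X c (chart_inv c (snd c (\<gamma> s))))) has_real_derivative 0) (at 0)"
    by (rule has_field_derivative_transform_within_open[OF DERIV_const[of 0] _ 0]) (use zero in auto)
  show ?thesis using DERIV_unique[OF 1 2] unfolding g0 .
qed

lemma frame_proj_smooth:
  assumes c: "c \<in> A" and N: "open N" "N \<subseteq> mdom c" and fr: "\<And>z. z \<in> N \<Longrightarrow> frame K (frame_matrix K X c z) (LT c (chart_inv c z))"
    and sm: "smooth_on N (frame_matrix K X c)"
  shows "smooth_on N (\<lambda>z. matrix_inv (gram K (frame_matrix K X c z) (metric_coord c z)))"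
    and "smooth_on N (\<lambda>z. frame_proj K (frame_matrix K X c z) (metric_coord c z))"
proof -
  have m: "smooth_on N (metric_coord c)" by (rule smooth_on_subset[OF metric_coord_smooth[OF c] N(2)])
  have inv: "invertible (gram K (frame_matrix K X c z) (metric_coord c z))" if "z \<in> N" for z
    by (rule gram_invertible[OF spd_mdom[OF c subsetD[OF N(2) that]]]) (use fr[OF that] in \<open>auto simp: frame_def\<close>)
  have "smooth_on N (\<lambda>z. gram K (frame_matrix K X c z) (metric_coord c z))"
    unfolding gram_def by (intro smooth_on_add smooth_on_matmul smooth_on_transpose smooth_on_const N sm m)
  from smooth_on_matrix_inv[OF N(1) inv this]
  show i: "smooth_on N (\<lambda>z. matrix_inv (gram K (frame_matrix K X c z) (metric_coord c z)))" .
  show "smooth_on N (\<lambda>z. frame_proj K (frame_matrix K X c z) (metric_coord c z))"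
    unfolding frame_proj_def by (intro smooth_on_matmul smooth_on_transpose N sm m i)
qed

end

section \<open>Adaptedness from the infinitesimal condition\<close>

lemma smooth_on_matrix:
  fixes L :: "'a::euclidean_space \<Rightarrow> real ^ 'n::finite \<Rightarrow> real ^ 'm::finite"
  assumes S: "open S" and L: "\<And>w. smooth_on S (\<lambda>z. L z w)"
  shows "smooth_on S (\<lambda>z. matrix (L z))"
  unfolding matrix_def by (intro smooth_on_vecI S, unfold vec_lambda_beta, intro smooth_on_nth S L)

lemma transpose_matvec_nth: "(transpose X *v v) $ i = column i X \<bullet> v" for X :: "real ^ 'n::finite ^ 'm::finite"
  by (simp add: matrix_vector_mult_def transpose_def column_def inner_vec_def)

context foliated_metric begin

text \<open>
  The bilinear form, not symmetrised, whose quadratic form is \<open>half_lie\<close>.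
\<close>

definition half_lie_matrix :: "('m, 'n) vfield \<Rightarrow> ('m, 'n) chart \<Rightarrow> real ^ 'n \<Rightarrow> real ^ 'n ^ 'n" where
  "half_lie_matrix X c z = (1/2) *\<^sub>R frechet_derivative (metric_coord c) (at z) (X c (chart_inv c z))
     + metric_coord c z ** matrix (frechet_derivative (\<lambda>z. X c (chart_inv c z)) (at z))"

lemma half_lie_eq_matrix:
  assumes c: "c \<in> A" and z: "z \<in> chart_range c" and X: "tangent_field X"
  shows "half_lie X c z u = u \<bullet> (half_lie_matrix X c z *v u)"
proof -
  have "linear (frechet_derivative (\<lambda>z. X c (chart_inv c z)) (at z))"
    by (rule linear_frechet_derivative[OF smooth_on_imp_differentiable[OF tangent_field_smooth[OF X c] z]])
  then show ?thesis
    unfolding half_lie_def half_lie_matrix_def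
    by (simp add: matrix_vector_mult_add_rdistrib scaleR_matrix_vector_assoc[symmetric] matrix_vector_mul_assoc[symmetric]
        inner_add_right matrix_linear_apply)
qed

lemma half_lie_matrix_smooth:
  assumes c: "c \<in> A" and X: "tangent_field X"
  shows "smooth_on (mdom c) (half_lie_matrix X c)"
proof -
  have sub: "mdom c \<subseteq> chart_range c" using mdom_range[OF c] by blast
  note Xs = smooth_on_subset[OF tangent_field_smooth[OF X c] sub]
  have "smooth_on (mdom c) (\<lambda>z. (1/2) *\<^sub>R frechet_derivative (metric_coord c) (at z) (X c (chart_inv c z))
     + metric_coord c z ** matrix (frechet_derivative (\<lambda>z. X c (chart_inv c z)) (at z)))"
    by (intro smooth_on_add smooth_on_scaleR smooth_on_const smooth_on_matmul smooth_on_matrix smooth_on_dir_deriv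
        mdom_open c metric_coord_smooth Xs)
  then show ?thesis unfolding half_lie_matrix_def[abs_def] .
qed

text \<open>
  Let \<open>\<Phi>\<close> be the vector of pairings of the velocity with a local frame of vertical fields.  Its
  derivative is given by \<open>half_lie\<close> of the velocity \<open>u = h + v\<close>, which splits into a horizontal and a vertical
  part.  The purely horizontal term vanishes by assumption, and every other term contains \<open>v\<close>, which is
  a linear function of \<open>\<Phi>\<close>.  Thus \<open>\<Phi>\<close> satisfies a homogeneous linear differential equation, and it
  vanishes near any of its zeros.
\<close>

lemma orthogonality_propagates:
  assumes S: "S = reg"
    and kill: "\<And>c x X u. c \<in> A \<Longrightarrow> x \<in> fst c \<Longrightarrow> x \<in> S \<Longrightarrow> tangent_field X \<Longrightarrow> horizontal c x u \<Longrightarrow> half_lie X c (snd c x) u = 0"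
    and geo: "geodesic A g I \<gamma>" and sub: "\<gamma> ` I \<subseteq> S" and t1: "t1 \<in> I"
  shows "\<exists>\<delta>>0. {t1-\<delta><..<t1+\<delta>} \<subseteq> I \<and>
    (\<forall>s\<in>{t1-\<delta><..<t1+\<delta>}. \<forall>t\<in>{t1-\<delta><..<t1+\<delta>}. orthogonal_at A F g \<gamma> s \<longrightarrow> orthogonal_at A F g \<gamma> t)"
proof -
  obtain c where c: "c \<in> A" "\<gamma> t1 \<in> fst c" by (rule chart_cover)
  have xr: "\<gamma> t1 \<in> reg" using sub t1 S by blast
  obtain N K X where N: "open N" "snd c (\<gamma> t1) \<in> N" "N \<subseteq> snd c ` (fst c \<inter> reg)"
    and X: "\<And>i. tangent_field (X i)" and fr: "\<And>z. z \<in> N \<Longrightarrow> frame K (frame_matrix K X c z) (LT c (chart_inv c z))"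
    and fs: "smooth_on N (frame_matrix K X c)"
    by (rule local_frame[OF xr c]) (rule that)
  have Nd: "N \<subseteq> mdom c" using N(3) S by simp
  define J where "J = {s \<in> I. \<gamma> s \<in> fst c}"
  note G = geodesic_in_chart[OF geo c(1) J_def]
  define Z where "Z s = snd c (\<gamma> s)" for s
  define u where "u = velocity c \<gamma>"
  have Zc: "continuous_on J Z" unfolding Z_def by (rule smooth_on_imp_continuous_on[OF G(3)])
  have uc: "continuous_on J u" unfolding u_def by (rule smooth_on_imp_continuous_on[OF G(4)])
  have "open (J \<inter> Z -` N)" by (rule continuous_open_preimage[OF Zc G(1) N(1)])
  moreover have "t1 \<in> J \<inter> Z -` N" unfolding J_def Z_def using t1 c N by simp
  ultimately obtain r where r: "r > 0" "cball t1 r \<subseteq> J \<inter> Z -` N" unfolding open_contains_cball by blast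
  define a where "a = t1 - r"
  define b where "b = t1 + r"
  have ab: "{a..b} \<subseteq> J" "\<And>s. s \<in> {a..b} \<Longrightarrow> Z s \<in> N"
    using r(2) unfolding a_def b_def by (auto simp: cball_eq_atLeastAtMost)
  have sJ: "s \<in> I" "\<gamma> s \<in> fst c" "chart_inv c (Z s) = \<gamma> s" "Z s \<in> chart_range c" "\<gamma> s \<in> S" "Z s \<in> mdom c" "Z s \<in> N"
    if "s \<in> {a..b}" for s
  proof -
    have "s \<in> J" using ab(1) that by blast
    then have s: "s \<in> I" "\<gamma> s \<in> fst c" unfolding J_def by auto
    then show "s \<in> I" "\<gamma> s \<in> fst c" "chart_inv c (Z s) = \<gamma> s" "Z s \<in> chart_range c" "\<gamma> s \<in> S"
      unfolding Z_def using c(1) sub by auto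
    show "Z s \<in> N" by (rule ab(2)[OF that])
    then show "Z s \<in> mdom c" using Nd by blast
  qed
  define \<Phi> where "\<Phi> s = transpose (frame_matrix K X c (Z s)) *v (metric_coord c (Z s) *v u s)" for s
  define \<psi> where "\<psi> i s = (if i \<in> K then u s \<bullet> (metric_coord c (Z s) *v X i c (chart_inv c (Z s))) else 0)" for i s
  define d\<Phi> where "d\<Phi> i s = (if i \<in> K then half_lie (X i) c (Z s) (u s) else 0)" for i s
  have \<Phi>i: "\<Phi> s $ i = \<psi> i s" if "s \<in> {a..b}" for s i
    unfolding \<Phi>_def \<psi>_def transpose_matvec_nth frame_matrix_column using spd_sym[OF spd_mdom[OF c(1) sJ(6)[OF that]]] by simp
  have I: "open I" "smooth_curve A I \<gamma>" using geo unfolding geodesic_def by auto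
  have orth: "orthogonal_at A F g \<gamma> s \<longleftrightarrow> \<Phi> s = 0" if s: "s \<in> {a..b}" for s
  proof -
    have L: "LT c (\<gamma> s) = range (\<lambda>w. frame_matrix K X c (Z s) *v w)"
      using fr[OF sJ(7)[OF s]] sJ(3)[OF s] unfolding frame_def by simp
    have e: "u s \<bullet> (g c (\<gamma> s) *v (frame_matrix K X c (Z s) *v w)) = w \<bullet> \<Phi> s" for w
    proof -
      have "u s \<bullet> (g c (\<gamma> s) *v (frame_matrix K X c (Z s) *v w)) = (frame_matrix K X c (Z s) *v w) \<bullet> (metric_coord c (Z s) *v u s)"
        using spd_sym[OF spd_mdom[OF c(1) sJ(6)[OF s]]] sJ(3)[OF s] unfolding metric_coord_def by simp
      also have "\<dots> = w \<bullet> \<Phi> s"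
        unfolding \<Phi>_def by (simp only: inner_matvec[of w "transpose (frame_matrix K X c (Z s))"] transpose_transpose)
      finally show ?thesis .
    qed
    have "orthogonal_at A F g \<gamma> s \<longleftrightarrow> (\<forall>v\<in>LT c (\<gamma> s). velocity c \<gamma> s \<bullet> (g c (\<gamma> s) *v v) = 0)"
      by (rule orthogonal_chart[OF I sJ(1)[OF s] c(1) sJ(2)[OF s]])
    also have "\<dots> \<longleftrightarrow> (\<forall>w. u s \<bullet> (g c (\<gamma> s) *v (frame_matrix K X c (Z s) *v w)) = 0)" unfolding L u_def by simp
    also have "\<dots> \<longleftrightarrow> (\<forall>w. w \<bullet> \<Phi> s = 0)" unfolding e ..
    also have "\<dots> \<longleftrightarrow> \<Phi> s = 0" by (metis inner_eq_zero_iff inner_zero_right)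
    finally show ?thesis .
  qed
  have d\<Phi>: "(\<psi> i has_real_derivative d\<Phi> i s) (at s)"
    if s: "s \<in> {a..b}" for i s
    using pairing_derivative[OF geo sub c(1) sJ(1,2)[OF s] X[of i]]
    unfolding d\<Phi>_def \<psi>_def[abs_def] u_def Z_def by (cases "i \<in> K") simp_all
  define P where "P z = frame_proj K (frame_matrix K X c z) (metric_coord c z)" for z
  define Wt where "Wt z = transpose (frame_matrix K X c z ** matrix_inv (gram K (frame_matrix K X c z) (metric_coord c z)))" for z
  define Q where "Q i = half_lie_matrix (X i) c" for i
  define R where "R i s = Wt (Z s) *v (transpose (Q i (Z s)) *v (u s - P (Z s) *v u s) + Q i (Z s) *v u s)" for i s
  have Ps: "smooth_on N P" unfolding P_def by (rule frame_proj_smooth(2)[OF c(1) N(1) Nd fr fs])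
  have Ws: "smooth_on N Wt" unfolding Wt_def
    by (intro smooth_on_transpose smooth_on_matmul N(1) fs frame_proj_smooth(1)[OF c(1) N(1) Nd fr fs])
  have Qs: "smooth_on N (Q i)" for i unfolding Q_def by (rule smooth_on_subset[OF half_lie_matrix_smooth[OF c(1) X] Nd])
  have dR: "d\<Phi> i s = R i s \<bullet> \<Phi> s" if s: "s \<in> {a..b}" and i: "i \<in> K" for i s
  proof -
    have B: "spd (metric_coord c (Z s))" by (rule spd_mdom[OF c(1) sJ(6)[OF s]])
    define v where "v = P (Z s) *v u s"
    define h where "h = u s - v"
    have "horizontal c (\<gamma> s) h"
      using frame_proj_projects(2)[OF B fr[OF sJ(7)[OF s]]] sJ(3)[OF s]
      unfolding horizontal_def h_def v_def P_def metric_coord_def by simp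
    from kill[OF c(1) sJ(2)[OF s] sJ(5)[OF s] X[of i] this]
    have 0: "h \<bullet> (Q i (Z s) *v h) = 0"
      unfolding Q_def half_lie_eq_matrix[OF c(1) sJ(4)[OF s] X, symmetric] unfolding Z_def .
    have v: "v = (frame_matrix K X c (Z s) ** matrix_inv (gram K (frame_matrix K X c (Z s)) (metric_coord c (Z s)))) *v \<Phi> s"
      unfolding v_def P_def frame_proj_apply \<Phi>_def by (simp add: matrix_vector_mul_assoc matrix_mul_assoc)
    \<comment> \<open>The vertical part of the velocity depends linearly on \<open>\<Phi>\<close>.\<close>
    have y: "y \<bullet> v = (Wt (Z s) *v y) \<bullet> \<Phi> s" for y
      unfolding v Wt_def by (rule inner_matvec)
    have us: "u s = h + v" unfolding h_def by simp
    have "d\<Phi> i s = u s \<bullet> (Q i (Z s) *v u s)"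
      unfolding d\<Phi>_def Q_def using i half_lie_eq_matrix[OF c(1) sJ(4)[OF s] X] by simp
    also have "\<dots> = h \<bullet> (Q i (Z s) *v h) + h \<bullet> (Q i (Z s) *v v) + v \<bullet> (Q i (Z s) *v u s)"
      unfolding us by (simp only: matrix_vector_right_distrib inner_add_left inner_add_right)
    also have "\<dots> = (transpose (Q i (Z s)) *v h) \<bullet> v + v \<bullet> (Q i (Z s) *v u s)"
      unfolding 0 inner_matvec[of h "Q i (Z s)" v] by simp
    also have "\<dots> = (transpose (Q i (Z s)) *v h + Q i (Z s) *v u s) \<bullet> v"
      by (simp only: inner_add_left inner_commute[of v])
    also have "\<dots> = R i s \<bullet> \<Phi> s" using y[of "transpose (Q i (Z s)) *v h + Q i (Z s) *v u s"] unfolding R_def h_def v_def .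
    finally show ?thesis .
  qed
  have cz: "continuous_on {a..b} (\<lambda>s. k (Z s))" if "smooth_on N k" for k :: "real ^ 'n \<Rightarrow> real ^ 'n ^ 'n"
    by (rule continuous_on_compose2[OF smooth_on_imp_continuous_on[OF that] continuous_on_subset[OF Zc ab(1)]])
       (use ab(2) in blast)
  have cu: "continuous_on {a..b} u" by (rule continuous_on_subset[OF uc ab(1)])
  note mv = bounded_bilinear.continuous_on[OF bounded_bilinear_matvec]
  have Rc: "continuous_on {a..b} (R i)" for i
    unfolding R_def
    by (intro mv continuous_on_add continuous_on_diff cz[OF Ws] cz[OF Ps] cz[OF Qs] cz[OF smooth_on_transpose[OF N(1) Qs]] cu)
  have "\<exists>C. \<forall>s\<in>{a..b}. norm (R i s) \<le> C" for i
  proof -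
    have "bounded (R i ` {a..b})" by (intro compact_imp_bounded compact_continuous_image Rc compact_Icc)
    then show ?thesis unfolding bounded_iff by blast
  qed
  then obtain C where C: "\<And>i s. s \<in> {a..b} \<Longrightarrow> norm (R i s) \<le> C i" by metis
  define f where "f s = (\<Sum>i\<in>UNIV. \<psi> i s^2)" for s
  have f\<Phi>: "f s = (norm (\<Phi> s))^2" if "s \<in> {a..b}" for s
    unfolding f_def power2_norm_eq_inner inner_vec_def \<Phi>i[OF that] by (simp add: power2_eq_square)
  have fz: "f s = 0 \<longleftrightarrow> orthogonal_at A F g \<gamma> s" if "s \<in> {a..b}" for s
    unfolding f\<Phi>[OF that] orth[OF that] by simp
  have fd: "(f has_real_derivative (\<Sum>i\<in>UNIV. 2 * (\<Phi> s $ i) * d\<Phi> i s)) (at s)" if s: "s \<in> {a..b}" for s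
  proof -
    have "(f has_real_derivative (\<Sum>i\<in>UNIV. 2 * (\<psi> i s) * d\<Phi> i s)) (at s)"
      unfolding f_def
    proof (rule DERIV_sum)
      fix i
      show "((\<lambda>s. \<psi> i s^2) has_real_derivative
         2 * (\<psi> i s) * d\<Phi> i s) (at s)"
        using DERIV_power[OF d\<Phi>[OF s, of i], of 2] by (simp add: mult.assoc mult.commute mult.left_commute)
    qed
    then show ?thesis unfolding \<Phi>i[OF s] .
  qed
  have bd: "\<bar>\<Sum>i\<in>UNIV. 2 * (\<Phi> s $ i) * d\<Phi> i s\<bar> \<le> (\<Sum>i\<in>UNIV. 2 * C i) * f s" if s: "s \<in> {a..b}" for s
  proof -
    have "\<bar>2 * (\<Phi> s $ i) * d\<Phi> i s\<bar> \<le> 2 * C i * f s" for i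
    proof -
      have C0: "0 \<le> C i" using order_trans[OF norm_ge_zero C[OF s]] .
      have "\<bar>d\<Phi> i s\<bar> \<le> C i * norm (\<Phi> s)"
      proof (cases "i \<in> K")
        case True
        have "\<bar>R i s \<bullet> \<Phi> s\<bar> \<le> norm (R i s) * norm (\<Phi> s)" by (rule Cauchy_Schwarz_ineq2)
        also have "\<dots> \<le> C i * norm (\<Phi> s)" by (rule mult_right_mono[OF C[OF s]]) simp
        finally show ?thesis unfolding dR[OF s True] .
      next
        case False
        then show ?thesis unfolding d\<Phi>_def using C0 by simp
      qed
      then have "\<bar>\<Phi> s $ i\<bar> * \<bar>d\<Phi> i s\<bar> \<le> norm (\<Phi> s) * (C i * norm (\<Phi> s))"
        by (intro mult_mono component_le_norm_cart) auto
      then show ?thesis unfolding f\<Phi>[OF s] by (simp add: abs_mult power2_eq_square mult.assoc mult.left_commute)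
    qed
    then have "\<bar>\<Sum>i\<in>UNIV. 2 * (\<Phi> s $ i) * d\<Phi> i s\<bar> \<le> (\<Sum>i\<in>UNIV. 2 * C i * f s)"
      by (intro order_trans[OF sum_abs] sum_mono)
    then show ?thesis by (simp add: sum_distrib_right)
  qed
  have nn: "f s \<ge> 0" for s unfolding f_def by (intro sum_nonneg) simp
  have transfer_zero: "orthogonal_at A F g \<gamma> s \<longrightarrow> orthogonal_at A F g \<gamma> t" if s: "s \<in> {a..b}" and t: "t \<in> {a..b}" for s t
  proof
    assume "orthogonal_at A F g \<gamma> s"
    then have fs0: "f s = 0" using fz[OF s] by simp
    have "f t = 0" by (rule gronwall_zero[OF fd bd nn s _ t]) (assumption | rule fs0)+
    then show "orthogonal_at A F g \<gamma> t" using fz[OF t] by simp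
  qed
  show ?thesis
  proof (intro exI[of _ r] conjI r(1) ballI)
    show "{t1-r<..<t1+r} \<subseteq> I" using sJ(1) unfolding a_def b_def by (auto simp: less_imp_le)
    fix s t assume "s \<in> {t1-r<..<t1+r}" "t \<in> {t1-r<..<t1+r}"
    then show "orthogonal_at A F g \<gamma> s \<longrightarrow> orthogonal_at A F g \<gamma> t"
      by (intro transfer_zero) (auto simp: a_def b_def)
  qed
qed

text \<open>
  Connectedness of the interval of definition turns local propagation of orthogonality into a global
  one.
\<close>

lemma half_lie_zero_imp_adapted:
  assumes S: "S = reg"
    and kill: "\<And>c x X u. c \<in> A \<Longrightarrow> x \<in> fst c \<Longrightarrow> x \<in> S \<Longrightarrow> tangent_field X \<Longrightarrow> horizontal c x u \<Longrightarrow> half_lie X c (snd c x) u = 0"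
  shows "adapted A F S g"
  unfolding adapted_def
proof (intro allI impI ballI)
  fix I \<gamma> t assume as: "geodesic A g I \<gamma> \<and> \<gamma> ` I \<subseteq> S \<and> (\<exists>t\<in>I. orthogonal_at A F g \<gamma> t)" and t: "t \<in> I"
  then obtain t0 where t0: "t0 \<in> I" "orthogonal_at A F g \<gamma> t0" by auto
  have conn: "connected I" using as is_interval_connected_1[of I] unfolding geodesic_def by simp
  show "orthogonal_at A F g \<gamma> t"
  proof (rule connected_induction_simple[where P = "orthogonal_at A F g \<gamma>", OF conn t0(1) t t0(2)])
    fix t1 assume t1: "t1 \<in> I"
    obtain \<delta> where d: "\<delta> > 0" "{t1-\<delta><..<t1+\<delta>} \<subseteq> I"
      "\<forall>s\<in>{t1-\<delta><..<t1+\<delta>}. \<forall>t\<in>{t1-\<delta><..<t1+\<delta>}. orthogonal_at A F g \<gamma> s \<longrightarrow> orthogonal_at A F g \<gamma> t"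
      using orthogonality_propagates[OF S kill _ _ t1, of \<gamma>] as by auto
    show "\<exists>T. openin (top_of_set I) T \<and> t1 \<in> T \<and> (\<forall>x\<in>T. \<forall>y\<in>T. orthogonal_at A F g \<gamma> x \<longrightarrow> orthogonal_at A F g \<gamma> y)"
      using d by (intro exI[of _ "{t1-\<delta><..<t1+\<delta>}"] conjI open_subset) auto
  qed
qed

end

section \<open>The rescaled metrics\<close>

text \<open>
  The segment from the identity to \<open>B\<close> consists of positive definite, hence invertible matrices, so
  the determinant does not change sign along it.
\<close>

lemma spd_det_pos:
  fixes B :: "real ^ 'n::finite ^ 'n"
  assumes B: "spd B" shows "det B > 0"
proof (rule ccontr)
  assume "\<not> det B > 0"
  define h where "h t = det ((1 - t) *\<^sub>R mat 1 + t *\<^sub>R B)" for t :: real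
  have "smooth_on UNIV h" unfolding h_def
    by (intro smooth_on_det smooth_on_add smooth_on_scaleR smooth_on_diff smooth_on_const smooth_on_ident open_UNIV)
  then have hc: "continuous_on {0..1} h" using smooth_on_imp_continuous_on continuous_on_subset by blast
  have "h 1 \<le> 0" "0 \<le> h 0" using \<open>\<not> det B > 0\<close> unfolding h_def by auto
  then obtain t where t: "0 \<le> t" "t \<le> 1" "h t = 0" using IVT2'[of h 1 0 0] hc by auto
  have "spd ((1 - t) *\<^sub>R mat 1 + t *\<^sub>R B)"
    unfolding spd_def
  proof (intro conjI allI impI)
    have "transpose B = B" using B unfolding spd_def by simp
    then show "transpose ((1 - t) *\<^sub>R mat 1 + t *\<^sub>R B) = (1 - t) *\<^sub>R mat 1 + t *\<^sub>R B"
      by (auto simp: vec_eq_iff transpose_def mat_def)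
    fix v :: "real ^ 'n" assume v: "v \<noteq> 0"
    have e: "v \<bullet> (((1 - t) *\<^sub>R mat 1 + t *\<^sub>R B) *v v) = (1 - t) * (v \<bullet> v) + t * (v \<bullet> (B *v v))"
      by (simp add: matrix_vector_mult_add_rdistrib scaleR_matrix_vector_assoc[symmetric] inner_add_right)
    have "v \<bullet> v > 0" using v by simp
    then show "v \<bullet> (((1 - t) *\<^sub>R mat 1 + t *\<^sub>R B) *v v) > 0"
      unfolding e using t(1,2) spd_pos[OF B v] by (cases "t = 0") (auto intro!: add_nonneg_pos mult_nonneg_nonneg mult_pos_pos)
  qed
  then have "h t \<noteq> 0" unfolding h_def using spd_invertible invertible_det_nz by blast
  then show False using t(3) by simp
qed

lemma christoffel_coord_scale:
  assumes "m differentiable at p" shows "christoffel_coord m p (s *\<^sub>R u) (s *\<^sub>R u) = s\<^sup>2 *\<^sub>R christoffel_coord m p u u"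
proof -
  have lin: "linear (frechet_derivative m (at p))" by (rule linear_frechet_derivative[OF assms])
  have "(\<chi> l. ((frechet_derivative m (at p) (s *\<^sub>R u) *v (s *\<^sub>R u)) $ l + (frechet_derivative m (at p) (s *\<^sub>R u) *v (s *\<^sub>R u)) $ l
            - (s *\<^sub>R u) \<bullet> (frechet_derivative m (at p) (axis l 1) *v (s *\<^sub>R u))) / 2)
    = s\<^sup>2 *\<^sub>R (\<chi> l. ((frechet_derivative m (at p) u *v u) $ l + (frechet_derivative m (at p) u *v u) $ l
            - u \<bullet> (frechet_derivative m (at p) (axis l 1) *v u)) / 2)"
    unfolding linear_cmul[OF lin]
    by (simp add: vec_eq_iff matrix_vector_mult_scaleR scaleR_matrix_vector_assoc[symmetric] power2_eq_square algebra_simps)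
  then show ?thesis unfolding christoffel_coord_def by (simp add: matrix_vector_mult_scaleR)
qed

locale foliated_riemannian = foliated_metric A F UNIV g for A :: "('m::t2_space, 'n::finite) chart set" and F :: "'m set set" and g :: "('m, 'n) tensor2"
begin

text \<open>
  Defined at singular points as well, where it is an inner product on each tangent space that need not
  depend continuously on the point.
\<close>

definition rescaled :: "real \<Rightarrow> ('m, 'n) tensor2" where
  "rescaled \<mu> c x = (if c \<in> A \<and> x \<in> fst c then rescale (g c x) (LT c x) \<mu> else 0)"

lemma rescaled_at: "c \<in> A \<Longrightarrow> x \<in> fst c \<Longrightarrow> rescaled \<mu> c x = rescale (g c x) (LT c x) \<mu>"
  unfolding rescaled_def by simp

lemma metric_coord_smooth_range: "c \<in> A \<Longrightarrow> smooth_on (chart_range c) (metric_coord c)"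
  using metric_coord_smooth[of c] chart_image_UNIV[of c] by simp

lemma vproj_oproj: "c \<in> A \<Longrightarrow> x \<in> fst c \<Longrightarrow> vproj F g c x u = oproj (g c x) (LT c x) *v u"
  unfolding vproj_def ip_def by (rule oproj_the[OF spd_g LT_subspace])

lemma transverse_at: "c \<in> A \<Longrightarrow> x \<in> fst c \<Longrightarrow> transverse_metric A F g c x = g c x - g c x ** oproj (g c x) (LT c x)"
  unfolding transverse_metric_def hproj_def ip_def
  using transverse_matrix[OF spd_g LT_subspace] by (simp add: vproj_oproj)

lemma leaf_at: "c \<in> A \<Longrightarrow> x \<in> fst c \<Longrightarrow> leaf_metric A F g c x = g c x ** oproj (g c x) (LT c x)"
  unfolding leaf_metric_def ip_def
  using leaf_matrix[OF spd_g LT_subspace] by (simp add: vproj_oproj)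

lemma rescaled_split:
  "c \<in> A \<Longrightarrow> x \<in> fst c \<Longrightarrow> rescaled \<mu> c x = transverse_metric A F g c x + \<mu> *\<^sub>R leaf_metric A F g c x"
  by (simp add: rescaled_at transverse_at leaf_at rescale_def[OF spd_g LT_subspace] algebra_simps)

lemma vproj_rescaled: "\<mu> > 0 \<Longrightarrow> c \<in> A \<Longrightarrow> x \<in> fst c \<Longrightarrow> vproj F (rescaled \<mu>) c x u = oproj (g c x) (LT c x) *v u"
  unfolding vproj_def ip_def rescaled_at
  using oproj_the[OF rescale_spd[OF spd_g LT_subspace] LT_subspace] oproj_rescale[OF spd_g LT_subspace] by simp

lemma transverse_rescaled: assumes mu: "\<mu> > 0" shows "transverse_metric A F (rescaled \<mu>) = transverse_metric A F g"
proof (intro ext)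
  fix c x
  show "transverse_metric A F (rescaled \<mu>) c x = transverse_metric A F g c x"
  proof (cases "c \<in> A \<and> x \<in> fst c")
    case True
    then have c: "c \<in> A" "x \<in> fst c" by auto
    note B = spd_g[OF c] and V = LT_subspace[OF c]
    have "transverse_metric A F (rescaled \<mu>) c x = rescaled \<mu> c x - rescaled \<mu> c x ** oproj (rescaled \<mu> c x) (LT c x)"
      unfolding transverse_metric_def hproj_def ip_def vproj_rescaled[OF mu c]
      using transverse_matrix[OF rescale_spd[OF B V mu] V] c oproj_rescale[OF B V mu] by (simp add: rescaled_at)
    also have "\<dots> = g c x - g c x ** oproj (g c x) (LT c x)"
    proof (rule matrix_eqI_inner)
      fix u w
      show "u \<bullet> ((rescaled \<mu> c x - rescaled \<mu> c x ** oproj (rescaled \<mu> c x) (LT c x)) *v w) = u \<bullet> ((g c x - g c x ** oproj (g c x) (LT c x)) *v w)"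
        by (simp add: rescaled_at c oproj_rescale[OF B V mu] matrix_vector_mult_diff_rdistrib matrix_vector_mul_assoc[symmetric]
            rescale_apply[OF B V] oproj_id[OF B V oproj_in[OF B V]])
    qed
    finally show ?thesis unfolding transverse_at[OF c] .
  qed (auto simp: transverse_metric_def)
qed

text \<open>
  Smoothness is only claimed on the regular set, where local frames make the vertical projection
  smooth.
\<close>

lemma rescaled_smooth: assumes c: "c \<in> A" shows "smooth_on (snd c ` (fst c \<inter> reg)) (\<lambda>z. rescaled \<mu> c (chart_inv c z))"
proof (rule smooth_on_local)
  fix z assume z: "z \<in> snd c ` (fst c \<inter> reg)"
  then have x: "chart_inv c z \<in> reg" "z \<in> chart_range c" unfolding chart_image[OF c] by auto
  have sz: "snd c (chart_inv c z) = z" using c x by simp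
  obtain N K X where N: "open N" "snd c (chart_inv c z) \<in> N" "N \<subseteq> snd c ` (fst c \<inter> reg)"
    and X: "\<And>i. tangent_field (X i)" and fr: "\<And>z. z \<in> N \<Longrightarrow> frame K (frame_matrix K X c z) (LT c (chart_inv c z))"
    and fs: "smooth_on N (frame_matrix K X c)"
    by (rule local_frame[OF x(1) c chart_inv_in[OF c x(2)]]) (rule that)
  have Nd: "N \<subseteq> snd c ` (fst c \<inter> UNIV)" using N(3) by blast
  have Nr: "w \<in> chart_range c" if "w \<in> N" for w using subsetD[OF N(3) that] unfolding chart_image[OF c] by simp
  have e: "rescaled \<mu> c (chart_inv c w) = metric_coord c w + (\<mu> - 1) *\<^sub>R (metric_coord c w ** frame_proj K (frame_matrix K X c w) (metric_coord c w))" if w: "w \<in> N" for w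
    using oproj_frame[OF spd_g[OF c chart_inv_in[OF c Nr[OF w]]] LT_subspace[OF c chart_inv_in[OF c Nr[OF w]]] fr[OF w]]
    unfolding rescaled_at[OF c chart_inv_in[OF c Nr[OF w]]] metric_coord_def
      rescale_def[OF spd_g[OF c chart_inv_in[OF c Nr[OF w]]] LT_subspace[OF c chart_inv_in[OF c Nr[OF w]]]] by simp
  have "smooth_on N (\<lambda>w. metric_coord c w + (\<mu> - 1) *\<^sub>R (metric_coord c w ** frame_proj K (frame_matrix K X c w) (metric_coord c w)))"
    by (intro smooth_on_add smooth_on_scaleR smooth_on_const smooth_on_matmul N(1)
        smooth_on_subset[OF metric_coord_smooth[OF c] Nd] frame_proj_smooth(2)[OF c N(1) Nd fr fs])
  then have "smooth_on N (\<lambda>z. rescaled \<mu> c (chart_inv c z))" using smooth_on_cong[OF N(1) e] by simp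
  then show "\<exists>T. open T \<and> z \<in> T \<and> smooth_on T (\<lambda>z. rescaled \<mu> c (chart_inv c z))"
    using N(1,2) sz by (intro exI[of _ N]) simp
qed

lemma rescaled_metric: assumes mu: "\<mu> > 0" shows "riemannian_metric A reg (rescaled \<mu>)"
  unfolding riemannian_metric_def
proof (intro conjI allI impI ballI)
  fix c x assume "\<not> (c \<in> A \<and> x \<in> fst c)" then show "rescaled \<mu> c x = 0" unfolding rescaled_def by auto
next
  fix c x assume c: "c \<in> A" "x \<in> fst c"
  note sp = rescale_spd[OF spd_g[OF c] LT_subspace[OF c] mu]
  show "transpose (rescaled \<mu> c x) = rescaled \<mu> c x" using sp unfolding rescaled_at[OF c] spd_def by simp
  fix v :: "real ^ 'n" assume "v \<noteq> 0"
  then show "ip (rescaled \<mu>) c x v v > 0" using spd_pos[OF sp] unfolding rescaled_at[OF c] ip_def by simp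
next
  fix c d x assume cd: "c \<in> A" "d \<in> A" and "x \<in> fst c \<inter> fst d"
  then have x: "x \<in> fst c" "x \<in> fst d" by auto
  show "rescaled \<mu> c x = transpose (jacobian c d x) ** rescaled \<mu> d x ** jacobian c d x"
    unfolding rescaled_at[OF cd(1) x(1)] rescaled_at[OF cd(2) x(2)]
    by (rule rescale_transform[OF spd_g[OF cd(2) x(2)] LT_subspace[OF cd(1) x(1)] LT_subspace[OF cd(2) x(2)] spd_g[OF cd(1) x(1)]
          g_change[OF cd x] leaf_tangent_image[OF cd x]])
next
  fix c assume "c \<in> A" then show "smooth_on (snd c ` (fst c \<inter> reg)) (\<lambda>z. rescaled \<mu> c (chart_inv c z))" by (rule rescaled_smooth)
qed

lemma rescaled_foliated_metric: "\<mu> > 0 \<Longrightarrow> foliated_metric A F reg (rescaled \<mu>)"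
  by unfold_locales (rule regular_open, rule rescaled_metric)

text \<open>
  By the two lemmas that translate adaptedness into its infinitesimal form, it suffices that \<open>half_lie\<close> is
  the same for both metrics on a horizontal vector \<open>u\<close>.  The difference of the two quadratic forms on the
  fixed coordinate vector \<open>u\<close> is \<open>\<mu> - 1\<close> times the squared length of the vertical part of \<open>u\<close>.  As a
  function of the base point this has an extremum, namely \<open>0\<close>, where \<open>u\<close> is horizontal, so its
  derivative vanishes there.
\<close>

lemma rescaled_adapted:
  assumes mu: "\<mu> > 0" and ad: "adapted A F UNIV g"
  shows "adapted A F reg (rescaled \<mu>)"
proof -
  interpret G: foliated_metric A F reg "rescaled \<mu>" by (rule rescaled_foliated_metric[OF mu])
  show ?thesis
  proof (rule G.half_lie_zero_imp_adapted[OF refl])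
    fix c x X u assume c: "c \<in> A" "x \<in> fst c" and xr: "x \<in> reg" and X: "tangent_field X" and h: "G.horizontal c x u"
    note B = spd_g[OF c] and V = LT_subspace[OF c]
    define p where "p = snd c x"
    have pr: "p \<in> snd c ` (fst c \<inter> reg)" "p \<in> chart_range c" unfolding p_def using c xr by auto
    have hg: "\<forall>v\<in>LT c x. u \<bullet> (g c x *v v) = 0"
      using h unfolding G.horizontal_def rescaled_at[OF c] by (simp add: rescale_orth_iff[OF B V mu])
    then have hor: "horizontal c x u" unfolding horizontal_def .
    have P0: "oproj (g c x) (LT c x) *v u = 0" by (rule oproj_zero[OF B V]) (use hg in simp)
    define DX where "DX = frechet_derivative (\<lambda>z. X c (chart_inv c z)) (at p) u"
    define w where "w = X c (chart_inv c p)"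
    have dm: "(metric_coord c has_derivative frechet_derivative (metric_coord c) (at p)) (at p)"
      by (rule smooth_on_has_derivative[OF metric_coord_smooth_range[OF c(1)] pr(2)])
    have dG: "(G.metric_coord c has_derivative frechet_derivative (G.metric_coord c) (at p)) (at p)"
      by (rule smooth_on_has_derivative[OF G.metric_coord_smooth[OF c(1)] pr(1)])
    have quad: "((\<lambda>z. u \<bullet> (m z *v u)) has_derivative (\<lambda>w. u \<bullet> (Dm w *v u))) (at p)" if "(m has_derivative Dm) (at p)"
      for m :: "real ^ 'n \<Rightarrow> real ^ 'n ^ 'n" and Dm
      by (intro has_derivative_inner_right bounded_linear.has_derivative[OF bounded_bilinear.bounded_linear_left[OF bounded_bilinear_matvec] that])
    \<comment> \<open>The coordinate vector \<open>u\<close> is kept fixed while the base point varies.\<close>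
    define E where "E z = u \<bullet> (G.metric_coord c z *v u) - u \<bullet> (metric_coord c z *v u)" for z
    have dE: "(E has_derivative (\<lambda>w. u \<bullet> (frechet_derivative (G.metric_coord c) (at p) w *v u) - u \<bullet> (frechet_derivative (metric_coord c) (at p) w *v u))) (at p)"
      unfolding E_def by (intro has_derivative_diff quad dm dG)
    define L where "L z = (oproj (metric_coord c z) (LT c (chart_inv c z)) *v u) \<bullet> (metric_coord c z *v (oproj (metric_coord c z) (LT c (chart_inv c z)) *v u))" for z
    have EL: "E z = (\<mu> - 1) * L z" if z: "z \<in> chart_range c" for z
    proof -
      note cz = c(1) chart_inv_in[OF c(1) z]
      show ?thesis
        unfolding E_def L_def metric_coord_def G.metric_coord_def rescaled_at[OF cz] rescale_apply[OF spd_g[OF cz] LT_subspace[OF cz]]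
        using oproj_selfadj[OF spd_g[OF cz] LT_subspace[OF cz], of u u] by (simp add: inner_add_right)
    qed
    have L0: "L z \<ge> 0" if z: "z \<in> chart_range c" for z
      unfolding L_def using spd_pos[OF spd_metric_coord[OF c(1) z], of "oproj (metric_coord c z) (LT c (chart_inv c z)) *v u"]
      by (cases "oproj (metric_coord c z) (LT c (chart_inv c z)) *v u = 0") auto
    have Lp: "L p = 0" unfolding L_def p_def using c P0 by simp
    have "(\<forall>y\<in>chart_range c. E y \<le> E p) \<or> (\<forall>y\<in>chart_range c. E p \<le> E y)"
    proof (cases "\<mu> \<ge> 1")
      case True
      then show ?thesis using EL L0 EL[OF pr(2)] Lp by simp
    next
      case False
      then have "(\<mu> - 1) * L y \<le> 0" if "y \<in> chart_range c" for y using L0[OF that] by (intro mult_nonpos_nonneg) auto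
      then show ?thesis using EL EL[OF pr(2)] Lp by simp
    qed
    from differential_zero_maxmin[OF pr(2) chart_range_open[OF c(1)] dE this]
    have D: "u \<bullet> (frechet_derivative (G.metric_coord c) (at p) w *v u) = u \<bullet> (frechet_derivative (metric_coord c) (at p) w *v u)"
      by (simp add: fun_eq_iff)
    have "u \<bullet> (rescaled \<mu> c x *v DX) = DX \<bullet> (rescaled \<mu> c x *v u)" using spd_sym[OF G.spd_g[OF c]] .
    also have "\<dots> = DX \<bullet> (g c x *v u)" unfolding rescaled_at[OF c] using rescale_hor[OF B V] hg by simp
    also have "\<dots> = u \<bullet> (g c x *v DX)" using spd_sym[OF B] .
    finally have S: "u \<bullet> (G.metric_coord c p *v DX) = u \<bullet> (metric_coord c p *v DX)" unfolding p_def using c by simp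
    have "half_lie X c p u = 0"
      unfolding p_def by (rule adapted_imp_half_lie_zero[OF ad c UNIV_I X hor])
    then show "G.half_lie X c (snd c x) u = 0"
      unfolding G.half_lie_def half_lie_def p_def[symmetric] DX_def[symmetric] w_def[symmetric] D S .
  qed
qed

text \<open>
  The differential of a basic function kills vertical vectors, so its gradient is horizontal; on
  horizontal vectors the metrics agree.
\<close>

lemma grad_rescaled:
  assumes mu: "\<mu> > 0" and U: "open U" and f: "smooth_fun A U f" "basic_on F U f" and c: "c \<in> A" "x \<in> fst c" "x \<in> U"
  shows "grad (rescaled \<mu>) c f x = grad g c f x" "\<forall>v\<in>LT c x. grad g c f x \<bullet> (g c x *v v) = 0"
proof -
  note B = spd_g[OF c(1,2)] and V = LT_subspace[OF c(1,2)]
  define D where "D = (\<chi> i. dfun c f x (axis i 1))"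
  have "smooth_on (snd c ` (fst c \<inter> U)) (f \<circ> chart_inv c)" using f(1) c(1) unfolding smooth_fun_def by simp
  then have lin: "linear (dfun c f x)" unfolding dfun_def using c
    by (intro linear_frechet_derivative smooth_on_imp_differentiable) auto
  have Dv: "D \<bullet> v = dfun c f x v" for v
  proof -
    have "dfun c f x (\<Sum>i\<in>UNIV. v $ i *\<^sub>R axis i 1) = (\<Sum>i\<in>UNIV. v $ i *\<^sub>R dfun c f x (axis i 1))"
      by (simp only: linear_sum[OF lin] linear_cmul[OF lin])
    then show ?thesis unfolding vec_expand D_def by (simp add: inner_vec_def mult.commute)
  qed
  define w where "w = grad g c f x"
  have w: "w = matrix_inv (g c x) *v D" unfolding w_def grad_def D_def ..
  have Bw: "g c x *v w = D" unfolding w by (simp add: matrix_vector_mul_assoc matrix_inv_both(1)[OF spd_invertible[OF B]])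
  have hor: "w \<bullet> (g c x *v v) = 0" if "v \<in> LT c x" for v
    using spd_sym[OF B, of w v] Bw Dv[of v] basic_dfun_zero[OF U f c that] by (simp add: inner_commute)
  then show "\<forall>v\<in>LT c x. grad g c f x \<bullet> (g c x *v v) = 0" unfolding w_def by simp
  have "rescaled \<mu> c x *v w = D" unfolding rescaled_at[OF c(1,2)] using rescale_hor[OF B V hor] Bw by simp
  then have "matrix_inv (rescaled \<mu> c x) *v (rescaled \<mu> c x *v w) = matrix_inv (rescaled \<mu> c x) *v D" by simp
  moreover have "invertible (rescaled \<mu> c x)"
    unfolding rescaled_at[OF c(1,2)] by (rule spd_invertible[OF rescale_spd[OF B V mu]])
  ultimately have "w = matrix_inv (rescaled \<mu> c x) *v D" by (simp add: matrix_vector_mul_assoc matrix_inv_both(2))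
  then show "grad (rescaled \<mu>) c f x = grad g c f x" unfolding w_def[symmetric] unfolding grad_def D_def by simp
qed

lemma rescaled_descends:
  assumes mu: "\<mu> > 0" and de: "descends A F UNIV g"
  shows "descends A F reg (rescaled \<mu>)"
  unfolding descends_def
proof (intro allI impI ballI)
  fix U f h c d x y
  assume U: "open U \<and> U \<subseteq> reg \<and> saturated F U \<and> smooth_fun A U f \<and> basic_on F U f \<and> smooth_fun A U h \<and> basic_on F U h"
    and cd: "c \<in> A" "d \<in> A" and x: "x \<in> fst c \<inter> U" and y: "y \<in> fst d \<inter> U" and l: "leaf_of F x = leaf_of F y"
  have same: "ip (rescaled \<mu>) c x (grad (rescaled \<mu>) c f x) (grad (rescaled \<mu>) c h x) = ip g c x (grad g c f x) (grad g c h x)"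
    if c: "c \<in> A" "x \<in> fst c \<inter> U" for c x
  proof -
    have x: "x \<in> fst c" "x \<in> U" using c by auto
    note B = spd_g[OF c(1) x(1)] and V = LT_subspace[OF c(1) x(1)]
    have f: "grad (rescaled \<mu>) c f x = grad g c f x"
      using grad_rescaled(1)[OF mu _ _ _ c(1) x, of f] U by simp
    have h: "grad (rescaled \<mu>) c h x = grad g c h x" "\<forall>v\<in>LT c x. grad g c h x \<bullet> (g c x *v v) = 0"
      using grad_rescaled[OF mu _ _ _ c(1) x, of h] U by simp_all
    have "rescaled \<mu> c x *v grad g c h x = g c x *v grad g c h x"
      unfolding rescaled_at[OF c(1) x(1)] using rescale_hor[OF B V] h(2) by simp
    then show ?thesis unfolding f h(1) ip_def by simp
  qed
  have "ip g c x (grad g c f x) (grad g c h x) = ip g d y (grad g d f y) (grad g d h y)"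
    using de U cd x y l unfolding descends_def by blast
  then show "ip (rescaled \<mu>) c x (grad (rescaled \<mu>) c f x) (grad (rescaled \<mu>) c h x) = ip (rescaled \<mu>) d y (grad (rescaled \<mu>) d f y) (grad (rescaled \<mu>) d h y)"
    unfolding same[OF cd(1) x] same[OF cd(2) y] .
qed

end

section \<open>Mean curvature\<close>

text \<open>
  The covariant derivative of a field \<open>E\<close> along itself, with lowered index, in terms of the derivatives
  of the one-form \<open>m E\<close> and of the function \<open>E \<bullet> m E\<close>; here \<open>e\<close> stands for the value of \<open>E\<close> and \<open>DE\<close> for
  its derivative at the point.  The purpose of this form is that the metric enters only through the
  one-form \<open>m E\<close>.
\<close>

lemma acceleration_lower:
  assumes dm: "(m has_derivative Dm) (at p)" and inv: "invertible (m p)" and sy: "transpose (m p) = m p"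
  shows "w \<bullet> (m p *v (DE e + christoffel_coord m p e e)) = w \<bullet> (m p *v DE e + Dm e *v e)
      - (e \<bullet> (m p *v DE w + Dm w *v e) + DE w \<bullet> (m p *v e)) / 2 + DE w \<bullet> (m p *v e)"
proof -
  have "e \<bullet> (m p *v DE w) = DE w \<bullet> (m p *v e)"
    using inner_matvec[of e "m p" "DE w"] sy by (simp add: inner_commute)
  then show ?thesis
    using christoffel_coord_lower[OF dm inv, of w e] by (simp add: matrix_vector_right_distrib inner_add_right field_simps)
qed

text \<open>
  If \<open>n E = \<mu> m E\<close> near a point, then all ingredients of the preceding formula scale by \<open>\<mu>\<close>.
\<close>

lemma acceleration_rescale:
  fixes m n :: "real ^ 'n::finite \<Rightarrow> real ^ 'n ^ 'n"
  assumes dm: "(m has_derivative Dm) (at p)" "invertible (m p)" "transpose (m p) = m p"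
    and dn: "(n has_derivative Dn) (at p)" "invertible (n p)" "transpose (n p) = n p"
    and dE: "(E has_derivative DE) (at p)"
    and W: "open W" "p \<in> W" and eq: "\<And>z. z \<in> W \<Longrightarrow> n z *v E z = \<mu> *\<^sub>R (m z *v E z)"
  shows "n p *v (DE (E p) + christoffel_coord n p (E p) (E p)) = \<mu> *\<^sub>R (m p *v (DE (E p) + christoffel_coord m p (E p) (E p)))"
proof -
  have th: "((\<lambda>z. k z *v E z) has_derivative (\<lambda>v. k p *v DE v + Dk v *v E p)) (at p)" if "(k has_derivative Dk) (at p)"
    for k :: "real ^ 'n \<Rightarrow> real ^ 'n ^ 'n" and Dk
    by (rule bounded_bilinear.FDERIV[OF bounded_bilinear_matvec that dE])
  have ps: "((\<lambda>z. E z \<bullet> (k z *v E z)) has_derivative (\<lambda>v. E p \<bullet> (k p *v DE v + Dk v *v E p) + DE v \<bullet> (k p *v E p))) (at p)"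
    if "(k has_derivative Dk) (at p)" for k :: "real ^ 'n \<Rightarrow> real ^ 'n ^ 'n" and Dk
    by (rule bounded_bilinear.FDERIV[OF bounded_bilinear_inner dE th[OF that]])
  have "((\<lambda>z. n z *v E z) has_derivative (\<lambda>v. \<mu> *\<^sub>R (m p *v DE v + Dm v *v E p))) (at p)"
    by (rule has_derivative_transform_within_open[OF has_derivative_scaleR_right[OF th[OF dm(1)]] W]) (simp add: eq)
  from has_derivative_unique[OF th[OF dn(1)] this]
  have 1: "n p *v DE v + Dn v *v E p = \<mu> *\<^sub>R (m p *v DE v + Dm v *v E p)" for v by (rule fun_cong)
  have "((\<lambda>z. E z \<bullet> (n z *v E z)) has_derivative (\<lambda>v. \<mu> *\<^sub>R (E p \<bullet> (m p *v DE v + Dm v *v E p) + DE v \<bullet> (m p *v E p)))) (at p)"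
    by (rule has_derivative_transform_within_open[OF has_derivative_scaleR_right[OF ps[OF dm(1)]] W]) (simp add: eq)
  from has_derivative_unique[OF ps[OF dn(1)] this]
  have 2: "E p \<bullet> (n p *v DE v + Dn v *v E p) + DE v \<bullet> (n p *v E p)
      = \<mu> * (E p \<bullet> (m p *v DE v + Dm v *v E p) + DE v \<bullet> (m p *v E p))" for v by (simp add: fun_eq_iff)
  have "w \<bullet> (n p *v (DE (E p) + christoffel_coord n p (E p) (E p))) = w \<bullet> (\<mu> *\<^sub>R (m p *v (DE (E p) + christoffel_coord m p (E p) (E p))))" for w
    unfolding inner_scaleR_right acceleration_lower[OF dm] acceleration_lower[OF dn] 1 2 eq[OF W(2)]
    by (simp add: algebra_simps)
  then show ?thesis using vector_eq_ldot by blast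
qed

context foliated_riemannian begin

lemma hproj_g: "c \<in> A \<Longrightarrow> x \<in> fst c \<Longrightarrow> hproj F g c x u = u - oproj (g c x) (LT c x) *v u"
  unfolding hproj_def by (simp add: vproj_oproj)

lemma hproj_rescaled: "\<mu> > 0 \<Longrightarrow> c \<in> A \<Longrightarrow> x \<in> fst c \<Longrightarrow> hproj F (rescaled \<mu>) c x u = hproj F g c x u"
  unfolding hproj_def by (simp add: vproj_oproj vproj_rescaled)

lemma hproj_scale: "c \<in> A \<Longrightarrow> x \<in> fst c \<Longrightarrow> hproj F g c x (s *\<^sub>R u) = s *\<^sub>R hproj F g c x u"
  by (simp add: hproj_g matrix_vector_mult_scaleR scaleR_diff_right)

text \<open>
  The lowered accelerations of a vertical field differ by the factor \<open>\<mu>\<close>, and lowering the index of a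
  horizontal vector is the same for both metrics; hence the horizontal parts differ by \<open>\<mu>\<close> too.
\<close>

lemma hproj_acceleration_rescaled:
  assumes mu: "\<mu> > 0" and c: "c \<in> A" "x \<in> fst c" "x \<in> reg"
    and W: "open W" "snd c x \<in> W" "W \<subseteq> chart_range c" and E: "smooth_on W E" "\<And>z. z \<in> W \<Longrightarrow> E z \<in> LT c (chart_inv c z)"
  shows "hproj F (rescaled \<mu>) c x (covariant_derivative (rescaled \<mu>) c x E E) = \<mu> *\<^sub>R hproj F g c x (covariant_derivative g c x E E)"
proof -
  interpret G: foliated_metric A F reg "rescaled \<mu>" by (rule rescaled_foliated_metric[OF mu])
  define p where "p = snd c x"
  have pr: "p \<in> snd c ` (fst c \<inter> reg)" "p \<in> chart_range c" "p \<in> W" unfolding p_def using c W by auto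
  note B = spd_g[OF c(1,2)] and V = LT_subspace[OF c(1,2)]
  have mp: "metric_coord c p = g c x" "G.metric_coord c p = rescaled \<mu> c x" unfolding p_def using c by simp_all
  have sG: "spd (rescaled \<mu> c x)" by (rule G.spd_g[OF c(1,2)])
  have dm: "(metric_coord c has_derivative frechet_derivative (metric_coord c) (at p)) (at p)"
    by (rule smooth_on_has_derivative[OF metric_coord_smooth_range[OF c(1)] pr(2)])
  have dG: "(G.metric_coord c has_derivative frechet_derivative (G.metric_coord c) (at p)) (at p)"
    by (rule smooth_on_has_derivative[OF G.metric_coord_smooth[OF c(1)] pr(1)])
  have dE: "(E has_derivative frechet_derivative E (at p)) (at p)" by (rule smooth_on_has_derivative[OF E(1) pr(3)])
  have eq: "G.metric_coord c z *v E z = \<mu> *\<^sub>R (metric_coord c z *v E z)" if z: "z \<in> W" for z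
  proof -
    note cz = c(1) chart_inv_in[OF c(1) subsetD[OF W(3) z]]
    show ?thesis unfolding G.metric_coord_def metric_coord_def rescaled_at[OF cz]
      by (rule rescale_vert[OF spd_g[OF cz] LT_subspace[OF cz] E(2)[OF z]])
  qed
  define a where "a = covariant_derivative g c x E E"
  define aG where "aG = covariant_derivative (rescaled \<mu>) c x E E"
  have a: "a = frechet_derivative E (at p) (E p) + christoffel_coord (metric_coord c) p (E p) (E p)"
    unfolding a_def covariant_derivative_def p_def christoffel_eq_coord[OF c(1,2)] ..
  have aG: "aG = frechet_derivative E (at p) (E p) + christoffel_coord (G.metric_coord c) p (E p) (E p)"
    unfolding aG_def covariant_derivative_def p_def G.christoffel_eq_coord[OF c(1,2)] ..
  have "rescaled \<mu> c x *v aG = \<mu> *\<^sub>R (g c x *v a)"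
    unfolding a aG mp[symmetric]
    by (rule acceleration_rescale[OF dm _ _ dG _ _ dE W(1) pr(3) eq])
       (use B sG spd_invertible[OF B] spd_invertible[OF sG] in \<open>simp_all add: mp spd_def\<close>)
  \<comment> \<open>By the definition of the rescaled inner product as \<open>g (1 + (\<mu> - 1) P)\<close>.\<close>
  then have "g c x *v (aG + (\<mu> - 1) *\<^sub>R (oproj (g c x) (LT c x) *v aG)) = g c x *v (\<mu> *\<^sub>R a)"
    unfolding rescaled_at[OF c(1,2)] rescale_apply[OF B V] by (simp add: matrix_vector_right_distrib matrix_vector_mult_scaleR)
  then have "matrix_inv (g c x) *v (g c x *v (aG + (\<mu> - 1) *\<^sub>R (oproj (g c x) (LT c x) *v aG))) = matrix_inv (g c x) *v (g c x *v (\<mu> *\<^sub>R a))"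
    by (rule arg_cong)
  then have e: "aG + (\<mu> - 1) *\<^sub>R (oproj (g c x) (LT c x) *v aG) = \<mu> *\<^sub>R a"
    by (simp add: matrix_vector_mul_assoc matrix_inv_both(2)[OF spd_invertible[OF B]])
  \<comment> \<open>The horizontal projection removes the vertical correction.\<close>
  have "hproj F g c x (aG + (\<mu> - 1) *\<^sub>R (oproj (g c x) (LT c x) *v aG)) = hproj F g c x aG"
    by (simp add: hproj_g[OF c(1,2)] matrix_vector_right_distrib matrix_vector_mult_scaleR oproj_id[OF B V oproj_in[OF B V]])
  then have "hproj F g c x aG = \<mu> *\<^sub>R hproj F g c x a" unfolding e hproj_scale[OF c(1,2)] by simp
  then show ?thesis unfolding hproj_rescaled[OF mu c(1,2)] a_def aG_def .
qed

lemma vertical_frame_scale: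
  assumes c: "c \<in> A" "x \<in> fst c" and vf: "vertical_frame F m c x K E" and s: "s \<noteq> 0"
    and ip: "\<And>u v. u \<in> LT c x \<Longrightarrow> v \<in> LT c x \<Longrightarrow> ip n c x (s *\<^sub>R u) (s *\<^sub>R v) = ip m c x u v"
  shows "vertical_frame F n c x K (\<lambda>i z. s *\<^sub>R E i z)"
proof -
  obtain W where W: "open W" "snd c x \<in> W" "W \<subseteq> chart_range c"
    "\<And>i. i \<in> K \<Longrightarrow> smooth_on W (E i)" "\<And>i z. i \<in> K \<Longrightarrow> z \<in> W \<Longrightarrow> E i z \<in> LT c (chart_inv c z)"
    using vf unfolding vertical_frame_def by auto
  have on: "\<And>i j. i \<in> K \<Longrightarrow> j \<in> K \<Longrightarrow> ip m c x (E i (snd c x)) (E j (snd c x)) = (if i = j then 1 else 0)"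
    and sp: "span ((\<lambda>i. E i (snd c x)) ` K) = LT c x"
    using vf unfolding vertical_frame_def by auto
  note V = LT_subspace[OF c]
  have inV: "E i (snd c x) \<in> LT c x" if "i \<in> K" for i using W(5)[OF that W(2)] c by simp
  show ?thesis unfolding vertical_frame_def
  proof (intro conjI exI[of _ W] W(1-3) ballI)
    fix i assume i: "i \<in> K"
    show "smooth_on W (\<lambda>z. s *\<^sub>R E i z)" by (intro smooth_on_scaleR W(1) smooth_on_const W(4)[OF i])
    fix z assume z: "z \<in> W"
    have "subspace (LT c (chart_inv c z))" by (rule LT_subspace[OF c(1) chart_inv_in[OF c(1) subsetD[OF W(3) z]]])
    then show "s *\<^sub>R E i z \<in> LT c (chart_inv c z)" using W(5)[OF i z] by (rule subspace_scale)
  next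
    fix i j assume "i \<in> K" "j \<in> K"
    then show "ip n c x (s *\<^sub>R E i (snd c x)) (s *\<^sub>R E j (snd c x)) = (if i = j then 1 else 0)"
      using ip[OF inV inV] on by simp
  next
    have "(\<lambda>i. s *\<^sub>R E i (snd c x)) ` K = (*\<^sub>R) s ` ((\<lambda>i. E i (snd c x)) ` K)" by (simp add: image_image)
    then have "span ((\<lambda>i. s *\<^sub>R E i (snd c x)) ` K) = (*\<^sub>R) s ` LT c x"
      using linear_span_image[of "(*\<^sub>R) s" "(\<lambda>i. E i (snd c x)) ` K"] sp by (simp add: linear_scale_self)
    also have "\<dots> = LT c x"
    proof (intro equalityI subsetI)
      fix v assume "v \<in> (*\<^sub>R) s ` LT c x" then show "v \<in> LT c x" using subspace_scale[OF V] by auto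
    next
      fix v assume "v \<in> LT c x"
      then have "(1 / s) *\<^sub>R v \<in> LT c x" by (rule subspace_scale[OF V])
      then show "v \<in> (*\<^sub>R) s ` LT c x" using s by (intro image_eqI[of _ _ "(1 / s) *\<^sub>R v"]) simp_all
    qed
    finally show "span ((\<lambda>i. s *\<^sub>R E i (snd c x)) ` K) = LT c x" .
  qed
qed

lemma vertical_frame_smooth:
  assumes "vertical_frame F m c x K E" "i \<in> K"
  obtains W where "open W" "snd c x \<in> W" "W \<subseteq> chart_range c" "smooth_on W (E i)" "\<And>z. z \<in> W \<Longrightarrow> E i z \<in> LT c (chart_inv c z)"
  using assms unfolding vertical_frame_def by auto

lemma covariant_scale:
  assumes "foliated_metric A F T m" and c: "c \<in> A" "x \<in> fst c" "x \<in> T" and E: "E differentiable at (snd c x)"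
  shows "covariant_derivative m c x (\<lambda>z. s *\<^sub>R E z) (\<lambda>z. s *\<^sub>R E z) = s\<^sup>2 *\<^sub>R covariant_derivative m c x E E"
proof -
  interpret M: foliated_metric A F T m by (rule assms(1))
  have dE: "(E has_derivative frechet_derivative E (at (snd c x))) (at (snd c x))" using E unfolding frechet_derivative_works .
  have md: "M.metric_coord c differentiable at (snd c x)"
    by (rule smooth_on_imp_differentiable[OF M.metric_coord_smooth[OF c(1)]]) (use c in auto)
  have "frechet_derivative (\<lambda>z. s *\<^sub>R E z) (at (snd c x)) = (\<lambda>v. s *\<^sub>R frechet_derivative E (at (snd c x)) v)"
    by (rule frechet_derivative_eq[OF has_derivative_scaleR_right[OF dE]])
  then show ?thesis
    unfolding covariant_derivative_def M.christoffel_eq_coord[OF c(1,2)] christoffel_coord_scale[OF md]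
    using linear_cmul[OF linear_frechet_derivative[OF E]] by (simp add: scaleR_add_right power2_eq_square)
qed

text \<open>
  Multiplication by \<open>\<surd>\<mu>\<close> turns orthonormal frames of the leaf for the rescaled metric into orthonormal
  frames for the original one.  It multiplies accelerations by \<open>\<mu>\<close>, which compensates the factor in the
  horizontal parts.  Both metrics therefore admit the same values of the trace over orthonormal frames,
  and the descriptions that define the two mean curvature vectors are the same predicate.
\<close>

lemma mean_curvature_rescaled:
  assumes mu: "\<mu> > 0" and c: "c \<in> A" "x \<in> fst c" "x \<in> reg"
  shows "mean_curvature F (rescaled \<mu>) c x = mean_curvature F g c x"
proof -
  let ?h = "\<lambda>m E. hproj F m c x (covariant_derivative m c x E E)"
  have rr: "foliated_metric A F UNIV g" by unfold_locales
  have ipV: "ip (rescaled \<mu>) c x (s *\<^sub>R u) (s *\<^sub>R v) = s\<^sup>2 * \<mu> * ip g c x u v" if "v \<in> LT c x" for s u v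
    unfolding ip_def rescaled_at[OF c(1,2)]
    by (simp add: matrix_vector_mult_scaleR rescale_vert[OF spd_g[OF c(1,2)] LT_subspace[OF c(1,2)] that] power2_eq_square)
  have acc: "?h (rescaled \<mu>) (E i) = \<mu> *\<^sub>R ?h g (E i)"
    and dif: "E i differentiable at (snd c x)"
    if vf: "vertical_frame F m c x K E" and i: "i \<in> K" for m K E i
  proof -
    obtain W where W: "open W" "snd c x \<in> W" "W \<subseteq> chart_range c" "smooth_on W (E i)" "\<And>z. z \<in> W \<Longrightarrow> E i z \<in> LT c (chart_inv c z)"
      by (rule vertical_frame_smooth[OF vf i]) (rule that)
    show "?h (rescaled \<mu>) (E i) = \<mu> *\<^sub>R ?h g (E i)"
      by (rule hproj_acceleration_rescaled[OF mu c W])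
    show "E i differentiable at (snd c x)" by (rule smooth_on_imp_differentiable[OF W(4,2)])
  qed
  let ?P = "\<lambda>m h. \<exists>K E. vertical_frame F m c x K E \<and> h = (\<Sum>i\<in>K. ?h m (E i))"
  have "?P (rescaled \<mu>) h \<longleftrightarrow> ?P g h" for h
  proof
    assume "?P (rescaled \<mu>) h"
    then obtain K E where vf: "vertical_frame F (rescaled \<mu>) c x K E"
      and h: "h = (\<Sum>i\<in>K. ?h (rescaled \<mu>) (E i))" by (elim exE conjE)
    define E' where "E' = (\<lambda>i z. sqrt \<mu> *\<^sub>R E i z)"
    have "vertical_frame F g c x K E'"
      unfolding E'_def
    proof (rule vertical_frame_scale[OF c(1,2) vf])
      fix u v assume "u \<in> LT c x" "v \<in> LT c x"
      then show "ip g c x (sqrt \<mu> *\<^sub>R u) (sqrt \<mu> *\<^sub>R v) = ip (rescaled \<mu>) c x u v"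
        using ipV[of v 1 u] mu by (simp add: ip_def matrix_vector_mult_scaleR mult.assoc[symmetric])
    qed (use mu in simp)
    moreover have "?h g (E' i) = ?h (rescaled \<mu>) (E i)"
      if "i \<in> K" for i
      unfolding E'_def covariant_scale[OF rr c(1,2) UNIV_I dif[OF vf that]] hproj_scale[OF c(1,2)] acc[OF vf that] using mu by simp
    ultimately show "?P g h"
      unfolding h by (intro exI[of _ K] exI[of _ E'] conjI sum.cong) simp_all
  next
    assume "?P g h"
    then obtain K E where vf: "vertical_frame F g c x K E"
      and h: "h = (\<Sum>i\<in>K. ?h g (E i))" by (elim exE conjE)
    define E' where "E' = (\<lambda>i z. (1 / sqrt \<mu>) *\<^sub>R E i z)"
    have sq: "(1 / sqrt \<mu>)\<^sup>2 = 1 / \<mu>" using mu by (simp add: power_divide)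
    have "vertical_frame F (rescaled \<mu>) c x K E'"
      unfolding E'_def
    proof (rule vertical_frame_scale[OF c(1,2) vf])
      fix u v assume "u \<in> LT c x" "v \<in> LT c x"
      then show "ip (rescaled \<mu>) c x ((1 / sqrt \<mu>) *\<^sub>R u) ((1 / sqrt \<mu>) *\<^sub>R v) = ip g c x u v"
        using ipV[of v "1 / sqrt \<mu>" u] mu unfolding sq by simp
    qed (use mu in simp)
    moreover have "?h (rescaled \<mu>) (E' i) = ?h g (E i)"
      if "i \<in> K" for i
      unfolding E'_def covariant_scale[OF rescaled_foliated_metric[OF mu] c dif[OF vf that]] hproj_rescaled[OF mu c(1,2)] hproj_scale[OF c(1,2)]
      unfolding hproj_rescaled[OF mu c(1,2), symmetric] acc[OF vf that] sq using mu by simp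
    ultimately show "?P (rescaled \<mu>) h"
      unfolding h by (intro exI[of _ K] exI[of _ E'] conjI sum.cong) simp_all
  qed
  then show ?thesis unfolding mean_curvature_def by simp
qed

lemma rescaled_isoparametric:
  assumes mu: "\<mu> > 0" and gi: "generalized_isoparametric A F g"
  shows "generalized_isoparametric A F (rescaled \<mu>)"
proof -
  note mc = mean_curvature_rescaled[OF mu]
  have b: "basic_vector_field A F g reg (mean_curvature F g)" using gi unfolding generalized_isoparametric_def .
  have h: "ip (rescaled \<mu>) c x (mean_curvature F (rescaled \<mu>) c x) v = 0"
    if c: "c \<in> A" "x \<in> fst c \<inter> reg" and v: "v \<in> LT c x" for c x v
  proof -
    have x: "x \<in> fst c" "x \<in> reg" using c by auto
    have "ip g c x (mean_curvature F g c x) v = 0" using b c v unfolding basic_vector_field_def by blast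
    then show ?thesis
      unfolding ip_def mc[OF c(1) x] rescaled_at[OF c(1) x(1)]
      by (simp add: rescale_orth_iff[OF spd_g[OF c(1) x(1)] LT_subspace[OF c(1) x(1)] mu v])
  qed
  have d: "dfun c f x (mean_curvature F (rescaled \<mu>) c x) = dfun d f y (mean_curvature F (rescaled \<mu>) d y)"
    if U: "open U \<and> U \<subseteq> reg \<and> saturated F U \<and> smooth_fun A U f \<and> basic_on F U f"
      and c: "c \<in> A" "d \<in> A" "x \<in> fst c \<inter> U" "y \<in> fst d \<inter> U" "leaf_of F x = leaf_of F y" for U f c d x y
  proof -
    have x: "x \<in> fst c" "x \<in> reg" "y \<in> fst d" "y \<in> reg" using c U by auto
    have "dfun c f x (mean_curvature F g c x) = dfun d f y (mean_curvature F g d y)"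
      using b U c unfolding basic_vector_field_def by blast
    then show ?thesis unfolding mc[OF c(1) x(1,2)] mc[OF c(2) x(3,4)] .
  qed
  show ?thesis unfolding generalized_isoparametric_def basic_vector_field_def
  proof (intro conjI allI impI ballI)
    fix c x v assume "c \<in> A" "x \<in> fst c \<inter> reg" "v \<in> LT c x"
    then show "ip (rescaled \<mu>) c x (mean_curvature F (rescaled \<mu>) c x) v = 0" by (rule h)
  next
    fix U f c d x y
    assume "open U \<and> U \<subseteq> reg \<and> saturated F U \<and> smooth_fun A U f \<and> basic_on F U f"
      "c \<in> A" "d \<in> A" "x \<in> fst c \<inter> U" "y \<in> fst d \<inter> U" "leaf_of F x = leaf_of F y"
    then show "dfun c f x (mean_curvature F (rescaled \<mu>) c x) = dfun d f y (mean_curvature F (rescaled \<mu>) d y)" by (rule d)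
  qed
qed

section \<open>The basic Laplacian and its spectrum\<close>

lemma smooth_fun_chart: "smooth_fun A UNIV f \<Longrightarrow> c \<in> A \<Longrightarrow> smooth_on (chart_range c) (f \<circ> chart_inv c)"
  unfolding smooth_fun_def chart_image_UNIV by (rule bspec)

lemma grad_smooth:
  assumes c: "c \<in> A" and f: "smooth_fun A UNIV f"
  shows "smooth_on (chart_range c) (\<lambda>z. grad g c f (chart_inv c z))"
proof -
  have R: "open (chart_range c)" by (rule chart_range_open[OF c])
  have fs: "smooth_on (chart_range c) (f \<circ> chart_inv c)"
    by (rule smooth_fun_chart[OF f c])
  have "smooth_on (chart_range c) (\<lambda>z. matrix_inv (metric_coord c z) *v (\<chi> i. frechet_derivative (f \<circ> chart_inv c) (at z) (axis i 1)))"
    by (intro smooth_on_matvec R smooth_on_matrix_inv spd_invertible[OF spd_metric_coord[OF c]] metric_coord_smooth_range c smooth_on_vecI,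
        assumption, unfold vec_lambda_beta, intro smooth_on_dir_deriv R fs smooth_on_const)
  moreover have "grad g c f (chart_inv c z) = matrix_inv (metric_coord c z) *v (\<chi> i. frechet_derivative (f \<circ> chart_inv c) (at z) (axis i 1))"
    if "z \<in> chart_range c" for z
    unfolding grad_def dfun_def metric_coord_def using chart_inv_right[OF c that] by simp
  ultimately show ?thesis using smooth_on_cong[OF R] by (metis (no_types, lifting))
qed

lemma density_grad_smooth:
  assumes c: "c \<in> A" and f: "smooth_fun A UNIV f"
  shows "smooth_on (chart_range c) (\<lambda>z. sqrt (det (metric_coord c z)))"
    "smooth_on (chart_range c) (\<lambda>z. sqrt (det (metric_coord c z)) * grad g c f (chart_inv c z) $ i)"
proof -
  have R: "open (chart_range c)" by (rule chart_range_open[OF c])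
  show s: "smooth_on (chart_range c) (\<lambda>z. sqrt (det (metric_coord c z)))"
    by (intro smooth_on_sqrt R smooth_on_det metric_coord_smooth_range c spd_det_pos spd_metric_coord)
  show "smooth_on (chart_range c) (\<lambda>z. sqrt (det (metric_coord c z)) * grad g c f (chart_inv c z) $ i)"
    by (intro smooth_on_mult smooth_on_nth R s grad_smooth c f)
qed

lemma laplacian_coord:
  "c \<in> A \<Longrightarrow> x \<in> fst c \<Longrightarrow> laplacian g c f x = - (1 / sqrt (det (metric_coord c (snd c x)))) *
    (\<Sum>i\<in>UNIV. frechet_derivative (\<lambda>z. sqrt (det (metric_coord c z)) * grad g c f (chart_inv c z) $ i) (at (snd c x)) (axis i 1))"
  unfolding laplacian_def metric_coord_def by (simp only: chart_inv_left)

lemma laplacian_continuous: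
  assumes c: "c \<in> A" and f: "smooth_fun A UNIV f"
  shows "continuous_on (fst c) (laplacian g c f)"
proof -
  have R: "open (chart_range c)" by (rule chart_range_open[OF c])
  let ?L = "\<lambda>z. - (1 / sqrt (det (metric_coord c z))) *
    (\<Sum>i\<in>UNIV. frechet_derivative (\<lambda>z. sqrt (det (metric_coord c z)) * grad g c f (chart_inv c z) $ i) (at z) (axis i 1))"
  have nz: "sqrt (det (metric_coord c z)) \<noteq> 0" if "z \<in> chart_range c" for z
    using spd_det_pos[OF spd_metric_coord[OF c that]] by simp
  have "smooth_on (chart_range c) ?L"
    by (intro smooth_on_mult smooth_on_minus smooth_on_divide smooth_on_sum smooth_on_dir_deriv smooth_on_const R
        density_grad_smooth[OF c f] nz)
  then have "continuous_on (chart_range c) ?L" by (rule smooth_on_imp_continuous_on)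
  then have "continuous_on (fst c) (\<lambda>x. ?L (snd c x))"
    by (rule continuous_on_compose2[OF _ chart_continuous[OF c]]) (simp add: chart_range_def)
  then show ?thesis by (rule continuous_on_eq) (simp add: laplacian_coord[OF c])
qed

text \<open>
  On the regular set the leaf dimension \<open>k\<close> is constant, so the volume densities of the two metrics differ
  by the constant factor \<open>\<surd>(\<mu>\<^sup>k)\<close>, which cancels in the divergence; gradients of basic functions agree.
\<close>

lemma laplacian_rescaled:
  assumes mu: "\<mu> > 0" and c: "c \<in> A" "x \<in> fst c" "x \<in> reg" and f: "smooth_fun A UNIV f" "basic_on F UNIV f"
  shows "laplacian (rescaled \<mu>) c f x = laplacian g c f x"
proof -
  define k where "k = sqrt (\<mu> ^ dim (LT c x))"
  have k: "k > 0" unfolding k_def using mu by simp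
  have det: "sqrt (det (rescaled \<mu> c y)) = k * sqrt (det (g c y))" if y: "y \<in> fst c" "y \<in> reg" for y
    unfolding rescaled_at[OF c(1) y(1)] det_rescale[OF spd_g[OF c(1) y(1)] LT_subspace[OF c(1) y(1)]] k_def
      regular_dim[OF c(3) y(2) c(1,2) c(1) y(1)] by (simp add: real_sqrt_mult)
  have op: "open (snd c ` (fst c \<inter> reg))" by (rule chart_image_open[OF c(1) regular_open])
  have xo: "snd c x \<in> snd c ` (fst c \<inter> reg)" using c by blast
  have "frechet_derivative (\<lambda>z. sqrt (det (rescaled \<mu> c (chart_inv c z))) * grad (rescaled \<mu>) c f (chart_inv c z) $ i) (at (snd c x)) (axis i 1)
     = k * frechet_derivative (\<lambda>z. sqrt (det (metric_coord c z)) * grad g c f (chart_inv c z) $ i) (at (snd c x)) (axis i 1)" for i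
  proof -
    let ?h = "\<lambda>z. sqrt (det (metric_coord c z)) * grad g c f (chart_inv c z) $ i"
    have "frechet_derivative (\<lambda>z. sqrt (det (rescaled \<mu> c (chart_inv c z))) * grad (rescaled \<mu>) c f (chart_inv c z) $ i) (at (snd c x))
      = frechet_derivative (\<lambda>z. k * ?h z) (at (snd c x))"
    proof (rule frechet_derivative_cong_open[OF op xo])
      fix z assume "z \<in> snd c ` (fst c \<inter> reg)"
      then have y: "chart_inv c z \<in> fst c" "chart_inv c z \<in> reg" unfolding chart_image[OF c(1)] using c(1) by auto
      show "sqrt (det (rescaled \<mu> c (chart_inv c z))) * grad (rescaled \<mu>) c f (chart_inv c z) $ i = k * ?h z"
        unfolding det[OF y] grad_rescaled(1)[OF mu open_UNIV f c(1) y(1) UNIV_I] metric_coord_def by simp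
    qed
    moreover have "frechet_derivative (\<lambda>z. k * ?h z) (at (snd c x)) = (\<lambda>v. k * frechet_derivative ?h (at (snd c x)) v)"
      by (rule frechet_derivative_eq[OF has_derivative_mult_right[OF smooth_on_has_derivative[OF density_grad_smooth(2)[OF c(1) f(1)] chart_in_range[OF c(2)]]]])
    ultimately show ?thesis by simp
  qed
  then show ?thesis
    unfolding laplacian_coord[OF c(1,2)] unfolding laplacian_def det[OF c(2,3)] using k c
    by (simp add: sum_distrib_left[symmetric])
qed

text \<open>
  An eigenfunction of a rescaled metric satisfies the eigenvalue equation of the original metric on
  the regular set, which is dense; since the original metric is smooth everywhere, both sides of the
  equation are continuous, and it holds on the whole manifold.
\<close>

lemma basic_eigenspace_rescaled:
  assumes mu: "\<mu> > 0"
  shows "basic_eigenspace A F reg (rescaled \<mu>) lam = basic_eigenspace A F UNIV g lam"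
proof (intro equalityI subsetI)
  fix f assume "f \<in> basic_eigenspace A F UNIV g lam"
  then have f: "smooth_fun A UNIV f" "basic_on F UNIV f" and e: "\<forall>c\<in>A. \<forall>x\<in>fst c \<inter> UNIV. laplacian g c f x = lam * f x"
    unfolding basic_eigenspace_def by auto
  have "laplacian (rescaled \<mu>) c f x = lam * f x" if "c \<in> A" "x \<in> fst c \<inter> reg" for c x
    using laplacian_rescaled[OF mu that(1) _ _ f, of x] e that by simp
  then show "f \<in> basic_eigenspace A F reg (rescaled \<mu>) lam" unfolding basic_eigenspace_def using f by simp
next
  fix f assume "f \<in> basic_eigenspace A F reg (rescaled \<mu>) lam"
  then have f: "smooth_fun A UNIV f" "basic_on F UNIV f" and e: "\<forall>c\<in>A. \<forall>x\<in>fst c \<inter> reg. laplacian (rescaled \<mu>) c f x = lam * f x"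
    unfolding basic_eigenspace_def by auto
  have "laplacian g c f x = lam * f x" if c: "c \<in> A" "x \<in> fst c" for c x
  proof (rule ccontr)
    assume ne: "laplacian g c f x \<noteq> lam * f x"
    have fs: "smooth_on (chart_range c) (f \<circ> chart_inv c)"
      by (rule smooth_fun_chart[OF f(1) c(1)])
    have "continuous_on (fst c) (\<lambda>x. (f \<circ> chart_inv c) (snd c x))"
      by (rule continuous_on_compose2[OF smooth_on_imp_continuous_on[OF fs] chart_continuous[OF c(1)]]) (simp add: chart_range_def)
    then have "continuous_on (fst c) f" by (rule continuous_on_eq) (simp add: c(1))
    then have "continuous_on (fst c) (\<lambda>x. laplacian g c f x - lam * f x)"
      by (intro continuous_on_diff laplacian_continuous[OF c(1) f(1)] continuous_on_mult continuous_on_const)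
    then have "open (fst c \<inter> (\<lambda>x. laplacian g c f x - lam * f x) -` (- {0}))"
      by (rule continuous_open_preimage[OF _ chart_open[OF c(1)]]) (simp add: open_Compl)
    moreover have "x \<in> fst c \<inter> (\<lambda>x. laplacian g c f x - lam * f x) -` (- {0})" using c(2) ne by simp
    moreover have "x \<in> closure reg" using fol unfolding smooth_foliation_def by simp
    ultimately obtain y where y: "y \<in> reg" "y \<in> fst c \<inter> (\<lambda>x. laplacian g c f x - lam * f x) -` (- {0})"
      unfolding closure_iff_nhds_not_empty by blast
    have "laplacian (rescaled \<mu>) c f y = lam * f y" using e c(1) y by blast
    then show False using laplacian_rescaled[OF mu c(1) _ y(1) f] y(2) by simp
  qed
  then show "f \<in> basic_eigenspace A F UNIV g lam" unfolding basic_eigenspace_def using f by simp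
qed

lemma basic_spectrum_rescaled: "\<mu> > 0 \<Longrightarrow> basic_spectrum A F reg (rescaled \<mu>) = basic_spectrum A F UNIV g"
  unfolding basic_spectrum_def by (intro ext) (simp add: basic_eigenspace_rescaled)

lemma rescaled_inj:
  assumes "\<exists>c\<in>A. \<exists>x\<in>fst c. LT c x \<noteq> {0}"
  shows "inj rescaled"
proof (rule injI)
  fix \<mu> \<nu> assume eq: "rescaled \<mu> = rescaled \<nu>"
  obtain c x where c: "c \<in> A" "x \<in> fst c" and ne: "LT c x \<noteq> {0}" using assms by auto
  note B = spd_g[OF c] and V = LT_subspace[OF c]
  obtain v where v: "v \<in> LT c x" "v \<noteq> 0" using ne subspace_0[OF V] by auto
  have "v \<bullet> (rescaled \<mu> c x *v v) = v \<bullet> (rescaled \<nu> c x *v v)" unfolding eq ..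
  then show "\<mu> = \<nu>"
    unfolding rescaled_at[OF c] rescale_vert[OF B V v(1)] using spd_pos[OF B v(2)] by simp
qed

end

theorem theorem1p4:
  fixes A :: "('m::t2_space, 'n::finite) chart set"
    and F Q :: "'m set set"
    and g gQ :: "('m, 'n) tensor2"
    and H :: "('m, 'n) vfield"
  assumes "(A, F, g) \<in> representations Q gQ"
    and "H = mean_curvature F g"
  shows "\<exists>G :: real \<Rightarrow> ('m, 'n) tensor2.
    (\<forall>\<mu>>0. (A, F, G \<mu>) \<in> representations_reg Q gQ) \<and>
    (regular_set A F = UNIV \<longrightarrow> (\<forall>\<mu>>0. (A, F, G \<mu>) \<in> representations Q gQ)) \<and>
    (\<forall>\<mu>>0. \<forall>c\<in>A. \<forall>x\<in>fst c \<inter> regular_set A F.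
       G \<mu> c x = gQ c x + \<mu> *\<^sub>R leaf_metric A F g c x \<and>
       mean_curvature F (G \<mu>) c x = H c x) \<and>
    ((\<exists>c\<in>A. \<exists>x\<in>fst c. leaf_tangent F c x \<noteq> {0}) \<longrightarrow>
       inj_on (\<lambda>\<mu>. (A, F, G \<mu>)) {0<..} \<and> infinite ((\<lambda>\<mu>. (A, F, G \<mu>)) ` {0<..})) \<and>
    (\<forall>\<mu>>0. \<forall>\<nu>>0. basic_spectrum A F (regular_set A F) (G \<mu>) = basic_spectrum A F (regular_set A F) (G \<nu>)) \<and>
    (\<forall>\<mu>>0. basic_spectrum A F (regular_set A F) (G \<mu>) = basic_spectrum A F UNIV g)"
proof -
  have cm: "compact_manifold A" and fol: "smooth_foliation A F" and met: "riemannian_metric A UNIV g"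
    and ad: "adapted A F UNIV g" and de: "descends A F UNIV g" and gi: "generalized_isoparametric A F g"
    and Q: "Q = F" and gQ: "gQ = transverse_metric A F g"
    using assms(1) unfolding representations_def riemannian_foliation_def by auto
  interpret foliated_riemannian A F g
    using cm fol met unfolding compact_manifold_def by unfold_locales auto
  have rf: "riemannian_foliation A F reg (rescaled \<mu>)" if "\<mu> > 0" for \<mu>
    unfolding riemannian_foliation_def
    by (intro conjI cm fol rescaled_metric rescaled_adapted rescaled_descends rescaled_isoparametric that ad de gi)
  have rep_reg: "(A, F, rescaled \<mu>) \<in> representations_reg Q gQ" if "\<mu> > 0" for \<mu>
    unfolding representations_reg_def using rf[OF that] Q gQ transverse_rescaled[OF that] by simp
  have rep_all: "(A, F, rescaled \<mu>) \<in> representations Q gQ" if "reg = UNIV" "\<mu> > 0" for \<mu>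
    unfolding representations_def using rf[OF that(2)] Q gQ transverse_rescaled[OF that(2)] that(1) by simp
  have split: "rescaled \<mu> c x = gQ c x + \<mu> *\<^sub>R leaf_metric A F g c x" "mean_curvature F (rescaled \<mu>) c x = H c x"
    if "\<mu> > 0" "c \<in> A" "x \<in> fst c \<inter> reg" for \<mu> c x
    using that rescaled_split[of c x \<mu>] mean_curvature_rescaled[of \<mu> c x] assms(2) gQ by simp_all
  have inj: "inj_on (\<lambda>\<mu>. (A, F, rescaled \<mu>)) {0<..}" if "\<exists>c\<in>A. \<exists>x\<in>fst c. LT c x \<noteq> {0}"
    using rescaled_inj[OF that] by (auto simp: inj_on_def)
  have inf: "infinite ((\<lambda>\<mu>. (A, F, rescaled \<mu>)) ` {0<..})" if "\<exists>c\<in>A. \<exists>x\<in>fst c. LT c x \<noteq> {0}"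
    using finite_imageD[OF _ inj[OF that]] infinite_Ioi by blast
  show ?thesis
    by (intro exI[of _ rescaled] conjI allI impI ballI)
       (simp_all add: rep_reg rep_all split inj inf basic_spectrum_rescaled)
qed

end
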